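(* Let $0<p\le 2$, $2<q\le\infty$, let $\mathcal H$ be a complex Hilbert space, and let $T:\ell_q^2(\mathbb C)\to\mathcal S_p(\mathcal H)$ be injective and complex-linear. Suppose that $\operatorname{rank}T(0,1)\le k<\infty$ for an integer $k$. Then $$D(T)^2\;\ge\;\sup_{0<t\le 1}\frac{1+\frac{p^2}{4}k^{1-2/p}t^2(1+t)^{p-2}}{\Phi_{p,q}(t)}\;>\;1.$$ In particular, this holds with $k=n$ for every injective complex-linear map $T:\ell_q^2(\mathbb C)\to\mathcal S_p^n$.
   Context: For a complex Hilbert space $\mathcal H$ and $0<p<\infty$, $\mathcal S_p(\mathcal H)$ is the space of compact operators $A$ on $\mathcal H$ with $\sum_j s_j(A)^p<\infty$ ($s_j(A)$ the singular values with multiplicity), with $\|A\|_p=(\sum_j s_j(A)^p)^{1/p}$; $\mathcal S_p^n=\mathcal S_p(\mathbb C^n)$. $\ell_q^2(\mathbb C)$ is $\mathbb C^2$ with $\|(a,b)\|_q=(|a|^q+|b|^q)^{1/q}$ for $q<\infty$ and $\|(a,b)\|_\infty=\max(|a|,|b|)$. For an injective complex-linear $T:\ell_q^2(\mathbb C)\to\mathcal S_p(\mathcal H)$ define $M(T)=\sup_{x\ne0}\|Tx\|_p/\|x\|_q$, $m(T)=\inf_{x\ne0}\|Tx\|_p/\|x\|_q$ and the distortion $D(T)=M(T)/m(T)$ (one has $0<m(T)\le M(T)<\infty$). For $2<q<\infty$, $\Phi_{p,q}(t)=(1+t^q)^{p/q}$; for $q=\infty$, $\Phi_{p,\infty}(t)=1$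 on $0\le t\le 1$. *)

theory Defs
  imports
    "HOL-Analysis.Analysis"
    "HOL-Library.Function_Algebras"
    "HOL-Library.Extended_Nat"
begin

class complex_vector = ab_group_add +
  fixes scaleC :: "complex \<Rightarrow> 'a \<Rightarrow> 'a"  (infixr \<open>*\<^sub>C\<close> 75)
  assumes scaleC_add_right: "a *\<^sub>C (x + y) = a *\<^sub>C x + a *\<^sub>C y"
    and scaleC_add_left: "(a + b) *\<^sub>C x = a *\<^sub>C x + b *\<^sub>C x"
    and scaleC_scaleC: "a *\<^sub>C (b *\<^sub>C x) = (a * b) *\<^sub>C x"
    and scaleC_one: "1 *\<^sub>C x = x"

global_interpretation complex_vector: vector_space "scaleC :: complex \<Rightarrow> 'a \<Rightarrow> 'a::complex_vector"
  by unfold_locales (rule scaleC_add_right scaleC_add_left scaleC_scaleC scaleC_one)+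

abbreviation cspan :: "'a::complex_vector set \<Rightarrow> 'a set"
  where "cspan \<equiv> complex_vector.span"

abbreviation cdim :: "'a::complex_vector set \<Rightarrow> nat"
  where "cdim \<equiv> complex_vector.dim"

abbreviation clinear :: "('a::complex_vector \<Rightarrow> 'b::complex_vector) \<Rightarrow> bool"
  where "clinear \<equiv> Vector_Spaces.linear scaleC scaleC"

text \<open>The real inner product (hence the norm and the topology) is the one induced by the complex
  inner product, which is conjugate-linear in the first argument.\<close>

class complex_hilbert_space = real_inner + complete_space + complex_vector +
  fixes cinner :: "'a \<Rightarrow> 'a \<Rightarrow> complex"
  assumes scaleR_scaleC: "r *\<^sub>R x = complex_of_real r *\<^sub>C x"
    and cinner_commute: "cinner x y = cnj (cinner y x)"
    and cinner_add_right: "cinner x (y + z) = cinner x y + cinner x z"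
    and cinner_scaleC_right: "cinner x (c *\<^sub>C y) = c * cinner x y"
    and inner_eq_Re_cinner: "inner x y = Re (cinner x y)"

instantiation complex :: complex_vector
begin
definition scaleC_complex :: "complex \<Rightarrow> complex \<Rightarrow> complex"
  where "scaleC_complex c z = c * z"
instance
  by standard (simp_all add: scaleC_complex_def algebra_simps)
end

instantiation prod :: (complex_vector, complex_vector) complex_vector
begin
definition scaleC_prod :: "complex \<Rightarrow> 'a \<times> 'b \<Rightarrow> 'a \<times> 'b"
  where "scaleC_prod c x = (c *\<^sub>C fst x, c *\<^sub>C snd x)"
instance
  by standard
    (simp_all add: scaleC_prod_def scaleC_add_right scaleC_add_left scaleC_scaleC scaleC_one)
end

instantiation "fun" :: (type, complex_vector) complex_vector
begin
definition scaleC_fun :: "complex \<Rightarrow> ('a \<Rightarrow> 'b) \<Rightarrow> 'a \<Rightarrow> 'b"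
  where "scaleC_fun c f = (\<lambda>x. c *\<^sub>C f x)"
instance
  by standard
    (simp_all add: scaleC_fun_def fun_eq_iff scaleC_add_right scaleC_add_left scaleC_scaleC scaleC_one)
end

instantiation vec :: (complex_vector, finite) complex_vector
begin
definition scaleC_vec :: "complex \<Rightarrow> 'a ^ 'b \<Rightarrow> 'a ^ 'b"
  where "scaleC_vec c x = (\<chi> i. c *\<^sub>C (x $ i))"
instance
  by standard
    (simp_all add: scaleC_vec_def vec_eq_iff scaleC_add_right scaleC_add_left scaleC_scaleC scaleC_one)
end

instantiation complex :: complex_hilbert_space
begin
definition cinner_complex :: "complex \<Rightarrow> complex \<Rightarrow> complex"
  where "cinner_complex x y = cnj x * y"
instance
  by standard
    (simp_all add: scaleC_complex_def cinner_complex_def algebra_simps scaleR_conv_of_real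
      inner_complex_def)
end

instantiation vec :: (complex_hilbert_space, finite) complex_hilbert_space
begin
definition cinner_vec :: "'a ^ 'b \<Rightarrow> 'a ^ 'b \<Rightarrow> complex"
  where "cinner_vec x y = (\<Sum>i\<in>UNIV. cinner (x $ i) (y $ i))"
instance
proof
  fix x y z :: "'a ^ 'b" and r :: real and c :: complex
  show "r *\<^sub>R x = complex_of_real r *\<^sub>C x"
    by (simp add: vec_eq_iff scaleC_vec_def scaleR_scaleC)
  show "cinner x y = cnj (cinner y x)"
    unfolding cinner_vec_def cnj_sum by (intro sum.cong refl cinner_commute)
  show "cinner x (y + z) = cinner x y + cinner x z"
    by (simp add: cinner_vec_def cinner_add_right sum.distrib)
  show "cinner x (c *\<^sub>C y) = c * cinner x y"
    by (simp add: cinner_vec_def scaleC_vec_def cinner_scaleC_right sum_distrib_left)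
  show "inner x y = Re (cinner x y)"
    by (simp add: cinner_vec_def inner_vec_def inner_eq_Re_cinner)
qed
end


definition compact_operator :: "('h::complex_hilbert_space \<Rightarrow> 'h) \<Rightarrow> bool"
  where "compact_operator A \<longleftrightarrow> clinear A \<and> compact (closure (A ` cball 0 1))"

definition cadjoint :: "('h::complex_hilbert_space \<Rightarrow> 'h) \<Rightarrow> 'h \<Rightarrow> 'h"
  where "cadjoint A = (THE B. \<forall>x y. cinner (A x) y = cinner x (B y))"

text \<open>The multiplicity of \<open>\<sigma> > 0\<close> as a singular value of \<open>A\<close> is the multiplicity of \<open>\<sigma>\<^sup>2\<close> as an
  eigenvalue of \<open>A\<^sup>* A\<close>.  It is \<open>0\<close> iff \<open>\<sigma>\<close> is not a singular value; for compact \<open>A\<close> these eigenspaces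
  are finite-dimensional, so the convention that \<open>cdim\<close> is \<open>0\<close> in infinite dimension plays no role.\<close>

definition sv_mult :: "('h::complex_hilbert_space \<Rightarrow> 'h) \<Rightarrow> real \<Rightarrow> nat"
  where "sv_mult A \<sigma> = cdim {v. cadjoint A (A v) = complex_of_real (\<sigma>\<^sup>2) *\<^sub>C v}"

text \<open>The nonzero singular values form the family \<open>\<sigma>\<close> indexed by \<open>(\<sigma>, i)\<close>, where each \<open>\<sigma>\<close> occurs as
  often as its multiplicity.  Zero singular values do not contribute to the sums below.\<close>

definition sv_index :: "('h::complex_hilbert_space \<Rightarrow> 'h) \<Rightarrow> (real \<times> nat) set"
  where "sv_index A = (SIGMA \<sigma>:{0<..}. {..<sv_mult A \<sigma>})"

definition schatten_class :: "real \<Rightarrow> ('h::complex_hilbert_space \<Rightarrow> 'h) set"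
  where "schatten_class p =
    {A. compact_operator A \<and> (\<lambda>(\<sigma>, i). \<sigma> powr p) summable_on sv_index A}"

definition schatten_norm :: "real \<Rightarrow> ('h::complex_hilbert_space \<Rightarrow> 'h) \<Rightarrow> real"
  where "schatten_norm p A = (\<Sum>\<^sub>\<infinity>(\<sigma>, i)\<in>sv_index A. \<sigma> powr p) powr (1 / p)"

definition crank :: "('a::complex_vector \<Rightarrow> 'b::complex_vector) \<Rightarrow> enat"
  where "crank A =
    (if \<exists>B. finite B \<and> range A \<subseteq> cspan B then enat (cdim (range A)) else \<infinity>)"


definition lq_norm :: "ereal \<Rightarrow> complex \<times> complex \<Rightarrow> real"
  where "lq_norm q x =
    (if q = \<infinity> then max (cmod (fst x)) (cmod (snd x))
     else (cmod (fst x) powr real_of_ereal q + cmod (snd x) powr real_of_ereal q)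
            powr (1 / real_of_ereal q))"

text \<open>For injective linear \<open>T\<close> into a Schatten class, the set of quotients is bounded and bounded away
  from \<open>0\<close>, so the conditionally complete supremum and infimum in \<open>\<real>\<close> are the true ones.\<close>

definition upper_const :: "real \<Rightarrow> ereal \<Rightarrow> (complex \<times> complex \<Rightarrow> 'h::complex_hilbert_space \<Rightarrow> 'h) \<Rightarrow> real"
  where "upper_const p q T = (SUP x\<in>-{0}. schatten_norm p (T x) / lq_norm q x)"

definition lower_const :: "real \<Rightarrow> ereal \<Rightarrow> (complex \<times> complex \<Rightarrow> 'h::complex_hilbert_space \<Rightarrow> 'h) \<Rightarrow> real"
  where "lower_const p q T = (INF x\<in>-{0}. schatten_norm p (T x) / lq_norm q x)"

definition distortion :: "real \<Rightarrow> ereal \<Rightarrow> (complex \<times> complex \<Rightarrow> 'h::complex_hilbert_space \<Rightarrow> 'h) \<Rightarrow> real"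
  where "distortion p q T = upper_const p q T / lower_const p q T"

definition Phi :: "real \<Rightarrow> ereal \<Rightarrow> real \<Rightarrow> real"
  where "Phi p q t =
    (if q = \<infinity> then 1 else (1 + t powr real_of_ereal q) powr (p / real_of_ereal q))"

definition distortion_bound :: "real \<Rightarrow> ereal \<Rightarrow> nat \<Rightarrow> real"
  where "distortion_bound p q k =
    (SUP t\<in>{0<..1}.
       (1 + p\<^sup>2 / 4 * real k powr (1 - 2 / p) * t\<^sup>2 * (1 + t) powr (p - 2)) / Phi p q t)"

end

(* Write A = T(1,0), B = T(0,1) and F(z) = A + z B. Since (1,z) has norm Phi(|z|)^(1/p), each
   ||F(z)||_p^p with |z| = t is at most M^p Phi(t). In the other direction z -> ||F(z)||_p^p is
   strictly subharmonic: its Laplacian is at least p^2 R^(p-2) ||B||_2^2 when R bounds the operator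
   norms of F on the disc, so some |z| = t has
     ||F(z)||_p^p >= ||A||_p^p + p^2/4 R^(p-2) t^2 ||B||_2^2.
   With R = (1+t) M, ||A||_p >= m and k^(1-2/p) ||B||_p^2 <= ||B||_2^2, multiplying by M^(2-p)/m^2
   gives the bound for D = M/m.

   Subharmonicity is proved on a finite-dimensional subspace for the regularised trace
   tr (F* F + eps)^(p/2). Comparing the eigenbases of two nearby Gram forms gives an exact Taylor
   formula with divided-difference coefficients; averaging over four points of a small circle
   leaves the divided differences of x (x^(p/2))', which are bounded below. A maximum principle
   passes from the local to the global statement, and then eps -> 0. *)

theory Submission
  imports Defs
begin

text \<open>For p < 1 the Schatten functional is only a quasi-norm, and for p < 2 the function
  x^(p/2) is singular at 0, so neither the triangle inequality nor smooth dependence of eigenvalues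
  is at hand. Only the forms <F x, F y> restricted to a finite-dimensional V are used. Max-min makes
  their diagonal sums lower bounds for Schatten sums, the right direction on the circle |z| = t; at
  z = 0 the opposite direction holds for any finite part of the singular vectors of A, because V is
  built to contain that part. V also contains the singular vectors of B, so nothing of ||B||_2 is
  lost. Eigenbases are chosen separately for each z; comparing two of them only through the doubly
  stochastic matrix |<s, t>|^2 avoids differentiating eigenvectors. The constant p^2/4 is alpha^2
  for alpha = p/2: alpha x^alpha has derivative alpha^2 x^(alpha-1), least at the largest
  eigenvalue, which R^2 + eps bounds. Finite rank of T(0,1) enters twice: in comparing ||B||_p with
  ||B||_2, and in showing that M is finite.\<close>

section \<open>Algebra of the complex inner product\<close>

lemma cinner_add_left: "cinner (x + y) z = cinner x z + cinner y z"
  for x y z :: "'h::complex_hilbert_space"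
  by (metis cinner_add_right cinner_commute complex_cnj_add)

lemma cinner_scaleC_left: "cinner (c *\<^sub>C x) y = cnj c * cinner x y"
  for x y :: "'h::complex_hilbert_space"
  by (metis cinner_scaleC_right cinner_commute complex_cnj_mult)

lemma cinner_zero [simp]: "cinner x 0 = 0" "cinner 0 x = 0" for x :: "'h::complex_hilbert_space"
  using cinner_add_right[of x 0 0] cinner_add_left[of 0 0 x] by simp_all

lemma cinner_minus [simp]: "cinner x (- y) = - cinner x y" "cinner (- x) y = - cinner x y"
  for x y :: "'h::complex_hilbert_space"
  using cinner_add_right[of x y "- y"] cinner_add_left[of x "- x" y]
  by (simp_all add: add_eq_0_iff)

lemma cinner_diff_right: "cinner x (y - z) = cinner x y - cinner x z"
  for x y z :: "'h::complex_hilbert_space"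
  using cinner_add_right[of x y "- z"] by simp

lemma cinner_diff_left: "cinner (x - y) z = cinner x z - cinner y z"
  for x y z :: "'h::complex_hilbert_space"
  using cinner_add_left[of x "- y" z] by simp

lemma cinner_sum_right: "cinner x (sum f S) = (\<Sum>i\<in>S. cinner x (f i))"
  for x :: "'h::complex_hilbert_space"
  by (induction S rule: infinite_finite_induct) (simp_all add: cinner_add_right)

lemma cinner_sum_left: "cinner (sum f S) x = (\<Sum>i\<in>S. cinner (f i) x)"
  for x :: "'h::complex_hilbert_space"
  by (induction S rule: infinite_finite_induct) (simp_all add: cinner_add_left)

lemma cinner_self: "cinner x x = complex_of_real ((norm x)\<^sup>2)"
  for x :: "'h::complex_hilbert_space"
proof (rule complex_eqI)
  show "Re (cinner x x) = Re (complex_of_real ((norm x)\<^sup>2))"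
    by (simp add: inner_eq_Re_cinner[symmetric] power2_norm_eq_inner)
  have "Im (cinner x x) = - Im (cinner x x)"
    by (metis cinner_commute cnj.simps(2))
  then show "Im (cinner x x) = Im (complex_of_real ((norm x)\<^sup>2))" by simp
qed

lemma cinner_self_eq_0 [simp]: "cinner x x = 0 \<longleftrightarrow> x = 0" for x :: "'h::complex_hilbert_space"
  by (simp add: cinner_self)

lemma cinner_eq_0_commute: "cinner x y = 0 \<longleftrightarrow> cinner y x = 0"
  for x y :: "'h::complex_hilbert_space"
  by (metis cinner_commute complex_cnj_zero)

lemma norm_cinner_commute: "cmod (cinner x y) = cmod (cinner y x)"
  for x y :: "'h::complex_hilbert_space"
  by (metis cinner_commute complex_mod_cnj)

lemma norm_scaleC: "norm (c *\<^sub>C x) = cmod c * norm x" for x :: "'h::complex_hilbert_space"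
proof -
  have "complex_of_real ((norm (c *\<^sub>C x))\<^sup>2) = complex_of_real ((cmod c * norm x)\<^sup>2)"
    unfolding cinner_self[symmetric] cinner_scaleC_left cinner_scaleC_right
    by (auto simp add: cinner_self power_mult_distrib complex_norm_square mult_ac simp del: of_real_power)
  then have "(norm (c *\<^sub>C x))\<^sup>2 = (cmod c * norm x)\<^sup>2" by (simp only: of_real_eq_iff)
  then show ?thesis by (simp add: power2_eq_iff_nonneg)
qed

text \<open>The real Cauchy-Schwarz inequality bounds only the real part; rotating \<open>y\<close>
  by the phase \<open>c\<close> makes the whole complex inner product real and nonnegative.\<close>

lemma norm_cinner_le: "cmod (cinner x y) \<le> norm x * norm y"
  for x y :: "'h::complex_hilbert_space"
proof (cases "cinner x y = 0")
  case False
  define c where "c = cnj (cinner x y) / of_real (cmod (cinner x y))"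
  have c: "cmod c = 1" using False by (simp add: c_def norm_divide)
  have "c * cinner x y = of_real (cmod (cinner x y))"
    using False by (simp add: c_def complex_norm_square[symmetric] mult.commute power2_eq_square)
  then have "cmod (cinner x y) = inner x (c *\<^sub>C y)"
    by (simp add: inner_eq_Re_cinner cinner_scaleC_right)
  also have "\<dots> \<le> norm x * norm (c *\<^sub>C y)" by (rule norm_cauchy_schwarz)
  finally show ?thesis by (simp add: norm_scaleC c)
qed simp

lemma bounded_linear_cinner_right: "bounded_linear (cinner x)"
  for x :: "'h::complex_hilbert_space"
  by (rule bounded_linear_intro[where K = "norm x"])
    (simp_all add: cinner_add_right scaleR_scaleC[where 'a = 'h] cinner_scaleC_right
      scaleR_conv_of_real norm_cinner_le mult.commute[of _ "norm x"])

lemma cinner_ext: "(\<And>z. cinner z x = cinner z y) \<Longrightarrow> x = y" for x y :: "'h::complex_hilbert_space"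
  using cinner_self_eq_0[of "x - y"] by (simp add: cinner_diff_right)

lemma norm_add_squared: "(norm (x + y))\<^sup>2 = (norm x)\<^sup>2 + 2 * Re (cinner x y) + (norm y)\<^sup>2"
  for x y :: "'h::complex_hilbert_space"
  by (simp add: power2_norm_eq_inner inner_eq_Re_cinner[symmetric] inner_add_left inner_add_right
      inner_commute)

subsection \<open>Adjoints\<close>

text \<open>The parallelogram law turns near-optimality into a bound of this shape; it yields both
  the Riesz representation and the attainment of operator norms.\<close>

lemma minimizing_sequence_Cauchy:
  fixes X :: "nat \<Rightarrow> 'a::real_inner"
  assumes "\<And>m n. (norm (X m - X n))\<^sup>2 \<le> r m + r n" and "r \<longlonglongrightarrow> 0"
  shows "Cauchy X"
proof (rule metric_CauchyI)
  fix e :: real assume "0 < e"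
  then have "\<forall>\<^sub>F n in sequentially. r n < e\<^sup>2 / 2"
    using order_tendstoD(2)[OF assms(2), of "e\<^sup>2 / 2"] by simp
  then obtain N where N: "\<And>n. N \<le> n \<Longrightarrow> r n < e\<^sup>2 / 2"
    by (auto simp: eventually_sequentially)
  have "dist (X m) (X n) < e" if "N \<le> m" "N \<le> n" for m n
  proof -
    have "(norm (X m - X n))\<^sup>2 < e\<^sup>2"
      using assms(1)[of m n] N[OF that(1)] N[OF that(2)] by linarith
    then show ?thesis using \<open>0 < e\<close> by (simp add: dist_norm power2_less_imp_less)
  qed
  then show "\<exists>M. \<forall>m\<ge>M. \<forall>n\<ge>M. dist (X m) (X n) < e" by blast
qed

text \<open>First-order condition of the variational arguments: a quadratic in \<open>s\<close> that
  is minimal at \<open>s = 0\<close> has no linear term.\<close>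

lemma quadratic_nonneg_imp_zero:
  fixes a b :: real
  assumes "\<And>s. 0 \<le> a * s\<^sup>2 + 2 * b * s"
  shows "b = 0"
proof (rule ccontr)
  assume "b \<noteq> 0"
  define c where "c = \<bar>a\<bar> + 1"
  have c0: "c \<noteq> 0" by (simp add: c_def)
  have "0 \<le> a * (- b / c)\<^sup>2 + 2 * b * (- b / c)" by (rule assms)
  also have "\<dots> = (b\<^sup>2 / c) * (a / c - 2)"
    using c0 by (simp add: power2_eq_square field_simps)
  finally have *: "0 \<le> (b\<^sup>2 / c) * (a / c - 2)" .
  have "a / c < 1" using abs_ge_self[of a] by (simp add: c_def divide_less_eq)
  moreover have "0 < b\<^sup>2 / c" using \<open>b \<noteq> 0\<close> by (simp add: c_def)
  ultimately have "(b\<^sup>2 / c) * (a / c - 2) < 0" by (intro mult_pos_neg) auto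
  with * show False by simp
qed

text \<open>The representing vector is the minimiser of the squared norm minus
  \<open>2 * f x\<close>. Completeness provides it as the limit of a minimising sequence, and the
  first-order condition in every direction \<open>y\<close> identifies it.\<close>

lemma riesz_representation:
  fixes f :: "'a::{real_inner, complete_space} \<Rightarrow> real"
  assumes "bounded_linear f"
  obtains z where "\<And>x. f x = inner x z"
proof -
  interpret f: bounded_linear f by fact
  define q where "q x = (norm x)\<^sup>2 - 2 * f x" for x
  obtain C where C: "\<And>x. \<bar>f x\<bar> \<le> norm x * C" using f.bounded by auto
  have lb: "- C\<^sup>2 \<le> q x" for x
    using C[of x] zero_le_power2[of "norm x - C"] unfolding q_def power2_diff by (simp add: abs_le_iff)
  then have bdd: "bdd_below (range q)" by (intro bdd_belowI[of _ "- C\<^sup>2"]) auto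
  define d where "d = Inf (range q)"
  have d: "d \<le> q x" for x unfolding d_def by (intro cInf_lower bdd) auto
  have "\<exists>x. q x < d + 1 / real (Suc n)" for n
    using cInf_lessD[of "range q" "d + 1 / real (Suc n)"] by (auto simp: d_def)
  then obtain X where X: "\<And>n. q (X n) < d + 1 / real (Suc n)" by metis
  have par: "(norm (x - y))\<^sup>2 = 2 * q x + 2 * q y - 4 * q ((1/2) *\<^sub>R (x + y))" for x y
    unfolding q_def by (simp add: power2_norm_eq_inner f.add f.scaleR inner_commute algebra_simps)
  have "(norm (X m - X n))\<^sup>2 \<le> 2 / real (Suc m) + 2 / real (Suc n)" for m n
    using X[of m] X[of n] d[of "(1/2) *\<^sub>R (X m + X n)"] par[of "X m" "X n"] by simp
  moreover have "(\<lambda>n. 2 / real (Suc n)) \<longlonglongrightarrow> 0"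
    using tendsto_mult[OF tendsto_const[of 2] LIMSEQ_inverse_real_of_nat] by (simp add: inverse_eq_divide)
  ultimately have "Cauchy X" by (rule minimizing_sequence_Cauchy)
  then obtain z where z: "X \<longlonglongrightarrow> z" using Cauchy_convergent convergent_def by blast
  have "(\<lambda>n. q (X n)) \<longlonglongrightarrow> q z"
    unfolding q_def by (intro tendsto_intros z f.tendsto)
  moreover have "(\<lambda>n. d + 1 / real (Suc n)) \<longlonglongrightarrow> d + 0"
    by (intro tendsto_add tendsto_const lim_1_over_n[THEN LIMSEQ_Suc])
  ultimately have "q z \<le> d + 0" by (rule LIMSEQ_le) (meson X less_imp_le)
  have "f y = inner y z" for y
  proof -
    have "0 \<le> (norm y)\<^sup>2 * s\<^sup>2 + 2 * (inner y z - f y) * s" for s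
    proof -
      have "q z \<le> q (z + s *\<^sub>R y)" using \<open>q z \<le> d + 0\<close> d[of "z + s *\<^sub>R y"] by simp
      then show ?thesis unfolding q_def
        by (simp only: power2_norm_eq_inner)
          (simp add: f.add f.scaleR inner_commute power2_eq_square algebra_simps)
    qed
    then have "inner y z - f y = 0" by (rule quadratic_nonneg_imp_zero)
    then show ?thesis by simp
  qed
  then show ?thesis by (rule that)
qed

lemma compact_operator_add: "compact_operator F \<Longrightarrow> F (x + y) = F x + F y"
  for F :: "'h::complex_hilbert_space \<Rightarrow> 'h"
  by (simp add: compact_operator_def linear_iff Vector_Spaces.linear_iff)

lemma compact_operator_scaleC: "compact_operator F \<Longrightarrow> F (c *\<^sub>C x) = c *\<^sub>C F x"
  for F :: "'h::complex_hilbert_space \<Rightarrow> 'h"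
  by (simp add: compact_operator_def Vector_Spaces.linear_iff)

lemma compact_operator_scaleR: "compact_operator F \<Longrightarrow> F (c *\<^sub>R x) = c *\<^sub>R F x"
  for F :: "'h::complex_hilbert_space \<Rightarrow> 'h"
  by (simp add: scaleR_scaleC compact_operator_scaleC)

lemma compact_operator_bounded_linear:
  fixes F :: "'h::complex_hilbert_space \<Rightarrow> 'h"
  assumes F: "compact_operator F"
  shows "bounded_linear F"
proof -
  have "bounded (F ` cball 0 1)"
    using F bounded_subset[OF compact_imp_bounded closure_subset] by (auto simp: compact_operator_def)
  then obtain C where C: "\<And>x. norm x \<le> 1 \<Longrightarrow> norm (F x) \<le> C"
    by (force simp: bounded_iff)
  have "norm (F x) \<le> norm x * C" for x
  proof (cases "x = 0")
    case True
    then show ?thesis using compact_operator_scaleR[OF F, of 0 x] by simp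
  next
    case False
    have "norm (F ((1 / norm x) *\<^sub>R x)) \<le> C" using False by (intro C) simp
    then show ?thesis using False by (simp add: compact_operator_scaleR[OF F] divide_le_eq mult.commute)
  qed
  then show ?thesis
    by (intro bounded_linear_intro[where K = C] compact_operator_add[OF F] compact_operator_scaleR[OF F])
qed

text \<open>Justifies the definite description in \<open>cadjoint\<close>. Riesz gives a
  representing vector for the real inner product; replacing \<open>x\<close> by
  \<open>\<i> *\<^sub>C x\<close> recovers the imaginary parts, so it represents the complex one as
  well.\<close>

lemma cinner_cadjoint:
  fixes F :: "'h::complex_hilbert_space \<Rightarrow> 'h"
  assumes F: "compact_operator F"
  shows "cinner (F x) y = cinner x (cadjoint F y)"
proof -
  have "\<exists>z. \<forall>x. cinner (F x) y = cinner x z" for y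
  proof -
    have "bounded_linear (\<lambda>x. inner (F x) y)"
      using bounded_linear_compose[OF bounded_linear_inner_left compact_operator_bounded_linear[OF F]]
      by (simp add: o_def)
    then obtain z where z: "\<And>x. inner (F x) y = inner x z" by (rule riesz_representation) auto
    have "cinner (F x) y = cinner x z" for x
    proof (rule complex_eqI)
      show "Re (cinner (F x) y) = Re (cinner x z)" using z by (simp add: inner_eq_Re_cinner)
      show "Im (cinner (F x) y) = Im (cinner x z)"
        using z[of "\<i> *\<^sub>C x"]
        by (simp add: inner_eq_Re_cinner compact_operator_scaleC[OF F] cinner_scaleC_left)
    qed
    then show ?thesis by blast
  qed
  then obtain B where B: "\<And>x y. cinner (F x) y = cinner x (B y)" by metis
  have "cadjoint F = B" unfolding cadjoint_def
  proof (rule the_equality)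
    fix B' assume B': "\<forall>x y. cinner (F x) y = cinner x (B' y)"
    show "B' = B"
    proof
      fix y show "B' y = B y" by (rule cinner_ext) (simp add: B'[rule_format, symmetric] B)
    qed
  qed (use B in blast)
  then show ?thesis using B by simp
qed

text \<open>Rewrites the eigenvalue equation of \<open>F* F\<close> through the Gram form of
  \<open>F\<close>. All later arguments see the adjoint only through this equivalence.\<close>

lemma cadjoint_comp_eq_iff:
  fixes F :: "'h::complex_hilbert_space \<Rightarrow> 'h"
  assumes "compact_operator F"
  shows "cadjoint F (F x) = c *\<^sub>C x \<longleftrightarrow> (\<forall>y. cinner (F y) (F x) = c * cinner y x)"
proof
  assume "\<forall>y. cinner (F y) (F x) = c * cinner y x"
  then show "cadjoint F (F x) = c *\<^sub>C x"
    by - (rule cinner_ext, simp add: cinner_cadjoint[OF assms, symmetric] cinner_scaleC_right)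
qed (simp add: cinner_cadjoint[OF assms] cinner_scaleC_right)

section \<open>Vectors at which a compact operator attains its norm\<close>

abbreviation csubspace :: "'a::complex_vector set \<Rightarrow> bool"
  where "csubspace \<equiv> complex_vector.subspace"

text \<open>Compactness makes the images of a maximising sequence converge along a subsequence. The
  subsequence itself then converges in norm: \<open>F\<close> of a sum of two late terms has norm
  near \<open>2 * s\<close>, so the sum has norm near 2, and the parallelogram law makes the
  difference small. No weak topology enters.\<close>

lemma compact_operator_norm_attained:
  fixes F :: "'h::complex_hilbert_space \<Rightarrow> 'h"
  assumes F: "compact_operator F" and W: "csubspace W" "closed W" and w: "w \<in> W" "w \<noteq> 0"
  obtains x where "x \<in> W" "norm x = 1" "\<And>y. y \<in> W \<Longrightarrow> norm (F y) \<le> norm (F x) * norm y"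
proof -
  interpret F: bounded_linear F by (rule compact_operator_bounded_linear[OF F])
  have WR: "c *\<^sub>R y \<in> W" if "y \<in> W" for c y
    using W(1) that by (simp add: scaleR_scaleC complex_vector.subspace_scale)
  have Wadd: "x + y \<in> W" if "x \<in> W" "y \<in> W" for x y
    using W(1) that by (rule complex_vector.subspace_add)
  define N where "N = {norm (F y) |y. y \<in> W \<and> norm y = 1}"
  obtain K where K: "\<And>x. norm (F x) \<le> norm x * K" using F.bounded by blast
  have bdd: "bdd_above N"
  proof (rule bdd_aboveI[of _ K])
    show "x \<le> K" if "x \<in> N" for x
    proof -
      from that obtain y where "x = norm (F y)" "norm y = 1" by (auto simp: N_def)
      then show ?thesis using K[of y] by simp
    qed
  qed
  define e where "e = (1 / norm w) *\<^sub>R w"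
  have e: "e \<in> W" "norm e = 1" using w by (auto simp: e_def WR)
  have N_ne: "N \<noteq> {}" using e by (auto simp: N_def)
  define s where "s = Sup N"
  have le_s: "norm (F y) \<le> s * norm y" if "y \<in> W" for y
  proof (cases "y = 0")
    case False
    have "norm (F ((1 / norm y) *\<^sub>R y)) \<in> N" using that False WR by (auto simp: N_def)
    then have "norm (F ((1 / norm y) *\<^sub>R y)) \<le> s" unfolding s_def by (rule cSup_upper[OF _ bdd])
    then show ?thesis using False by (simp add: F.scaleR divide_le_eq)
  qed (simp add: F.zero)
  show ?thesis
  proof (cases "s \<le> 0")
    case True
    have "norm (F y) \<le> norm (F e) * norm y" if "y \<in> W" for y
    proof -
      have "norm (F y) \<le> 0"
        using le_s[OF that] mult_nonpos_nonneg[OF True norm_ge_zero[of y]] by linarith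
      then show ?thesis by simp
    qed
    then show ?thesis using e by (intro that[of e])
  next
    case False
    then have s: "0 < s" by simp
    have "\<exists>y. y \<in> W \<and> norm y = 1 \<and> s - 1 / real (Suc n) < norm (F y)" for n
      using less_cSupE[OF _ N_ne, of "s - 1 / real (Suc n)"] by (auto simp: s_def N_def)
    then obtain X where X: "\<And>n. X n \<in> W" "\<And>n. norm (X n) = 1"
      "\<And>n. s - 1 / real (Suc n) < norm (F (X n))" by metis
    have "compact (closure (F ` cball 0 1))" using F by (simp add: compact_operator_def)
    moreover have "F (X n) \<in> closure (F ` cball 0 1)" for n
      using X(2)[of n] closure_subset[of "F ` cball 0 1"] by auto
    ultimately obtain l r where r: "strict_mono r" and "((\<lambda>n. F (X n)) \<circ> r) \<longlonglongrightarrow> l"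
      unfolding compact_eq_seq_compact_metric seq_compact_def by meson
    then have l: "(\<lambda>n. F (X (r n))) \<longlonglongrightarrow> l" by (simp add: o_def)
    have "s - 0 \<le> norm l"
    proof (rule LIMSEQ_le)
      show "(\<lambda>n. s - 1 / real (Suc (r n))) \<longlonglongrightarrow> s - 0"
        using LIMSEQ_subseq_LIMSEQ[OF LIMSEQ_Suc[OF lim_1_over_n] r]
        by (intro tendsto_diff tendsto_const) (simp add: o_def)
      show "(\<lambda>n. norm (F (X (r n)))) \<longlonglongrightarrow> norm l" by (intro tendsto_norm l)
      show "\<exists>N. \<forall>n\<ge>N. s - 1 / real (Suc (r n)) \<le> norm (F (X (r n)))"
        using X(3) less_imp_le by blast
    qed
    then have l_ge: "s \<le> norm l" by simp
    define Y where "Y n = X (r n)" for n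
    define d where "d n = norm (F (Y n) - l)" for n
    have "(norm (Y m - Y n))\<^sup>2 \<le> 4 / s * d m + 4 / s * d n" for m n
    proof -
      define t where "t = (d m + d n) / s"
      have "norm (2 *\<^sub>R l) \<le> norm (F (Y m) + F (Y n)) + norm (F (Y m) - l) + norm (F (Y n) - l)"
        using norm_triangle_ineq4[of "F (Y m) + F (Y n)" "(F (Y m) - l) + (F (Y n) - l)"]
          norm_triangle_ineq[of "F (Y m) - l" "F (Y n) - l"]
        by (simp add: scaleR_2 algebra_simps)
      also have "norm (F (Y m) + F (Y n)) \<le> s * norm (Y m + Y n)"
        using le_s[OF Wadd] X(1) by (simp add: Y_def F.add[symmetric])
      finally have "s * 2 - (d m + d n) \<le> s * norm (Y m + Y n)"
        using l_ge by (simp add: d_def)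
      then have "2 - t \<le> norm (Y m + Y n)"
        using s by (simp add: t_def field_simps)
      then have t: "4 - 4 * t \<le> (norm (Y m + Y n))\<^sup>2"
      proof (cases "2 \<le> t")
        case True
        then show ?thesis using zero_le_power2[of "norm (Y m + Y n)"] by linarith
      next
        case False
        then have "(2 - t)\<^sup>2 \<le> (norm (Y m + Y n))\<^sup>2" using \<open>2 - t \<le> _\<close> by (intro power_mono) auto
        moreover have "(2 - t)\<^sup>2 = 4 - 4 * t + t\<^sup>2" by (simp add: power2_diff)
        ultimately show ?thesis using zero_le_power2[of t] by linarith
      qed
      have "(norm (Y m - Y n))\<^sup>2 = 2 * (norm (Y m))\<^sup>2 + 2 * (norm (Y n))\<^sup>2 - (norm (Y m + Y n))\<^sup>2"
        by (simp only: power2_norm_eq_inner) (simp add: inner_commute algebra_simps)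
      then show ?thesis using t X(2) by (simp add: t_def Y_def add_divide_distrib algebra_simps)
    qed
    moreover have "(\<lambda>n. 4 / s * d n) \<longlonglongrightarrow> 0"
      unfolding d_def Y_def by (rule tendsto_mult_right_zero[OF tendsto_norm_zero[OF LIM_zero[OF l]]])
    ultimately have "Cauchy Y" by (rule minimizing_sequence_Cauchy)
    then obtain x where x: "Y \<longlonglongrightarrow> x" using Cauchy_convergent convergent_def by blast
    have "x \<in> W" by (rule closed_sequentially[OF W(2) _ x]) (simp add: Y_def X(1))
    moreover have "norm x = 1"
      using tendsto_norm[OF x] X(2) by (simp add: Y_def LIMSEQ_const_iff)
    moreover have "F x = l"
      using LIMSEQ_unique[OF F.tendsto[OF x]] l by (simp add: Y_def)
    moreover have "norm (F y) \<le> norm l * norm y" if "y \<in> W" for y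
      using le_s[OF that] mult_right_mono[OF l_ge norm_ge_zero[of y]] by linarith
    ultimately show ?thesis by (intro that[of x]) auto
  qed
qed

text \<open>Euler-Lagrange condition for the Rayleigh quotient: perturbing \<open>x\<close> by a
  multiple \<open>r * u\<close> of an orthogonal \<open>y\<close> cannot increase the quotient, so
  the cross term has zero real part for every phase \<open>u\<close>. The phases 1 and
  \<open>- \<i>\<close> give its real and imaginary parts.\<close>

lemma norm_maximizer_orthogonal:
  fixes F :: "'h::complex_hilbert_space \<Rightarrow> 'h"
  assumes F: "compact_operator F" and W: "csubspace W" and x: "x \<in> W" "norm x = 1"
    and max: "\<And>y. y \<in> W \<Longrightarrow> norm (F y) \<le> norm (F x) * norm y"
    and y: "y \<in> W" "cinner x y = 0"
  shows "cinner (F x) (F y) = 0"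
proof -
  have Re0: "Re (u * cinner (F x) (F y)) = 0" if u: "cmod u = 1" for u
  proof -
    have "0 \<le> ((norm (F x))\<^sup>2 * (norm y)\<^sup>2 - (norm (F y))\<^sup>2) * r\<^sup>2
        + 2 * (- Re (u * cinner (F x) (F y))) * r" for r
    proof -
      define c where "c = of_real r * u"
      have c: "(cmod c)\<^sup>2 = r\<^sup>2" by (simp add: c_def u norm_mult)
      have "x + c *\<^sub>C y \<in> W"
        using W x y by (simp add: complex_vector.subspace_add complex_vector.subspace_scale)
      then have "(norm (F (x + c *\<^sub>C y)))\<^sup>2 \<le> (norm (F x) * norm (x + c *\<^sub>C y))\<^sup>2"
        by (intro power_mono max) auto
      also have "\<dots> = (norm (F x))\<^sup>2 * (1 + r\<^sup>2 * (norm y)\<^sup>2)"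
        by (simp add: power_mult_distrib norm_add_squared x y cinner_scaleC_right norm_scaleC c)
      also have "(norm (F (x + c *\<^sub>C y)))\<^sup>2
          = (norm (F x))\<^sup>2 + 2 * (r * Re (u * cinner (F x) (F y))) + r\<^sup>2 * (norm (F y))\<^sup>2"
        by (simp add: compact_operator_add[OF F] compact_operator_scaleC[OF F] norm_add_squared
            cinner_scaleC_right norm_scaleC power_mult_distrib c) (simp add: c_def mult.assoc algebra_simps)
      finally show ?thesis by (simp add: algebra_simps)
    qed
    then have "- Re (u * cinner (F x) (F y)) = 0" by (rule quadratic_nonneg_imp_zero)
    then show ?thesis by simp
  qed
  show ?thesis using Re0[of 1] Re0[of "- \<i>"] by (intro complex_eqI) auto
qed

subsection \<open>Finite orthonormal sets\<close>

definition onset :: "'h::complex_hilbert_space set \<Rightarrow> bool"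
  where "onset S \<longleftrightarrow> finite S \<and> (\<forall>x\<in>S. \<forall>y\<in>S. cinner x y = (if x = y then 1 else 0))"

lemma onset_finite: "onset S \<Longrightarrow> finite S"
  and onset_cinner: "onset S \<Longrightarrow> x \<in> S \<Longrightarrow> y \<in> S \<Longrightarrow> cinner x y = (if x = y then 1 else 0)"
  by (auto simp: onset_def)

lemma onset_norm: "onset S \<Longrightarrow> x \<in> S \<Longrightarrow> norm x = 1"
  using cinner_self[of x] onset_cinner[of S x x] of_real_eq_1_iff[of "(norm x)\<^sup>2", where 'a = complex]
    norm_ge_zero[of x]
  by (auto simp add: power2_eq_1_iff simp del: of_real_power norm_ge_zero)

lemma onset_subset: "onset S \<Longrightarrow> T \<subseteq> S \<Longrightarrow> onset T"
  unfolding onset_def by (meson finite_subset subsetD)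

lemma onset_insert:
  assumes "onset S" "norm x = 1" "\<And>s. s \<in> S \<Longrightarrow> cinner s x = 0"
  shows "onset (insert x S)" "x \<notin> S"
proof -
  show "x \<notin> S" using assms(2) assms(3)[of x] by auto
  then show "onset (insert x S)"
    using assms cinner_eq_0_commute[of x] by (auto simp: onset_def cinner_self)
qed

lemma cinner_onset_sum:
  assumes "onset S" "s \<in> S"
  shows "cinner s (\<Sum>e\<in>S. c e *\<^sub>C e) = c s"
proof -
  have "cinner s (\<Sum>e\<in>S. c e *\<^sub>C e) = (\<Sum>e\<in>S. if s = e then c e else 0)"
    unfolding cinner_sum_right using assms
    by (intro sum.cong) (auto simp: cinner_scaleC_right onset_cinner)
  then show ?thesis using assms by (simp add: onset_finite)
qed

lemma onset_expand:
  assumes S: "onset S" and x: "x \<in> cspan S"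
  shows "x = (\<Sum>e\<in>S. cinner e x *\<^sub>C e)"
proof -
  obtain c where c: "x = (\<Sum>e\<in>S. c e *\<^sub>C e)"
    using x unfolding complex_vector.span_finite[OF onset_finite[OF S]] by auto
  then have "cinner s x = c s" if "s \<in> S" for s using cinner_onset_sum[OF S that] by simp
  then show ?thesis using c by simp
qed

lemma onset_cinner_expand:
  assumes S: "onset S" and x: "x \<in> cspan S"
  shows "cinner x y = (\<Sum>e\<in>S. cinner x e * cinner e y)"
proof -
  have "cinner x y = cinner (\<Sum>e\<in>S. cinner e x *\<^sub>C e) y" using onset_expand[OF S x] by simp
  also have "\<dots> = (\<Sum>e\<in>S. cinner x e * cinner e y)"
    unfolding cinner_sum_left by (intro sum.cong refl) (metis cinner_scaleC_left cinner_commute)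
  finally show ?thesis .
qed

lemma onset_parseval:
  assumes S: "onset S" and x: "x \<in> cspan S"
  shows "(\<Sum>e\<in>S. (cmod (cinner e x))\<^sup>2) = (norm x)\<^sup>2"
proof -
  have "complex_of_real ((norm x)\<^sup>2) = (\<Sum>e\<in>S. cinner x e * cinner e x)"
    unfolding cinner_self[symmetric] by (rule onset_cinner_expand[OF S x])
  also have "\<dots> = complex_of_real (\<Sum>e\<in>S. (cmod (cinner e x))\<^sup>2)"
    unfolding of_real_sum by (intro sum.cong refl) (metis cinner_commute complex_norm_square mult.commute)
  finally show ?thesis by (simp only: of_real_eq_iff)
qed

lemma onset_bessel:
  assumes S: "onset S"
  shows "(\<Sum>e\<in>S. (cmod (cinner e x))\<^sup>2) \<le> (norm x)\<^sup>2"
proof -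
  define y where "y = (\<Sum>e\<in>S. cinner e x *\<^sub>C e)"
  have y: "cinner e y = cinner e x" if "e \<in> S" for e
    unfolding y_def by (rule cinner_onset_sum[OF S that])
  have yS: "y \<in> cspan S"
    unfolding y_def by (intro complex_vector.span_sum complex_vector.span_scale complex_vector.span_base)
  have "cinner y (x - y) = 0"
    by (subst onset_cinner_expand[OF S yS]) (simp add: cinner_diff_right y)
  then have "(norm x)\<^sup>2 = (norm y)\<^sup>2 + (norm (x - y))\<^sup>2"
    using norm_add_squared[of y "x - y"] by simp
  moreover have "(norm y)\<^sup>2 = (\<Sum>e\<in>S. (cmod (cinner e x))\<^sup>2)"
    using onset_parseval[OF S yS] y by simp
  ultimately show ?thesis by simp
qed

lemma cspan_onset_closed:
  assumes S: "onset S" shows "closed (cspan S)"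
proof -
  have "cspan S = {x. (\<Sum>e\<in>S. cinner e x *\<^sub>C e) = x}"
  proof (intro set_eqI iffI CollectI)
    show "(\<Sum>e\<in>S. cinner e x *\<^sub>C e) = x" if "x \<in> cspan S" for x
      using onset_expand[OF S that] by (rule sym)
    show "x \<in> cspan S" if "x \<in> {x. (\<Sum>e\<in>S. cinner e x *\<^sub>C e) = x}" for x
    proof -
      have "(\<Sum>e\<in>S. cinner e x *\<^sub>C e) \<in> cspan S"
        by (intro complex_vector.span_sum complex_vector.span_scale complex_vector.span_base)
      then show ?thesis using that by simp
    qed
  qed
  moreover have "continuous_on UNIV (\<lambda>x. \<Sum>e\<in>S. cinner e x *\<^sub>C e)"
  proof (intro continuous_on_sum)
    fix e assume "e \<in> S"
    have "bounded_linear (\<lambda>c. c *\<^sub>C e)"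
      by (rule bounded_linear_intro[where K = "norm e"])
        (simp_all add: scaleC_add_left scaleR_scaleC[where 'a = 'a] scaleC_scaleC scaleR_conv_of_real norm_scaleC)
    then show "continuous_on UNIV (\<lambda>x. cinner e x *\<^sub>C e)"
      using bounded_linear_compose[OF _ bounded_linear_cinner_right[of e]]
        linear_continuous_on by blast
  qed
  ultimately show ?thesis by (simp add: closed_Collect_eq)
qed

lemma closed_onset_orthogonal: "closed {x. \<forall>s\<in>S. cinner s x = 0}" for S :: "'h::complex_hilbert_space set"
proof -
  have "closed {x. cinner s x = 0}" for s :: 'h
    by (intro closed_Collect_eq continuous_on_const linear_continuous_on bounded_linear_cinner_right)
  then have "closed (\<Inter>s\<in>S. {x. cinner s x = 0})" by blast
  also have "(\<Inter>s\<in>S. {x. cinner s x = 0}) = {x. \<forall>s\<in>S. cinner s x = 0}" by auto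
  finally show ?thesis .
qed

lemma csubspace_orthogonal: "csubspace {x. \<forall>s\<in>S. cinner s x = 0}" for S :: "'h::complex_hilbert_space set"
  by (auto simp: complex_vector.subspace_def cinner_add_right cinner_scaleC_right)

lemma onset_independent:
  assumes S: "onset S" shows "\<not> complex_vector.dependent S"
proof -
  have "u v = 0" if "(\<Sum>v\<in>S. u v *\<^sub>C v) = 0" "v \<in> S" for u v
    using cinner_onset_sum[OF S that(2), of u] that(1) by simp
  then show ?thesis using onset_finite[OF S] by (simp add: complex_vector.dependent_finite) blast
qed

lemma onset_card_le:
  assumes "onset S" "finite T" "S \<subseteq> cspan T" shows "card S \<le> card T"
  using complex_vector.independent_span_bound[OF assms(2) onset_independent[OF assms(1)] assms(3)]
  by blast

lemma exists_unit_orthogonal: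
  assumes S: "onset S" and V: "csubspace V" "S \<subseteq> V" and x: "x \<in> V" "x \<notin> cspan S"
  obtains e where "e \<in> V" "norm e = 1" "\<And>s. s \<in> S \<Longrightarrow> cinner s e = 0"
proof -
  define y where "y = (\<Sum>e\<in>S. cinner e x *\<^sub>C e)"
  have yS: "y \<in> cspan S"
    unfolding y_def by (intro complex_vector.span_sum complex_vector.span_scale complex_vector.span_base)
  then have yV: "y \<in> V" using complex_vector.span_minimal[OF V(2,1)] by blast
  have ne: "x - y \<noteq> 0" using x yS by auto
  define e where "e = complex_of_real (1 / norm (x - y)) *\<^sub>C (x - y)"
  show ?thesis
  proof (rule that)
    show "e \<in> V"
      unfolding e_def using V x yV by (intro complex_vector.subspace_scale complex_vector.subspace_diff)
    show "norm e = 1" using ne by (simp add: e_def norm_scaleC norm_divide)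
    show "cinner s e = 0" if "s \<in> S" for s
      using cinner_onset_sum[OF S that, of "\<lambda>e. cinner e x"]
      by (simp add: e_def cinner_scaleC_right cinner_diff_right y_def)
  qed
qed

text \<open>Spectral theorem for the Gram form of \<open>F\<close> on the finite-dimensional
  \<open>V\<close>, continuing a prescribed partial eigenbasis \<open>S0\<close>. The prescription
  later lets a basis of \<open>V\<close> contain given singular vectors of \<open>A\<close> or of
  \<open>B\<close>.\<close>

lemma onset_extend_diagonal:
  fixes F :: "'h::complex_hilbert_space \<Rightarrow> 'h"
  assumes F: "compact_operator F" and V: "csubspace V" "closed V" "V \<subseteq> cspan T" "finite T"
    and S0: "onset S0" "S0 \<subseteq> V"
    and diag0: "\<And>s y. s \<in> S0 \<Longrightarrow> y \<in> V \<Longrightarrow> cinner s y = 0 \<Longrightarrow> cinner (F s) (F y) = 0"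
  obtains S where "S0 \<subseteq> S" "onset S" "cspan S = V"
    "\<And>s t. s \<in> S \<Longrightarrow> t \<in> S \<Longrightarrow> s \<noteq> t \<Longrightarrow> cinner (F s) (F t) = 0"
proof -
  \<comment> \<open>The last clause says that the complement of \<open>S\<close> in \<open>V\<close>
    is invariant under the compression of \<open>F* F\<close>. It makes a norm maximiser found in
    that complement orthogonal to the old vectors in the Gram form, so that a set of largest
    cardinality must already span.\<close>
  define P where "P S \<longleftrightarrow> S0 \<subseteq> S \<and> onset S \<and> S \<subseteq> V \<and>
    (\<forall>s\<in>S. \<forall>t\<in>S. s \<noteq> t \<longrightarrow> cinner (F s) (F t) = 0) \<and>
    (\<forall>s\<in>S. \<forall>y\<in>V. (\<forall>t\<in>S. cinner t y = 0) \<longrightarrow> cinner (F s) (F y) = 0)" for S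
  have "P S0" using S0 diag0 by (auto simp: P_def onset_cinner subset_eq)
  moreover have "card S \<le> card T" if "P S" for S
    using that V(3) by (intro onset_card_le V(4)) (auto simp: P_def)
  ultimately obtain S where PS: "P S" and mx: "\<And>S'. P S' \<Longrightarrow> card S' \<le> card S"
    using ex_has_greatest_nat[of P S0 card "Suc (card T)"] by (metis less_Suc_eq_le)
  have S: "onset S" "S \<subseteq> V" "S0 \<subseteq> S"
    and dS: "\<And>s t. s \<in> S \<Longrightarrow> t \<in> S \<Longrightarrow> s \<noteq> t \<Longrightarrow> cinner (F s) (F t) = 0"
    and cS: "\<And>s y. s \<in> S \<Longrightarrow> y \<in> V \<Longrightarrow> (\<And>t. t \<in> S \<Longrightarrow> cinner t y = 0) \<Longrightarrow> cinner (F s) (F y) = 0"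
    using PS unfolding P_def by blast+
  have "V \<subseteq> cspan S"
  proof (rule ccontr)
    assume "\<not> V \<subseteq> cspan S"
    then obtain x where "x \<in> V" "x \<notin> cspan S" by blast
    then obtain e where e: "e \<in> V" "norm e = 1" "\<And>s. s \<in> S \<Longrightarrow> cinner s e = 0"
      using exists_unit_orthogonal[OF S(1) V(1) S(2)] by metis
    define W where "W = V \<inter> {x. \<forall>s\<in>S. cinner s x = 0}"
    have W: "csubspace W" "closed W" unfolding W_def
      using V by (auto intro!: complex_vector.subspace_inter closed_Int csubspace_orthogonal closed_onset_orthogonal)
    have "e \<in> W" "e \<noteq> 0" using e by (auto simp: W_def)
    then obtain x where x: "x \<in> W" "norm x = 1" and mxx: "\<And>y. y \<in> W \<Longrightarrow> norm (F y) \<le> norm (F x) * norm y"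
      using compact_operator_norm_attained[OF F W] by metis
    have ortho: "cinner (F x) (F y) = 0" if "y \<in> W" "cinner x y = 0" for y
      by (rule norm_maximizer_orthogonal[OF F W(1) x mxx that])
    have x0: "cinner s x = 0" if "s \<in> S" for s using x that by (auto simp: W_def)
    have Fx: "cinner (F s) (F x) = 0" if "s \<in> S" for s
      using x x0 by (intro cS that) (auto simp: W_def)
    have "P (insert x S)"
      unfolding P_def
    proof (intro conjI ballI impI)
      show "S0 \<subseteq> insert x S" using S(3) by blast
      show "onset (insert x S)" using onset_insert(1)[OF S(1) x(2) x0] .
      show "insert x S \<subseteq> V" using S x by (auto simp: W_def)
      show "cinner (F s) (F t) = 0" if "s \<in> insert x S" "t \<in> insert x S" "s \<noteq> t" for s t
        using that Fx cinner_eq_0_commute[of "F x"] dS by (metis insertE)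
      show "cinner (F s) (F y) = 0"
        if "s \<in> insert x S" "y \<in> V" "\<forall>t\<in>insert x S. cinner t y = 0" for s y
        using that ortho[of y] cS[of s y] by (auto simp: W_def)
    qed
    then show False
      using mx[of "insert x S"] onset_insert(2)[OF S(1) x(2) x0] onset_finite[OF S(1)] by simp
  qed
  moreover have "cspan S \<subseteq> V" by (rule complex_vector.span_minimal[OF S(2) V(1)])
  ultimately show ?thesis using S dS by (intro that[of S]) blast+
qed

text \<open>The orthogonal complement \<open>W\<close> of eigenvectors is invariant under
  \<open>F* F\<close>, so a norm maximiser on \<open>W\<close> satisfies the eigenvalue equation
  against the whole space, not only against \<open>W\<close>. Its eigenvalue is large as soon as
  some unit vector \<open>w\<close> of the complement has a large image.\<close>

lemma eigenvector_orthogonal_to_eigenvectors: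
  fixes F :: "'h::complex_hilbert_space \<Rightarrow> 'h"
  assumes F: "compact_operator F" and S: "onset S"
    and eig: "\<And>s. s \<in> S \<Longrightarrow> \<exists>c. \<forall>y. cinner (F y) (F s) = c * cinner y s"
    and w: "\<And>s. s \<in> S \<Longrightarrow> cinner s w = 0" "norm w = 1"
  obtains x where "norm x = 1" "\<And>s. s \<in> S \<Longrightarrow> cinner s x = 0" "norm (F w) \<le> norm (F x)"
    "\<And>y. cinner (F y) (F x) = complex_of_real ((norm (F x))\<^sup>2) * cinner y x"
proof -
  define W where "W = {x. \<forall>s\<in>S. cinner s x = 0}"
  have W: "csubspace W" "closed W"
    unfolding W_def by (rule csubspace_orthogonal closed_onset_orthogonal)+
  have "w \<in> W" "w \<noteq> 0" using w by (auto simp: W_def)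
  then obtain x where x: "x \<in> W" "norm x = 1" and mx: "\<And>y. y \<in> W \<Longrightarrow> norm (F y) \<le> norm (F x) * norm y"
    using compact_operator_norm_attained[OF F W] by metis
  have xS: "cinner s x = 0" if "s \<in> S" for s using x that by (auto simp: W_def)
  have FS: "cinner (F s) (F x) = 0" if s: "s \<in> S" for s
  proof -
    obtain c where "cinner (F x) (F s) = c * cinner x s" using eig[OF s] by blast
    then show ?thesis using xS[OF s] cinner_eq_0_commute[of x s] cinner_eq_0_commute[of "F x" "F s"] by simp
  qed
  define S' where "S' = insert x S"
  have S': "onset S'" unfolding S'_def using x xS by (intro onset_insert(1)[OF S]) auto
  have x': "cinner e x = (if e = x then 1 else 0)" if "e \<in> S'" for e
    using onset_cinner[OF S' that, of x] by (simp add: S'_def)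
  have Fx': "cinner (F e) (F x) = complex_of_real ((norm (F x))\<^sup>2) * cinner e x" if "e \<in> S'" for e
    using that FS xS by (auto simp: S'_def x' cinner_self)
  show ?thesis
  proof (rule that[of x])
    fix y
    \<comment> \<open>Splits an arbitrary \<open>y\<close> into a part along \<open>S'\<close>,
      where the form is known, and a part in \<open>W\<close> orthogonal to \<open>x\<close>, where
      maximality applies.\<close>
    define z where "z = (\<Sum>e\<in>S'. cinner e y *\<^sub>C e)"
    have z: "cinner e (y - z) = 0" if "e \<in> S'" for e
      using cinner_onset_sum[OF S' that, of "\<lambda>e. cinner e y"] by (simp add: z_def cinner_diff_right)
    have "y - z \<in> W" using z by (auto simp: W_def S'_def)
    moreover have xyz: "cinner x (y - z) = 0" using z by (simp add: S'_def)
    ultimately have 1: "cinner (F x) (F (y - z)) = 0"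
      by (intro norm_maximizer_orthogonal[OF F W(1) x mx])
    interpret F: bounded_linear F by (rule compact_operator_bounded_linear[OF F])
    have Fz: "F z = (\<Sum>e\<in>S'. cinner e y *\<^sub>C F e)"
      by (simp add: z_def F.sum compact_operator_scaleC[OF F])
    have 2: "cinner (F z) (F x) = complex_of_real ((norm (F x))\<^sup>2) * cinner z x"
      unfolding Fz unfolding z_def cinner_sum_left sum_distrib_left
      by (intro sum.cong refl) (simp add: cinner_scaleC_left Fx')
    have "cinner (F (y - z)) (F x) = 0" "cinner (y - z) x = 0"
      using 1 xyz cinner_eq_0_commute by blast+
    then show "cinner (F y) (F x) = complex_of_real ((norm (F x))\<^sup>2) * cinner y x"
      using 2 by (simp add: F.diff cinner_diff_left)
  qed (use x xS mx[OF \<open>w \<in> W\<close>] w in auto)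
qed

subsection \<open>Singular values\<close>

text \<open>Orthonormal eigenvectors have images at mutual distance
  \<open>sqrt 2 * \<sigma>\<close>, so a finite cover of the relatively compact image by balls of
  radius \<open>\<sigma> / 2\<close> bounds their number. Hence the eigenspace is finite-dimensional
  and \<open>sv_mult\<close> is its true dimension, not the default value 0 of
  \<open>cdim\<close>.\<close>

lemma eigenspace_onset:
  fixes F :: "'h::complex_hilbert_space \<Rightarrow> 'h"
  assumes F: "compact_operator F" and \<sigma>: "0 < \<sigma>"
  obtains S where "onset S" "card S = sv_mult F \<sigma>"
    "cspan S = {x. \<forall>y. cinner (F y) (F x) = complex_of_real (\<sigma>\<^sup>2) * cinner y x}"
proof -
  define E where "E = {x. \<forall>y. cinner (F y) (F x) = complex_of_real (\<sigma>\<^sup>2) * cinner y x}"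
  interpret F: bounded_linear F by (rule compact_operator_bounded_linear[OF F])
  have E: "csubspace E"
    unfolding E_def complex_vector.subspace_def
    by (auto simp: F.zero F.add compact_operator_scaleC[OF F] cinner_add_right cinner_scaleC_right
        distrib_left)
  have "compact (closure (F ` cball 0 1))" using F by (simp add: compact_operator_def)
  then obtain k where k: "finite k" "closure (F ` cball 0 1) \<subseteq> (\<Union>x\<in>k. ball x (\<sigma> / 2))"
    using \<sigma> unfolding compact_eq_totally_bounded by (meson half_gt_zero)
  have bound: "card S \<le> card k" if S: "onset S" "S \<subseteq> E" for S
  proof -
    have "\<exists>c\<in>k. dist c (F s) < \<sigma> / 2" if "s \<in> S" for s
    proof -
      have "F s \<in> closure (F ` cball 0 1)"
        using onset_norm[OF S(1) that] closure_subset[of "F ` cball 0 1"] by auto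
      then obtain c where "c \<in> k" "F s \<in> ball c (\<sigma> / 2)" using k(2) by blast
      then show ?thesis by (intro bexI[of _ c]) (simp_all only: mem_ball)
    qed
    then obtain c where c: "\<And>s. s \<in> S \<Longrightarrow> c s \<in> k" "\<And>s. s \<in> S \<Longrightarrow> dist (c s) (F s) < \<sigma> / 2"
      by metis
    have "inj_on c S"
    proof (rule inj_onI, rule ccontr)
      fix s t assume st: "s \<in> S" "t \<in> S" "c s = c t" "s \<noteq> t"
      have "dist (F s) (F t) < \<sigma>"
        using dist_triangle2[of "F s" "F t" "c s"] c(2)[OF st(1)] c(2)[OF st(2)] st(3)
        by (simp add: dist_commute)
      then have "(norm (F (s - t)))\<^sup>2 < \<sigma>\<^sup>2" by (simp add: dist_norm F.diff power_strict_mono)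
      moreover have "complex_of_real ((norm (F (s - t)))\<^sup>2) = complex_of_real (2 * \<sigma>\<^sup>2)"
      proof -
        have "s - t \<in> E" using S st by (intro complex_vector.subspace_diff[OF E]) auto
        then have "cinner (F (s - t)) (F (s - t)) = complex_of_real (\<sigma>\<^sup>2) * cinner (s - t) (s - t)"
          by (simp add: E_def)
        also have "cinner (s - t) (s - t) = 2"
          using st by (simp add: cinner_diff_left cinner_diff_right onset_cinner[OF S(1)])
        finally show ?thesis by (simp add: cinner_self)
      qed
      ultimately show False using zero_le_power2[of \<sigma>] unfolding of_real_eq_iff by linarith
    qed
    then show ?thesis using c(1) k(1) by (intro card_inj_on_le[of c]) auto
  qed
  define P where "P S \<longleftrightarrow> onset S \<and> S \<subseteq> E" for S
  have "P {}" by (simp add: P_def onset_def)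
  then obtain S where PS: "P S" and mx: "\<And>S'. P S' \<Longrightarrow> card S' \<le> card S"
    using ex_has_greatest_nat[of P "{}" card "Suc (card k)"] bound unfolding P_def
    by (metis less_Suc_eq_le)
  then have S: "onset S" "S \<subseteq> E" by (auto simp: P_def)
  have "E \<subseteq> cspan S"
  proof (rule ccontr)
    assume "\<not> E \<subseteq> cspan S"
    then obtain x where "x \<in> E" "x \<notin> cspan S" by blast
    then obtain e where e: "e \<in> E" "norm e = 1" "\<And>s. s \<in> S \<Longrightarrow> cinner s e = 0"
      using exists_unit_orthogonal[OF S(1) E S(2)] by metis
    then have "P (insert e S)" using S onset_insert(1)[OF S(1) e(2,3)] by (simp add: P_def)
    then show False using mx onset_insert(2)[OF S(1) e(2,3)] onset_finite[OF S(1)] by fastforce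
  qed
  moreover have "cspan S \<subseteq> E" by (rule complex_vector.span_minimal[OF S(2) E])
  ultimately have span: "cspan S = E" by blast
  have "sv_mult F \<sigma> = cdim E"
    by (simp add: sv_mult_def E_def cadjoint_comp_eq_iff[OF F] del: of_real_power)
  also have "\<dots> = card S"
  proof (rule complex_vector.dim_eq_card)
    show "cspan S = cspan E" using span E by (metis complex_vector.span_eq_iff)
  qed (rule onset_independent[OF S(1)])
  finally show ?thesis using S span by (intro that[of S]) (auto simp: E_def)
qed

text \<open>An orthonormal family of right singular vectors, indexed with multiplicity. The last
  clause is completeness: an eigenvector to a positive eigenvalue cannot be orthogonal to the listed
  basis of its eigenspace.\<close>

definition singular_system :: "('h::complex_hilbert_space \<Rightarrow> 'h) \<Rightarrow> (real \<times> nat \<Rightarrow> 'h) \<Rightarrow> bool"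
  where "singular_system F e \<longleftrightarrow>
    (\<forall>i\<in>sv_index F. \<forall>j\<in>sv_index F. cinner (e i) (e j) = (if i = j then 1 else 0)) \<and>
    (\<forall>j\<in>sv_index F. \<forall>y. cinner (F y) (F (e j)) = complex_of_real ((fst j)\<^sup>2) * cinner y (e j)) \<and>
    (\<forall>x s. 0 < s \<longrightarrow> (\<forall>y. cinner (F y) (F x) = complex_of_real (s\<^sup>2) * cinner y x) \<longrightarrow>
      (\<forall>i<sv_mult F s. cinner (e (s, i)) x = 0) \<longrightarrow> x = 0)"

lemma sv_index_pos: "j \<in> sv_index F \<Longrightarrow> 0 < fst j"
  by (auto simp: sv_index_def)

lemma singular_system_exists:
  fixes F :: "'h::complex_hilbert_space \<Rightarrow> 'h"
  assumes F: "compact_operator F"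
  obtains e where "singular_system F e"
proof -
  define P where "P \<sigma> b \<longleftrightarrow> onset (b ` {..<sv_mult F \<sigma>}) \<and> inj_on b {..<sv_mult F \<sigma>} \<and>
     cspan (b ` {..<sv_mult F \<sigma>}) =
       {x. \<forall>y. cinner (F y) (F x) = complex_of_real (\<sigma>\<^sup>2) * cinner y x}" for \<sigma> b
  have "\<exists>b. 0 < \<sigma> \<longrightarrow> P \<sigma> b" for \<sigma>
  proof (cases "0 < \<sigma>")
    case True
    obtain S where S: "onset S" "card S = sv_mult F \<sigma>"
      "cspan S = {x. \<forall>y. cinner (F y) (F x) = complex_of_real (\<sigma>\<^sup>2) * cinner y x}"
      by (rule eigenspace_onset[OF F True])
    obtain b where "bij_betw b {0..<card S} S"
      using ex_bij_betw_nat_finite[OF onset_finite[OF S(1)]] by blast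
    then have "inj_on b {..<sv_mult F \<sigma>}" "b ` {..<sv_mult F \<sigma>} = S"
      using S(2) by (auto simp: bij_betw_def atLeast0LessThan)
    then have "P \<sigma> b" unfolding P_def using S by (simp only: simp_thms)
    then show ?thesis by blast
  qed simp
  then obtain b where "\<And>\<sigma>. 0 < \<sigma> \<Longrightarrow> P \<sigma> (b \<sigma>)" by metis
  then have b: "onset (b \<sigma> ` {..<sv_mult F \<sigma>})" "inj_on (b \<sigma>) {..<sv_mult F \<sigma>}"
      "cspan (b \<sigma> ` {..<sv_mult F \<sigma>}) =
        {x. \<forall>y. cinner (F y) (F x) = complex_of_real (\<sigma>\<^sup>2) * cinner y x}" if "0 < \<sigma>" for \<sigma>
    using that unfolding P_def by blast+
  define e where "e j = b (fst j) (snd j)" for j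
  have eig: "cinner (F y) (F (e j)) = complex_of_real ((fst j)\<^sup>2) * cinner y (e j)"
    if "j \<in> sv_index F" for j y
  proof -
    have "e j \<in> cspan (b (fst j) ` {..<sv_mult F (fst j)})"
      using that by (intro complex_vector.span_base) (auto simp: sv_index_def e_def)
    then show ?thesis using b(3)[OF sv_index_pos[OF that]] by simp
  qed
  have ortho: "cinner (e i) (e j) = (if i = j then 1 else 0)"
    if ij: "i \<in> sv_index F" "j \<in> sv_index F" for i j
  proof (cases "fst i = fst j")
    case True
    have "e i \<in> b (fst i) ` {..<sv_mult F (fst i)}" "e j \<in> b (fst i) ` {..<sv_mult F (fst i)}"
      using ij True by (auto simp: sv_index_def e_def)
    then have "cinner (e i) (e j) = (if e i = e j then 1 else 0)"
      using onset_cinner[OF b(1)[OF sv_index_pos[OF ij(1)]]] by blast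
    moreover have "e i = e j \<longleftrightarrow> i = j"
    proof
      assume "e i = e j"
      then have "snd i = snd j"
        using ij True inj_onD[OF b(2)[OF sv_index_pos[OF ij(1)]], of "snd i" "snd j"]
        by (auto simp: sv_index_def e_def)
      then show "i = j" using True by (simp add: prod_eq_iff)
    qed simp
    ultimately show ?thesis by simp
  next
    \<comment> \<open>Symmetry of the Gram form: both eigenvalue equations evaluate the same entry,
      so vectors from different eigenspaces are orthogonal.\<close>
    case False
    have 1: "cinner (F (e i)) (F (e j)) = complex_of_real ((fst j)\<^sup>2) * cinner (e i) (e j)"
      by (rule eig[OF ij(2)])
    have "cinner (F (e j)) (F (e i)) = complex_of_real ((fst i)\<^sup>2) * cinner (e j) (e i)"
      by (rule eig[OF ij(1)])
    then have "cnj (cinner (F (e j)) (F (e i))) = complex_of_real ((fst i)\<^sup>2) * cnj (cinner (e j) (e i))"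
      by simp
    then have "cinner (F (e i)) (F (e j)) = complex_of_real ((fst i)\<^sup>2) * cinner (e i) (e j)"
      by (simp add: cinner_commute[symmetric])
    with 1 have "(fst i)\<^sup>2 = (fst j)\<^sup>2 \<or> cinner (e i) (e j) = 0"
      by (metis mult_cancel_right of_real_eq_iff)
    moreover have "(fst i)\<^sup>2 \<noteq> (fst j)\<^sup>2"
      using False sv_index_pos[OF ij(1)] sv_index_pos[OF ij(2)] by (simp add: power2_eq_iff)
    ultimately show ?thesis using False by auto
  qed
  have "x = 0" if s: "0 < s" and x: "\<forall>y. cinner (F y) (F x) = complex_of_real (s\<^sup>2) * cinner y x"
    and 0: "\<forall>i<sv_mult F s. cinner (e (s, i)) x = 0" for x s
  proof -
    have "x \<in> cspan (b s ` {..<sv_mult F s})" using b(3)[OF s] x by simp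
    from onset_expand[OF b(1)[OF s] this] show ?thesis
      using 0 by (simp add: e_def sum.neutral)
  qed
  then show ?thesis
    using eig ortho by (intro that[of e]) (auto simp: singular_system_def)
qed

lemma singular_systemD:
  assumes "singular_system F e"
  shows "\<And>i j. i \<in> sv_index F \<Longrightarrow> j \<in> sv_index F \<Longrightarrow> cinner (e i) (e j) = (if i = j then 1 else 0)"
    and "\<And>j y. j \<in> sv_index F \<Longrightarrow> cinner (F y) (F (e j)) = complex_of_real ((fst j)\<^sup>2) * cinner y (e j)"
  using conjunct1[OF assms[unfolded singular_system_def]]
    conjunct1[OF conjunct2[OF assms[unfolded singular_system_def]]] by blast+

lemma singular_system_onset:
  assumes e: "singular_system F e" and J: "finite J" "J \<subseteq> sv_index F"
  shows "onset (e ` J)" "inj_on e J" "\<And>j. j \<in> J \<Longrightarrow> norm (F (e j)) = fst j"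
    "\<And>s y. s \<in> e ` J \<Longrightarrow> cinner s y = 0 \<Longrightarrow> cinner (F s) (F y) = 0"
proof -
  note o = singular_systemD[OF e]
  show inj: "inj_on e J"
    by (rule inj_onI) (use J o(1) in \<open>metis one_neq_zero subsetD\<close>)
  show "onset (e ` J)"
    unfolding onset_def using J o(1) inj by (auto simp: inj_on_eq_iff subset_eq)
  show "norm (F (e j)) = fst j" if "j \<in> J" for j
  proof -
    have j: "j \<in> sv_index F" using that J by blast
    have "complex_of_real ((norm (F (e j)))\<^sup>2) = complex_of_real ((fst j)\<^sup>2)"
      using o(2)[OF j, of "e j"] o(1)[OF j j] by (simp add: cinner_self)
    then have "(norm (F (e j)))\<^sup>2 = (fst j)\<^sup>2" by (simp only: of_real_eq_iff)
    then show ?thesis using sv_index_pos[OF j] by (simp add: power2_eq_iff_nonneg)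
  qed
  show "cinner (F s) (F y) = 0" if s: "s \<in> e ` J" "cinner s y = 0" for s y
  proof -
    have "cinner (F y) (F s) = 0" using s o(2)[of _ y] J cinner_eq_0_commute[of s y] by auto
    then show ?thesis using cinner_eq_0_commute by blast
  qed
qed

section \<open>Comparison of singular values by the max-min principle\<close>

text \<open>An image of norm at least \<open>\<tau>\<close> would produce an eigenvector with
  singular value at least \<open>\<tau>\<close> orthogonal to all listed ones, against the
  completeness clause of \<open>singular_system\<close>.\<close>

lemma norm_less_of_orthogonal:
  fixes F :: "'h::complex_hilbert_space \<Rightarrow> 'h"
  assumes F: "compact_operator F" and e: "singular_system F e" and \<tau>: "0 < \<tau>"
    and fin: "finite {j \<in> sv_index F. \<tau> \<le> fst j}"
    and w: "norm w = 1" "\<And>j. j \<in> sv_index F \<Longrightarrow> \<tau> \<le> fst j \<Longrightarrow> cinner (e j) w = 0"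
  shows "norm (F w) < \<tau>"
proof (rule ccontr)
  assume "\<not> norm (F w) < \<tau>"
  define S where "S = e ` {j \<in> sv_index F. \<tau> \<le> fst j}"
  have S: "onset S" unfolding S_def by (intro singular_system_onset(1)[OF e fin]) auto
  have eig: "\<exists>c. \<forall>y. cinner (F y) (F s) = c * cinner y s" if "s \<in> S" for s
    using that singular_systemD(2)[OF e] unfolding S_def by blast
  have wS: "cinner s w = 0" if "s \<in> S" for s using that w(2) by (auto simp: S_def)
  show False
  proof (rule eigenvector_orthogonal_to_eigenvectors[OF F S _ _ w(1)])
    fix x
    assume x: "norm x = 1" "\<And>s. s \<in> S \<Longrightarrow> cinner s x = 0" "norm (F w) \<le> norm (F x)"
      "\<And>y. cinner (F y) (F x) = complex_of_real ((norm (F x))\<^sup>2) * cinner y x"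
    have s: "0 < norm (F x)" "\<tau> \<le> norm (F x)" using x(3) \<open>\<not> norm (F w) < \<tau>\<close> \<tau> by linarith+
    have "cinner (e (norm (F x), i)) x = 0" if "i < sv_mult F (norm (F x))" for i
      using that s by (intro x(2)) (auto simp: S_def sv_index_def)
    then have "x = 0" using e x(4) s unfolding singular_system_def by blast
    then show False using x(1) by simp
  qed (fact eig wS)+
qed

text \<open>Dimension count: the linear map recording the inner products with the elements of
  \<open>Z\<close> has rank at most \<open>card Z\<close>, so it is not injective on the span of
  \<open>S\<close>.\<close>

lemma exists_unit_in_span_orthogonal:
  fixes S Z :: "'h::complex_hilbert_space set"
  assumes S: "onset S" and Z: "finite Z" "card Z < card S"
  obtains w where "w \<in> cspan S" "norm w = 1" "\<And>z. z \<in> Z \<Longrightarrow> cinner z w = 0"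
proof -
  interpret vp: vector_space_pair "scaleC :: complex \<Rightarrow> 'h \<Rightarrow> 'h"
      "scaleC :: complex \<Rightarrow> ('h \<Rightarrow> complex) \<Rightarrow> ('h \<Rightarrow> complex)"
    by (simp add: vector_space_pair_def complex_vector.vector_space_axioms)
  have sum_fun_apply: "sum f A y = (\<Sum>i\<in>A. f i y)" for f :: "'h \<Rightarrow> 'h \<Rightarrow> complex" and A y
    by (induction A rule: infinite_finite_induct) simp_all
  \<comment> \<open>The inner products are stored in functions on the whole space that vanish off
    \<open>Z\<close>, because this function type is already a complex vector space; the
    \<open>\<delta> z\<close> span the range.\<close>
  define L where "L x = (\<lambda>z. if z \<in> Z then cinner z x else 0)" for x :: 'h
  define \<delta> :: "'h \<Rightarrow> 'h \<Rightarrow> complex" where "\<delta> z = (\<lambda>y. if y = z then 1 else 0)" for z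
  have L: "clinear L"
    by (auto simp: Vector_Spaces.linear_iff L_def fun_eq_iff cinner_add_right cinner_scaleC_right
        scaleC_fun_def scaleC_complex_def complex_vector.vector_space_axioms)
  have "L x \<in> cspan (\<delta> ` Z)" for x
  proof -
    have "L x = (\<Sum>z\<in>Z. cinner z x *\<^sub>C \<delta> z)"
    proof
      fix y
      have "(\<Sum>z\<in>Z. cinner z x *\<^sub>C \<delta> z) y = (\<Sum>z\<in>Z. if y = z then cinner z x else 0)"
        unfolding sum_fun_apply by (intro sum.cong) (auto simp: \<delta>_def scaleC_fun_def scaleC_complex_def)
      then show "L x y = (\<Sum>z\<in>Z. cinner z x *\<^sub>C \<delta> z) y" using Z(1) by (simp add: L_def)
    qed
    also have "\<dots> \<in> cspan (\<delta> ` Z)"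
      by (intro complex_vector.span_sum complex_vector.span_scale complex_vector.span_base imageI)
    finally show ?thesis .
  qed
  then have sub: "L ` S \<subseteq> cspan (\<delta> ` Z)" by blast
  have "\<not> inj_on L (cspan S)"
  proof
    assume inj: "inj_on L (cspan S)"
    have "\<not> complex_vector.dependent (L ` S)"
      by (rule vp.linear_independent_injective_image[OF L onset_independent[OF S] inj])
    then have "card (L ` S) \<le> card (\<delta> ` Z)"
      using complex_vector.independent_span_bound[OF _ _ sub] Z(1) by blast
    moreover have "card (L ` S) = card S"
      using inj complex_vector.span_superset[of S] by (intro card_image inj_on_subset[OF inj])
    moreover have "card (\<delta> ` Z) \<le> card Z" by (rule card_image_le[OF Z(1)])
    ultimately show False using Z(2) by simp
  qed
  then obtain x y where xy: "x \<in> cspan S" "y \<in> cspan S" "x \<noteq> y" "L x = L y"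
    by (auto simp: inj_on_def)
  define w where "w = complex_of_real (1 / norm (x - y)) *\<^sub>C (x - y)"
  show ?thesis
  proof (rule that)
    show "w \<in> cspan S"
      unfolding w_def using xy by (intro complex_vector.span_scale complex_vector.span_diff)
    show "norm w = 1" using xy by (simp add: w_def norm_scaleC norm_divide)
    show "cinner z w = 0" if "z \<in> Z" for z
      using fun_cong[OF xy(4), of z] that by (simp add: L_def w_def cinner_scaleC_right cinner_diff_right)
  qed
qed

text \<open>Comparison of two decreasingly sorted families, phrased through counting so that no
  enumeration is chosen. Induction removes the smallest value \<open>a i0\<close>: all indices lie
  above that threshold, so \<open>J'\<close> has at least \<open>card I\<close> members and the
  injection of the remaining indices leaves one of them free.\<close>

lemma dominating_injection:
  fixes a :: "'i \<Rightarrow> real" and b :: "'j \<Rightarrow> real"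
  assumes "finite I"
    and "\<And>i. i \<in> I \<Longrightarrow> \<exists>J'. finite J' \<and> J' \<subseteq> J \<and> (\<forall>j\<in>J'. a i \<le> b j) \<and> card {i' \<in> I. a i \<le> a i'} \<le> card J'"
  shows "\<exists>\<iota>. inj_on \<iota> I \<and> \<iota> ` I \<subseteq> J \<and> (\<forall>i\<in>I. a i \<le> b (\<iota> i))"
  using assms
proof (induction "card I" arbitrary: I)
  case 0
  then show ?case by simp
next
  case (Suc n)
  then have ne: "I \<noteq> {}" by auto
  obtain i0 where i0: "i0 \<in> I" "\<And>i. i \<in> I \<Longrightarrow> a i0 \<le> a i"
    using ex_min_if_finite[of "a ` I"] Suc.prems(1) ne by (metis arg_min_if_finite(1) arg_min_least)
  define I' where "I' = I - {i0}"
  have I': "finite I'" "card I' = n" "I = insert i0 I'" "i0 \<notin> I'"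
    using Suc.hyps(2) Suc.prems(1) i0(1) by (auto simp: I'_def)
  have "\<exists>\<iota>. inj_on \<iota> I' \<and> \<iota> ` I' \<subseteq> J \<and> (\<forall>i\<in>I'. a i \<le> b (\<iota> i))"
  proof (rule Suc.hyps(1))
    show "n = card I'" "finite I'" using I' by auto
    fix i assume i: "i \<in> I'"
    have "card {i' \<in> I'. a i \<le> a i'} \<le> card {i' \<in> I. a i \<le> a i'}"
      using Suc.prems(1) by (intro card_mono) (auto simp: I'_def)
    then show "\<exists>J'. finite J' \<and> J' \<subseteq> J \<and> (\<forall>j\<in>J'. a i \<le> b j) \<and> card {i' \<in> I'. a i \<le> a i'} \<le> card J'"
      using Suc.prems(2)[of i] i I'(3) by (meson insertI2 order_trans)
  qed
  then obtain \<iota> where \<iota>: "inj_on \<iota> I'" "\<iota> ` I' \<subseteq> J" "\<And>i. i \<in> I' \<Longrightarrow> a i \<le> b (\<iota> i)" by blast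
  obtain J' where J': "finite J'" "J' \<subseteq> J" "\<And>j. j \<in> J' \<Longrightarrow> a i0 \<le> b j"
    "card {i' \<in> I. a i0 \<le> a i'} \<le> card J'" using Suc.prems(2)[OF i0(1)] by blast
  have "{i' \<in> I. a i0 \<le> a i'} = I" using i0(2) by auto
  then have "Suc n \<le> card J'" using J'(4) Suc.hyps(2) by simp
  moreover have "card (\<iota> ` I') \<le> n" using card_image_le[OF I'(1), of \<iota>] I'(2) by simp
  ultimately have "card (\<iota> ` I') < card J'" by linarith
  then have "\<not> J' \<subseteq> \<iota> ` I'" using card_mono[of "\<iota> ` I'" J'] I'(1) by auto
  then obtain j where j: "j \<in> J'" "j \<notin> \<iota> ` I'" by blast
  define \<kappa> where "\<kappa> = \<iota>(i0 := j)"
  have "inj_on \<kappa> I" using \<iota>(1) j(2) I'(4) unfolding I'(3) \<kappa>_def by (auto simp: inj_on_def)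
  moreover have "\<kappa> ` I \<subseteq> J" using \<iota>(2) j(1) J'(2) I'(4) unfolding I'(3) \<kappa>_def by auto
  moreover have "\<forall>i\<in>I. a i \<le> b (\<kappa> i)" using \<iota>(3) J'(3)[OF j(1)] unfolding I'(3) \<kappa>_def by auto
  ultimately show ?case by blast
qed

lemma norm_image_diagonal:
  fixes F :: "'h::complex_hilbert_space \<Rightarrow> 'h"
  assumes F: "compact_operator F" and S: "onset S"
    and diag: "\<And>s t. s \<in> S \<Longrightarrow> t \<in> S \<Longrightarrow> s \<noteq> t \<Longrightarrow> cinner (F s) (F t) = 0"
    and x: "x \<in> cspan S"
  shows "(norm (F x))\<^sup>2 = (\<Sum>s\<in>S. (cmod (cinner s x))\<^sup>2 * (norm (F s))\<^sup>2)"
proof -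
  interpret F: bounded_linear F by (rule compact_operator_bounded_linear[OF F])
  have Fx: "F x = (\<Sum>s\<in>S. cinner s x *\<^sub>C F s)"
    using arg_cong[OF onset_expand[OF S x], of F] by (simp add: F.sum compact_operator_scaleC[OF F])
  have "complex_of_real ((norm (F x))\<^sup>2) = (\<Sum>s\<in>S. \<Sum>t\<in>S. cnj (cinner s x) * (cinner t x * cinner (F s) (F t)))"
    unfolding cinner_self[symmetric] Fx cinner_sum_left cinner_scaleC_left
    by (simp only: cinner_sum_right cinner_scaleC_right sum_distrib_left)
  also have "\<dots> = (\<Sum>s\<in>S. \<Sum>t\<in>S. if s = t then complex_of_real ((cmod (cinner s x))\<^sup>2 * (norm (F s))\<^sup>2) else 0)"
    using diag by (intro sum.cong refl) (auto simp: cinner_self complex_norm_square mult_ac simp del: of_real_power)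
  also have "\<dots> = complex_of_real (\<Sum>s\<in>S. (cmod (cinner s x))\<^sup>2 * (norm (F s))\<^sup>2)"
    using onset_finite[OF S] by simp
  finally show ?thesis by (simp only: of_real_eq_iff)
qed

lemma schatten_norm_powr:
  assumes "0 < p"
  shows "schatten_norm p F powr p = (\<Sum>\<^sub>\<infinity>(\<sigma>, i)\<in>sv_index F. \<sigma> powr p)"
  unfolding schatten_norm_def using assms
  by (simp add: powr_powr infsum_nonneg case_prod_beta)

lemma schatten_norm_nonneg: "0 \<le> schatten_norm p F"
  by (simp add: schatten_norm_def)

lemma finite_large_singular_values:
  assumes A: "A \<in> schatten_class p" and p: "0 < p" and \<tau>: "0 < \<tau>"
  shows "finite {j \<in> sv_index A. \<tau> \<le> fst j}"
proof (rule ccontr)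
  assume inf: "infinite {j \<in> sv_index A. \<tau> \<le> fst j}"
  have sm: "(\<lambda>(\<sigma>, i). \<sigma> powr p) summable_on sv_index A"
    using A by (simp add: schatten_class_def)
  define c where "c = (\<Sum>\<^sub>\<infinity>(\<sigma>, i)\<in>sv_index A. \<sigma> powr p)"
  obtain n :: nat where n: "c / (\<tau> powr p) < real n" using reals_Archimedean2 by blast
  obtain K where K: "finite K" "card K = n" "K \<subseteq> {j \<in> sv_index A. \<tau> \<le> fst j}"
    using infinite_arbitrarily_large[OF inf] by blast
  have "real n * \<tau> powr p = (\<Sum>j\<in>K. \<tau> powr p)" by (simp add: K)
  also have "\<dots> \<le> (\<Sum>j\<in>K. case j of (\<sigma>, i) \<Rightarrow> \<sigma> powr p)"
    using K \<tau> p by (intro sum_mono) (auto intro!: powr_mono2)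
  also have "\<dots> \<le> c" unfolding c_def using K by (intro finite_sum_le_infsum sm) auto
  finally show False using n \<tau> by (simp add: divide_less_eq)
qed

text \<open>With \<open>Z = {}\<close>, \<open>L = 1\<close> and \<open>A = F\<close> this bounds the diagonal of \<open>F\<close> in any orthonormal system
  that diagonalises \<open>F\<^sup>* F\<close> on its span; the general case compares \<open>F\<close> with \<open>A\<close> modulo finite rank.\<close>

lemma sum_diagonal_le_schatten_norm:
  fixes F A :: "'h::complex_hilbert_space \<Rightarrow> 'h"
  assumes p: "0 < p" and F: "compact_operator F" and A: "A \<in> schatten_class p" and L: "0 < L"
    and Z: "finite Z" "\<And>w. (\<And>z. z \<in> Z \<Longrightarrow> cinner z w = 0) \<Longrightarrow> norm (F w) \<le> L * norm (A w)"
    and C: "0 \<le> C" "Z \<noteq> {} \<Longrightarrow> \<forall>w. norm (F w) \<le> C * norm w"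
    and S: "onset S"
    and diag: "\<And>s t. s \<in> S \<Longrightarrow> t \<in> S \<Longrightarrow> s \<noteq> t \<Longrightarrow> cinner (F s) (F t) = 0"
  shows "(\<Sum>s\<in>S. norm (F s) powr p)
    \<le> L powr p * schatten_norm p A powr p + real (card Z) * C powr p"
proof -
  have cA: "compact_operator A" and sm: "(\<lambda>(\<sigma>, i). \<sigma> powr p) summable_on sv_index A"
    using A by (auto simp: schatten_class_def)
  obtain e where e: "singular_system A e" by (rule singular_system_exists[OF cA])
  define I where "I = {s \<in> S. F s \<noteq> 0}"
  \<comment> \<open>The values \<open>norm (F s)\<close> are matched with the singular values of
    \<open>A\<close> scaled by \<open>L\<close> and with one extra value \<open>C\<close> for each
    \<open>z\<close> in \<open>Z\<close>.\<close>
  define J :: "(real \<times> nat + 'h) set" where "J = Inl ` sv_index A \<union> Inr ` Z"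
  define b where "b j = (case j of Inl \<sigma>i \<Rightarrow> L * fst \<sigma>i | Inr z \<Rightarrow> C)" for j :: "real \<times> nat + 'h"
  have finI: "finite I" using onset_finite[OF S] by (simp add: I_def)
  have "\<exists>\<iota>. inj_on \<iota> I \<and> \<iota> ` I \<subseteq> J \<and> (\<forall>i\<in>I. norm (F i) \<le> b (\<iota> i))"
  proof (rule dominating_injection[OF finI])
    fix s assume s: "s \<in> I"
    define \<tau> where "\<tau> = norm (F s)"
    have \<tau>: "0 < \<tau>" using s by (simp add: I_def \<tau>_def)
    define K where "K = {j \<in> sv_index A. \<tau> / L \<le> fst j}"
    have K: "finite K" unfolding K_def using \<tau> L by (intro finite_large_singular_values[OF A p]) simp
    define J' where "J' = (Inl ` K \<union> Inr ` Z :: (real \<times> nat + 'h) set)"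
    have cJ': "card J' = card K + card Z"
      unfolding J'_def using K Z(1) by (subst card_Un_disjoint) (auto simp: card_image)
    define S' where "S' = {s' \<in> I. \<tau> \<le> norm (F s')}"
    have S'S: "S' \<subseteq> S" by (auto simp: S'_def I_def)
    note S' = onset_subset[OF S S'S]
    \<comment> \<open>Otherwise the span of \<open>S'\<close> contains a unit vector orthogonal to
      \<open>Z\<close> and to the singular vectors of \<open>A\<close> with value at least
      \<open>\<tau> / L\<close>. Its image under \<open>F\<close> has norm below
      \<open>\<tau>\<close> by comparison with \<open>A\<close>, but at least \<open>\<tau>\<close>
      because \<open>S'\<close> diagonalises the form.\<close>
    have "card S' \<le> card J'"
    proof (rule ccontr)
      assume "\<not> card S' \<le> card J'"
      moreover have "card (e ` K \<union> Z) \<le> card J'"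
        unfolding cJ' using card_Un_le[of "e ` K" Z] card_image_le[OF K, of e] by linarith
      ultimately obtain w where w: "w \<in> cspan S'" "norm w = 1"
        "\<And>z. z \<in> e ` K \<union> Z \<Longrightarrow> cinner z w = 0"
        using exists_unit_in_span_orthogonal[OF S', of "e ` K \<union> Z"] K Z(1) by auto
      have "norm (A w) < \<tau> / L"
        using \<tau> L K w by (intro norm_less_of_orthogonal[OF cA e]) (auto simp: K_def)
      then have "norm (F w) < \<tau>" using Z(2)[of w] w(3) L by (simp add: less_divide_eq mult.commute)
      moreover have "\<tau>\<^sup>2 \<le> (norm (F w))\<^sup>2"
      proof -
        have "\<tau>\<^sup>2 = (\<Sum>s\<in>S'. (cmod (cinner s w))\<^sup>2 * \<tau>\<^sup>2)"
          using onset_parseval[OF S' w(1)] w(2) by (simp add: sum_distrib_right[symmetric])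
        also have "\<dots> \<le> (\<Sum>s\<in>S'. (cmod (cinner s w))\<^sup>2 * (norm (F s))\<^sup>2)"
          using \<tau> by (intro sum_mono mult_left_mono power_mono) (auto simp: S'_def)
        also have "\<dots> = (norm (F w))\<^sup>2"
          by (rule norm_image_diagonal[symmetric, OF F S' _ w(1)]) (use diag S'S in blast)
        finally show ?thesis .
      qed
      ultimately show False using power_strict_mono[of "norm (F w)" \<tau> 2] by simp
    qed
    moreover have "\<forall>j\<in>J'. \<tau> \<le> b j"
    proof -
      have "\<tau> \<le> C" if "z \<in> Z" for z
        using C(2) that onset_norm[OF S, of s] s unfolding \<tau>_def I_def by (metis (lifting) empty_iff mem_Collect_eq mult.right_neutral)
      then show ?thesis using L by (auto simp: J'_def K_def b_def field_simps)
    qed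
    moreover have "finite J'" "J' \<subseteq> J" using K Z(1) by (auto simp: J'_def J_def K_def)
    ultimately show "\<exists>J'. finite J' \<and> J' \<subseteq> J \<and> (\<forall>j\<in>J'. norm (F s) \<le> b j)
        \<and> card {i' \<in> I. norm (F s) \<le> norm (F i')} \<le> card J'"
      unfolding S'_def \<tau>_def by blast
  qed
  then obtain \<iota> where \<iota>: "inj_on \<iota> I" "\<iota> ` I \<subseteq> J" "\<And>i. i \<in> I \<Longrightarrow> norm (F i) \<le> b (\<iota> i)" by blast
  define K where "K = {j. Inl j \<in> \<iota> ` I}"
  define Y where "Y = {z. Inr z \<in> \<iota> ` I}"
  have im: "\<iota> ` I = Inl ` K \<union> Inr ` Y"
  proof (intro set_eqI)
    show "j \<in> \<iota> ` I \<longleftrightarrow> j \<in> Inl ` K \<union> Inr ` Y" for j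
      by (cases j) (auto simp: K_def Y_def)
  qed
  have "finite (Inl ` K \<union> Inr ` Y :: (real \<times> nat + 'h) set)"
    unfolding im[symmetric] using finI by simp
  then have finK: "finite K" "finite Y" by (simp_all add: finite_image_iff)
  have sub: "K \<subseteq> sv_index A" "Y \<subseteq> Z" using \<iota>(2) by (auto simp: K_def Y_def J_def)
  have "(\<Sum>s\<in>S. norm (F s) powr p) = (\<Sum>s\<in>I. norm (F s) powr p)"
    unfolding I_def using onset_finite[OF S] by (intro sum.mono_neutral_right) auto
  also have "\<dots> \<le> (\<Sum>s\<in>I. b (\<iota> s) powr p)"
    using \<iota>(3) p by (intro sum_mono powr_mono2) auto
  also have "\<dots> = (\<Sum>j\<in>\<iota> ` I. b j powr p)" by (simp add: sum.reindex[OF \<iota>(1)])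
  also have "\<dots> = (\<Sum>j\<in>K. (L * fst j) powr p) + (\<Sum>z\<in>Y. C powr p)"
    unfolding im using finK by (subst sum.union_disjoint) (auto simp: sum.reindex b_def)
  also have "(\<Sum>j\<in>K. (L * fst j) powr p) = L powr p * (\<Sum>j\<in>K. case j of (\<sigma>, i) \<Rightarrow> \<sigma> powr p)"
    unfolding sum_distrib_left using L sub(1) sv_index_pos
    by (intro sum.cong refl) (auto simp: case_prod_beta subset_eq intro!: powr_mult)
  also have "(\<Sum>j\<in>K. case j of (\<sigma>, i) \<Rightarrow> \<sigma> powr p) \<le> schatten_norm p A powr p"
    unfolding schatten_norm_powr[OF p] using finK sub by (intro finite_sum_le_infsum sm) auto
  also have "(\<Sum>z\<in>Y. C powr p) \<le> real (card Z) * C powr p"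
    using card_mono[OF Z(1) sub(2)] by (simp add: mult_right_mono)
  finally show ?thesis by (simp add: mult_left_mono)
qed

lemma diagonal_sum_le_schatten_norm:
  fixes F :: "'h::complex_hilbert_space \<Rightarrow> 'h"
  assumes p: "0 < p" and F: "F \<in> schatten_class p" and S: "onset S"
    and diag: "\<And>s t. s \<in> S \<Longrightarrow> t \<in> S \<Longrightarrow> s \<noteq> t \<Longrightarrow> cinner (F s) (F t) = 0"
  shows "(\<Sum>s\<in>S. norm (F s) powr p) \<le> schatten_norm p F powr p"
proof -
  have "(\<Sum>s\<in>S. norm (F s) powr p) \<le> 1 powr p * schatten_norm p F powr p + real (card ({} :: 'h set)) * 0 powr p"
    by (rule sum_diagonal_le_schatten_norm[OF p _ F _ _ _ _ _ S diag])
      (use F in \<open>auto simp: schatten_class_def\<close>)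
  then show ?thesis by simp
qed

text \<open>The infinite sum is the supremum of its finite parts, each realised by a finite
  orthonormal system of singular vectors. The orthogonality available in \<open>le\<close> is the
  eigenvector property of \<open>s\<close>, tested against every \<open>y\<close> orthogonal to
  \<open>s\<close>.\<close>

lemma schatten_norm_powr_le:
  fixes F :: "'h::complex_hilbert_space \<Rightarrow> 'h"
  assumes p: "0 < p" and F: "F \<in> schatten_class p"
    and le: "\<And>S. onset S \<Longrightarrow> (\<And>s y. s \<in> S \<Longrightarrow> cinner s y = 0 \<Longrightarrow> cinner (F s) (F y) = 0)
      \<Longrightarrow> (\<Sum>s\<in>S. norm (F s) powr p) \<le> c"
  shows "schatten_norm p F powr p \<le> c"
proof -
  have cF: "compact_operator F" and sm: "(\<lambda>(\<sigma>, i). \<sigma> powr p) summable_on sv_index F"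
    using F by (auto simp: schatten_class_def)
  obtain e where e: "singular_system F e" by (rule singular_system_exists[OF cF])
  show ?thesis
    unfolding schatten_norm_powr[OF p]
  proof (rule infsum_le_finite_sums[OF sm])
    fix J assume J: "finite J" "J \<subseteq> sv_index F"
    note o = singular_system_onset[OF e J]
    have "(\<Sum>j\<in>J. case j of (\<sigma>, i) \<Rightarrow> \<sigma> powr p) = (\<Sum>s\<in>e ` J. norm (F s) powr p)"
      using o(2,3) by (simp add: sum.reindex case_prod_beta)
    also have "\<dots> \<le> c" by (rule le[OF o(1,4)])
    finally show "(\<Sum>j\<in>J. case j of (\<sigma>, i) \<Rightarrow> \<sigma> powr p) \<le> c" .
  qed
qed

lemma norm_le_schatten_norm:
  fixes F :: "'h::complex_hilbert_space \<Rightarrow> 'h"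
  assumes p: "0 < p" and F: "F \<in> schatten_class p"
  shows "norm (F x) \<le> schatten_norm p F * norm x"
proof -
  have cF: "compact_operator F" using F by (auto simp: schatten_class_def)
  interpret F: bounded_linear F by (rule compact_operator_bounded_linear[OF cF])
  show ?thesis
  proof (cases "x = 0")
    case False
    define s where "s = (1 / norm x) *\<^sub>R x"
    have "norm s = 1" using False by (simp add: s_def)
    then have "onset {s}" by (simp add: onset_def cinner_self)
    then have "norm (F s) powr p \<le> schatten_norm p F powr p"
      using diagonal_sum_le_schatten_norm[OF p F, of "{s}"] by simp
    then have "norm (F s) \<le> schatten_norm p F"
      using p schatten_norm_nonneg powr_less_mono2[OF p schatten_norm_nonneg] by (meson linorder_not_le)
    then show ?thesis using False by (simp add: s_def F.scaleR divide_le_eq)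
  qed (simp add: F.zero)
qed

text \<open>The images \<open>B (e j)\<close> divided by their singular values are orthonormal in
  the range of \<open>B\<close>, so there are at most \<open>k\<close> of them. As \<open>S\<close>
  is a complete system of right singular vectors, \<open>B\<close> vanishes on its orthogonal
  complement.\<close>

lemma finite_rank_singular_system:
  fixes B :: "'h::complex_hilbert_space \<Rightarrow> 'h"
  assumes p: "0 < p" and B: "B \<in> schatten_class p" and rank: "crank B \<le> enat k"
  obtains S where "onset S" "card S \<le> k"
    "\<And>s y. s \<in> S \<Longrightarrow> cinner s y = 0 \<Longrightarrow> cinner (B s) (B y) = 0"
    "schatten_norm p B powr p = (\<Sum>s\<in>S. norm (B s) powr p)"
    "\<And>w. (\<And>s. s \<in> S \<Longrightarrow> cinner s w = 0) \<Longrightarrow> B w = 0"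
proof -
  have cB: "compact_operator B" using B by (auto simp: schatten_class_def)
  interpret B: bounded_linear B by (rule compact_operator_bounded_linear[OF cB])
  obtain e where e: "singular_system B e" by (rule singular_system_exists[OF cB])
  obtain T where T: "finite T" "range B \<subseteq> cspan T" and dim: "cdim (range B) \<le> k"
    using rank by (auto simp: crank_def split: if_splits)
  obtain T' where T': "T' \<subseteq> range B" "\<not> complex_vector.dependent T'" "range B \<subseteq> cspan T'"
      "card T' = cdim (range B)"
    using complex_vector.basis_exists by metis
  have finT': "finite T'"
    using complex_vector.independent_span_bound[OF T(1) T'(2)] T' T by blast
  have card: "card J \<le> k" if J: "finite J" "J \<subseteq> sv_index B" for J
  proof -
    define b where "b j = complex_of_real (1 / fst j) *\<^sub>C B (e j)" for j
    have ob: "cinner (b i) (b j) = (if i = j then 1 else 0)" if ij: "i \<in> J" "j \<in> J" for i j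
    proof -
      have "i \<in> sv_index B" "j \<in> sv_index B" using ij J by auto
      then show ?thesis
        using sv_index_pos[of j B]
        by (auto simp: b_def cinner_scaleC_left cinner_scaleC_right singular_systemD[OF e] power2_eq_square)
    qed
    have inj: "inj_on b J" by (rule inj_onI) (metis ob one_neq_zero)
    then have "onset (b ` J)" using J ob by (auto simp: onset_def inj_on_eq_iff)
    moreover have "b ` J \<subseteq> range B"
      unfolding b_def by (auto simp: compact_operator_scaleC[OF cB, symmetric])
    ultimately have "card (b ` J) \<le> card T'" using T'(3) finT' by (intro onset_card_le) auto
    then show ?thesis using inj dim T'(4) by (simp add: card_image)
  qed
  have fin: "finite (sv_index B)"
    using finite_if_finite_subsets_card_bdd[of "sv_index B" k] card by blast
  define S where "S = e ` sv_index B"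
  note o = singular_system_onset[OF e fin order_refl]
  show ?thesis
  proof (rule that[of S])
    show "onset S" using o(1) by (simp add: S_def)
    show "card S \<le> k" using card[OF fin] o(2) by (simp add: S_def card_image)
    show "cinner (B s) (B y) = 0" if "s \<in> S" "cinner s y = 0" for s y
      using o(4) that by (simp add: S_def)
    show "schatten_norm p B powr p = (\<Sum>s\<in>S. norm (B s) powr p)"
      unfolding schatten_norm_powr[OF p] S_def using fin o(2,3)
      by (simp add: sum.reindex case_prod_beta)
    show "B w = 0" if w: "\<And>s. s \<in> S \<Longrightarrow> cinner s w = 0" for w
    proof (rule ccontr)
      assume "B w \<noteq> 0"
      then have "w \<noteq> 0" using B.zero by auto
      define v where "v = (1 / norm w) *\<^sub>R w"
      have "norm (B v) < norm (B v)"
      proof (rule norm_less_of_orthogonal[OF cB e])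
        show "0 < norm (B v)" using \<open>B w \<noteq> 0\<close> \<open>w \<noteq> 0\<close> by (simp add: v_def B.scaleR)
        show "norm v = 1" using \<open>w \<noteq> 0\<close> by (simp add: v_def)
        show "cinner (e j) v = 0" if "j \<in> sv_index B" for j
          using w that by (simp add: v_def scaleR_scaleC[where 'a = 'h] cinner_scaleC_right S_def)
        show "finite {j \<in> sv_index B. norm (B v) \<le> fst j}" using fin by simp
      qed
      then show False by simp
    qed
  qed
qed

subsection \<open>Taylor remainder of a power\<close>

text \<open>The second divided difference of the power at \<open>l\<close>, \<open>l\<close>,
  \<open>x\<close>, in integral form. This form stays meaningful at \<open>x = l\<close> and
  inherits sign and Lipschitz bounds from the second derivative.\<close>

definition powr_remainder :: "real \<Rightarrow> real \<Rightarrow> real \<Rightarrow> real"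
  where "powr_remainder \<alpha> l x =
    integral {0..1} (\<lambda>s. (1 - s) * (\<alpha> * (\<alpha> - 1) * (l + s * (x - l)) powr (\<alpha> - 2)))"

lemma convex_combination_ge:
  fixes l x s :: real
  assumes "\<epsilon> \<le> l" "\<epsilon> \<le> x" "0 \<le> s" "s \<le> 1"
  shows "\<epsilon> \<le> l + s * (x - l)"
proof -
  have "(1 - s) * \<epsilon> + s * \<epsilon> \<le> (1 - s) * l + s * x"
    using assms by (intro add_mono mult_left_mono) auto
  then show ?thesis by (simp add: algebra_simps)
qed

lemma powr_remainder_integrable:
  fixes l x :: real
  assumes "0 < l" "0 < x"
  shows "(\<lambda>s. (1 - s) * (\<alpha> * (\<alpha> - 1) * (l + s * (x - l)) powr (\<alpha> - 2))) integrable_on {0..1}"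
proof (intro integrable_continuous_interval continuous_intros ballI)
  fix s :: real assume "s \<in> {0..1}"
  then show "l + s * (x - l) \<noteq> 0"
    using convex_combination_ge[of "min l x" l x s] assms by auto
qed

lemma powr_taylor:
  fixes l x :: real
  assumes "0 < l" "0 < x"
  shows "x powr \<alpha> = l powr \<alpha> + \<alpha> * l powr (\<alpha> - 1) * (x - l) + powr_remainder \<alpha> l x * (x - l)\<^sup>2"
proof -
  define h where "h s = (1 - s) * (\<alpha> * (\<alpha> - 1) * (l + s * (x - l)) powr (\<alpha> - 2))" for s
  \<comment> \<open>An antiderivative found by integrating by parts; its endpoint values are the
    power at \<open>x\<close> and the tangent at \<open>l\<close> evaluated at
    \<open>x\<close>.\<close>
  define G where "G s = (1 - s) * (\<alpha> * (l + s * (x - l)) powr (\<alpha> - 1)) * (x - l) + (l + s * (x - l)) powr \<alpha>" for s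
  have "(G has_vector_derivative h s * (x - l)\<^sup>2) (at s within {0..1})" if "s \<in> {0..1}" for s
  proof -
    have pos: "0 < l + s * (x - l)"
      using convex_combination_ge[of "min l x" l x s] assms that by auto
    have "(G has_real_derivative h s * (x - l)\<^sup>2) (at s within {0..1})"
      unfolding G_def h_def using pos
      by (auto intro!: derivative_eq_intros simp: power2_eq_square algebra_simps)
    then show ?thesis by (simp add: has_real_derivative_iff_has_vector_derivative)
  qed
  then have "((\<lambda>s. h s * (x - l)\<^sup>2) has_integral (G 1 - G 0)) {0..1}"
    by (intro fundamental_theorem_of_calculus) auto
  moreover have "((\<lambda>s. h s * (x - l)\<^sup>2) has_integral (integral {0..1} h * (x - l)\<^sup>2)) {0..1}"
    using powr_remainder_integrable[OF assms] unfolding h_def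
    by (intro has_integral_mult_left integrable_integral)
  ultimately have "integral {0..1} h * (x - l)\<^sup>2 = G 1 - G 0" by (rule has_integral_unique[rotated])
  moreover have "powr_remainder \<alpha> l x = integral {0..1} h"
    unfolding powr_remainder_def h_def ..
  ultimately show ?thesis by (simp add: G_def algebra_simps)
qed

lemma powr_remainder_nonpos:
  assumes "0 < l" "0 < x" "0 < \<alpha>" "\<alpha> \<le> 1"
  shows "powr_remainder \<alpha> l x \<le> 0"
proof -
  have "powr_remainder \<alpha> l x \<le> integral {0..1} (\<lambda>s::real. 0 :: real)"
    unfolding powr_remainder_def
  proof (rule integral_le[OF powr_remainder_integrable[OF assms(1,2)] integrable_0])
    fix s :: real assume "s \<in> {0..1}"
    then show "(1 - s) * (\<alpha> * (\<alpha> - 1) * (l + s * (x - l)) powr (\<alpha> - 2)) \<le> 0"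
      using assms by (intro mult_nonneg_nonpos mult_nonpos_nonneg) auto
  qed
  then show ?thesis by simp
qed

text \<open>The second derivative of the power is Lipschitz on \<open>{\<epsilon>..}\<close>: the
  third has a coefficient of absolute value at most 2 and a negative exponent. The factors
  \<open>1 - s\<close> and \<open>s\<close> are at most 1.\<close>

lemma powr_remainder_lipschitz:
  assumes \<epsilon>: "0 < \<epsilon>" "\<epsilon> \<le> l" "\<epsilon> \<le> x" "\<epsilon> \<le> y" and \<alpha>: "0 < \<alpha>" "\<alpha> \<le> 1"
  shows "\<bar>powr_remainder \<alpha> l x - powr_remainder \<alpha> l y\<bar> \<le> 2 * \<epsilon> powr (\<alpha> - 3) * \<bar>x - y\<bar>"
proof -
  define k where "k u = \<alpha> * (\<alpha> - 1) * u powr (\<alpha> - 2)" for u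
  have k: "\<bar>k u - k v\<bar> \<le> 2 * \<epsilon> powr (\<alpha> - 3) * \<bar>u - v\<bar>" if "\<epsilon> \<le> u" "\<epsilon> \<le> v" for u v
  proof -
    have "norm (k u - k v) \<le> 2 * \<epsilon> powr (\<alpha> - 3) * norm (u - v)"
    proof (rule field_differentiable_bound[of "{\<epsilon>..}"])
      fix z assume z: "z \<in> {\<epsilon>..}"
      show "(k has_field_derivative \<alpha> * (\<alpha> - 1) * ((\<alpha> - 2) * z powr (\<alpha> - 3))) (at z within {\<epsilon>..})"
        unfolding k_def using z \<epsilon> by (auto intro!: derivative_eq_intros)
      have "\<bar>\<alpha> * (\<alpha> - 1) * (\<alpha> - 2)\<bar> \<le> 1 * 1 * 2"
        unfolding abs_mult using \<alpha> by (intro mult_mono) auto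
      moreover have "z powr (\<alpha> - 3) \<le> \<epsilon> powr (\<alpha> - 3)"
        using z \<epsilon> \<alpha> by (intro powr_mono2') auto
      ultimately have "\<bar>\<alpha> * (\<alpha> - 1) * (\<alpha> - 2)\<bar> * z powr (\<alpha> - 3) \<le> 2 * \<epsilon> powr (\<alpha> - 3)"
        by (intro mult_mono) auto
      then show "norm (\<alpha> * (\<alpha> - 1) * ((\<alpha> - 2) * z powr (\<alpha> - 3))) \<le> 2 * \<epsilon> powr (\<alpha> - 3)"
        by (simp add: abs_mult mult.assoc)
    qed (use that in auto)
    then show ?thesis by simp
  qed
  define D where "D = integral {0..1} (\<lambda>s. (1 - s) * k (l + s * (x - l)) - (1 - s) * k (l + s * (y - l)))"
  have int: "(\<lambda>s. (1 - s) * k (l + s * (x - l))) integrable_on {0..1}" 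
    "(\<lambda>s. (1 - s) * k (l + s * (y - l))) integrable_on {0..1}"
    unfolding k_def using \<epsilon> by (intro powr_remainder_integrable; simp)+
  have "norm D \<le> integral {0..1::real} (\<lambda>_. 2 * \<epsilon> powr (\<alpha> - 3) * \<bar>x - y\<bar>)"
    unfolding D_def
  proof (rule integral_norm_bound_integral[OF integrable_diff[OF int] integrable_const_ivl])
    fix s :: real assume "s \<in> {0..1}"
    then have s: "0 \<le> s" "s \<le> 1" by auto
    have "\<bar>k (l + s * (x - l)) - k (l + s * (y - l))\<bar>
        \<le> 2 * \<epsilon> powr (\<alpha> - 3) * \<bar>(l + s * (x - l)) - (l + s * (y - l))\<bar>"
      using \<epsilon> s by (intro k convex_combination_ge) auto
    also have "\<dots> = s * (2 * \<epsilon> powr (\<alpha> - 3) * \<bar>x - y\<bar>)"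
    proof -
      have "(l + s * (x - l)) - (l + s * (y - l)) = s * (x - y)" by (simp add: algebra_simps)
      then show ?thesis using s by (simp add: abs_mult)
    qed
    also have "\<dots> \<le> 1 * (2 * \<epsilon> powr (\<alpha> - 3) * \<bar>x - y\<bar>)"
      using s by (intro mult_right_mono) auto
    finally have *: "\<bar>k (l + s * (x - l)) - k (l + s * (y - l))\<bar> \<le> 2 * \<epsilon> powr (\<alpha> - 3) * \<bar>x - y\<bar>" by simp
    have "norm ((1 - s) * k (l + s * (x - l)) - (1 - s) * k (l + s * (y - l)))
        = (1 - s) * \<bar>k (l + s * (x - l)) - k (l + s * (y - l))\<bar>"
      using s by (simp add: right_diff_distrib[symmetric] abs_mult)
    also have "\<dots> \<le> 1 * (2 * \<epsilon> powr (\<alpha> - 3) * \<bar>x - y\<bar>)"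
      using s * by (intro mult_mono) auto
    finally show "norm ((1 - s) * k (l + s * (x - l)) - (1 - s) * k (l + s * (y - l)))
        \<le> 2 * \<epsilon> powr (\<alpha> - 3) * \<bar>x - y\<bar>" by simp
  qed
  moreover have "D = powr_remainder \<alpha> l x - powr_remainder \<alpha> l y"
    unfolding D_def integral_diff[OF int] by (simp add: powr_remainder_def k_def)
  ultimately show ?thesis by simp
qed

text \<open>The right-hand side is the divided difference of \<open>x * (x powr \<alpha>)'\<close> at \<open>l\<close> and \<open>x\<close>.\<close>

lemma powr_remainder_symmetrized:
  assumes "0 < l" "l \<le> L" "0 < x" "x \<le> L" and \<alpha>: "0 < \<alpha>" "\<alpha> \<le> 1"
  shows "\<alpha>\<^sup>2 * L powr (\<alpha> - 1) \<le>
    \<alpha> * x powr (\<alpha> - 1) + l * (powr_remainder \<alpha> l x + powr_remainder \<alpha> x l)"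
proof -
  define \<kappa> where "\<kappa> = \<alpha>\<^sup>2 * L powr (\<alpha> - 1)"
  have \<kappa>: "\<kappa> \<le> \<alpha>\<^sup>2 * z powr (\<alpha> - 1)" if "0 < z" "z \<le> L" for z
    unfolding \<kappa>_def using that \<alpha> by (intro mult_left_mono powr_mono2') auto
  \<comment> \<open>Mean value theorem for \<open>\<alpha> * x powr \<alpha>\<close>, whose
    derivative is nonincreasing and so least at \<open>L\<close>.\<close>
  have mvt: "\<kappa> * (b - a) \<le> \<alpha> * b powr \<alpha> - \<alpha> * a powr \<alpha>" if ab: "0 < a" "a < b" "b \<le> L" for a b
  proof -
    have "\<exists>z. a < z \<and> z < b \<and> \<alpha> * b powr \<alpha> - \<alpha> * a powr \<alpha> = (b - a) * (\<alpha> * (\<alpha> * z powr (\<alpha> - 1)))"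
      using ab by (intro MVT2) (auto intro!: derivative_eq_intros)
    then obtain z where z: "a < z" "z < b"
      and eq: "\<alpha> * b powr \<alpha> - \<alpha> * a powr \<alpha> = (b - a) * (\<alpha> * (\<alpha> * z powr (\<alpha> - 1)))" by blast
    have "(b - a) * \<kappa> \<le> (b - a) * (\<alpha>\<^sup>2 * z powr (\<alpha> - 1))"
      using z ab \<kappa>[of z] by (intro mult_left_mono) auto
    then show ?thesis unfolding eq by (simp add: power2_eq_square mult_ac)
  qed
  have mul: "u * u powr (\<alpha> - 1) = u powr \<alpha>" if "0 < u" for u
    using that by (simp add: powr_diff)
  show ?thesis
  proof (cases "l = x")
    case True
    \<comment> \<open>On the diagonal the divided difference is a derivative: each remainder is half
      the second derivative.\<close>
    define c where "c = \<alpha> * (\<alpha> - 1) * l powr (\<alpha> - 2)"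
    have "((\<lambda>s::real. (1 - s) * c) has_integral (1 - 1\<^sup>2 / 2) * c - (0 - 0\<^sup>2 / 2) * c) {0..1}"
      by (rule fundamental_theorem_of_calculus)
        (auto intro!: derivative_eq_intros simp: has_real_derivative_iff_has_vector_derivative[symmetric])
    then have "integral {0..1} (\<lambda>s::real. (1 - s) * c) = (1 - 1\<^sup>2 / 2) * c - (0 - 0\<^sup>2 / 2) * c"
      by (rule integral_unique)
    moreover have "powr_remainder \<alpha> l l = integral {0..1} (\<lambda>s::real. (1 - s) * c)"
      by (simp add: powr_remainder_def c_def)
    ultimately have "powr_remainder \<alpha> l l = c / 2" by simp
    then have "l * (powr_remainder \<alpha> l x + powr_remainder \<alpha> x l) = \<alpha> * (\<alpha> - 1) * (l * l powr (\<alpha> - 2))"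
      using True by (simp add: c_def)
    also have "l * l powr (\<alpha> - 2) = l powr (\<alpha> - 1)"
      using assms(1) powr_add[of l 1 "\<alpha> - 2"] by simp
    finally have "\<alpha> * x powr (\<alpha> - 1) + l * (powr_remainder \<alpha> l x + powr_remainder \<alpha> x l)
        = \<alpha>\<^sup>2 * l powr (\<alpha> - 1)"
      using True by (simp add: power2_eq_square algebra_simps)
    then show ?thesis using \<kappa>[of l] assms by (simp add: \<kappa>_def)
  next
    case False
    define r where "r = powr_remainder \<alpha> l x + powr_remainder \<alpha> x l"
    \<comment> \<open>Adding the two expansions with base points exchanged leaves the divided
      difference of the first derivative.\<close>
    have "r * (x - l) * (x - l) = (\<alpha> * x powr (\<alpha> - 1) - \<alpha> * l powr (\<alpha> - 1)) * (x - l)"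
      using powr_taylor[OF assms(1,3), of \<alpha>] powr_taylor[OF assms(3,1), of \<alpha>]
      by (simp add: r_def power2_commute[of l x] power2_eq_square algebra_simps)
    then have r: "r * (x - l) = \<alpha> * x powr (\<alpha> - 1) - \<alpha> * l powr (\<alpha> - 1)" using False by simp
    have eq: "(\<alpha> * x powr (\<alpha> - 1) + l * r) * (x - l) = \<alpha> * x powr \<alpha> - \<alpha> * l powr \<alpha>"
      using arg_cong[OF r, of "(*) l"] mul[OF assms(1)] mul[OF assms(3)] by (simp add: algebra_simps)
    have "\<kappa> \<le> \<alpha> * x powr (\<alpha> - 1) + l * r"
    proof (cases "l < x")
      case True
      then have "\<kappa> * (x - l) \<le> (\<alpha> * x powr (\<alpha> - 1) + l * r) * (x - l)"
        using mvt[of l x] assms eq by simp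
      then show ?thesis using True by simp
    next
      case 2: False
      then have "\<kappa> * (l - x) \<le> (\<alpha> * x powr (\<alpha> - 1) + l * r) * (l - x)"
        using mvt[of x l] assms eq False by (simp add: algebra_simps)
      then show ?thesis using 2 False by simp
    qed
    then show ?thesis by (simp add: r_def \<kappa>_def)
  qed
qed

subsection \<open>Second-order perturbation of trace functionals\<close>

definition diagonalizes :: "('h::complex_hilbert_space \<Rightarrow> 'h) \<Rightarrow> 'h set \<Rightarrow> bool"
  where "diagonalizes F S \<longleftrightarrow> (\<forall>s\<in>S. \<forall>t\<in>S. s \<noteq> t \<longrightarrow> cinner (F s) (F t) = 0)"

text \<open>When \<open>S\<close> diagonalises \<open>F\<close>, this is the trace of the
  \<open>\<alpha>\<close>-th power of the compression of \<open>F* F + \<epsilon>\<close> to the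
  span of \<open>S\<close>. The shift keeps the eigenvalues away from the singularity of the power
  at 0.\<close>

definition reg_trace :: "real \<Rightarrow> real \<Rightarrow> ('h::complex_hilbert_space \<Rightarrow> 'h) \<Rightarrow> 'h set \<Rightarrow> real"
  where "reg_trace \<alpha> \<epsilon> F S = (\<Sum>s\<in>S. ((norm (F s))\<^sup>2 + \<epsilon>) powr \<alpha>)"

lemma diagonalizes_cinner:
  fixes F :: "'h::complex_hilbert_space \<Rightarrow> 'h"
  assumes F: "compact_operator F" and S: "onset S" and d: "diagonalizes F S"
    and s: "s \<in> S" and x: "x \<in> cspan S"
  shows "cinner (F s) (F x) = complex_of_real ((norm (F s))\<^sup>2) * cinner s x"
    and "cinner (F x) (F s) = complex_of_real ((norm (F s))\<^sup>2) * cinner x s"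
proof -
  interpret F: bounded_linear F by (rule compact_operator_bounded_linear[OF F])
  have "F x = (\<Sum>t\<in>S. cinner t x *\<^sub>C F t)"
    using arg_cong[OF onset_expand[OF S x], of F] by (simp add: F.sum compact_operator_scaleC[OF F])
  then have "cinner (F s) (F x) = (\<Sum>t\<in>S. cinner t x * cinner (F s) (F t))"
    by (simp only: cinner_sum_right cinner_scaleC_right)
  also have "\<dots> = (\<Sum>t\<in>S. if t = s then cinner t x * cinner (F s) (F s) else 0)"
    using d s by (intro sum.cong) (auto simp: diagonalizes_def)
  also have "\<dots> = complex_of_real ((norm (F s))\<^sup>2) * cinner s x"
    using onset_finite[OF S] s by (simp add: cinner_self mult.commute)
  finally show 1: "cinner (F s) (F x) = complex_of_real ((norm (F s))\<^sup>2) * cinner s x" .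
  show "cinner (F x) (F s) = complex_of_real ((norm (F s))\<^sup>2) * cinner x s"
    using arg_cong[OF 1, of cnj] cinner_commute[of "F x" "F s"] cinner_commute[of x s] by simp
qed

lemma onset_card_eq:
  assumes "onset S" "onset T" "cspan S = cspan T" shows "card S = card T"
  using onset_card_le[OF assms(1) onset_finite[OF assms(2)]]
    onset_card_le[OF assms(2) onset_finite[OF assms(1)]] complex_vector.span_superset assms(3)
  by (metis le_antisym)

text \<open>Two Gram forms on one space, each with its own eigenbasis. No pairing of the bases is
  assumed, since eigenvalues may cross; they are compared only through the overlaps
  \<open>cinner s t\<close>.\<close>

locale two_diagonalizations =
  fixes F G :: "'h::complex_hilbert_space \<Rightarrow> 'h" and S T :: "'h set" and \<alpha> \<epsilon> :: real
  assumes F: "compact_operator F" and G: "compact_operator G"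
    and S: "onset S" and T: "onset T" and span: "cspan S = cspan T"
    and dF: "diagonalizes F S" and dG: "diagonalizes G T"
    and \<alpha>: "0 < \<alpha>" "\<alpha> \<le> 1" and \<epsilon>: "0 < \<epsilon>"
begin

definition E :: "'h \<Rightarrow> 'h \<Rightarrow> complex"
  where "E x y = cinner (G x) (G y) - cinner (F x) (F y)"

definition lam :: "'h \<Rightarrow> real" where "lam s = (norm (F s))\<^sup>2 + \<epsilon>"
definition mu :: "'h \<Rightarrow> real" where "mu t = (norm (G t))\<^sup>2 + \<epsilon>"

lemma lam_ge: "\<epsilon> \<le> lam s" and mu_ge: "\<epsilon> \<le> mu s"
  by (simp_all add: lam_def mu_def)

lemma lam_pos: "0 < lam s" and mu_pos: "0 < mu s"
  using lam_ge[of s] mu_ge[of s] \<epsilon> by linarith+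

lemma S_span: "s \<in> S \<Longrightarrow> s \<in> cspan S" "s \<in> S \<Longrightarrow> s \<in> cspan T"
  and T_span: "t \<in> T \<Longrightarrow> t \<in> cspan T" "t \<in> T \<Longrightarrow> t \<in> cspan S"
  using span by (auto intro: complex_vector.span_base)

text \<open>In mixed eigenbases the perturbation is exactly eigenvalue difference times overlap.
  This turns scalar Taylor formulas into trace formulas without any operator calculus.\<close>

lemma E_eq:
  assumes "s \<in> S" "t \<in> T"
  shows "E s t = complex_of_real (mu t - lam s) * cinner s t"
  using diagonalizes_cinner(1)[OF F S dF assms(1) T_span(2)[OF assms(2)]]
    diagonalizes_cinner(2)[OF G T dG assms(2) S_span(2)[OF assms(1)]]
  by (simp add: E_def lam_def mu_def algebra_simps)

lemma sum_overlap_S: "t \<in> T \<Longrightarrow> (\<Sum>s\<in>S. (cmod (cinner s t))\<^sup>2) = 1"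
  using onset_parseval[OF S T_span(2)] onset_norm[OF T] by simp

lemma sum_overlap_T: "s \<in> S \<Longrightarrow> (\<Sum>t\<in>T. (cmod (cinner s t))\<^sup>2) = 1"
proof -
  assume s: "s \<in> S"
  have "(\<Sum>t\<in>T. (cmod (cinner s t))\<^sup>2) = (\<Sum>t\<in>T. (cmod (cinner t s))\<^sup>2)"
    by (intro sum.cong refl) (metis norm_cinner_commute)
  then show ?thesis using onset_parseval[OF T S_span(2)[OF s]] onset_norm[OF S s] by simp
qed

text \<open>The squared overlaps form a doubly stochastic matrix, so both traces become double sums
  with common weights and the scalar Taylor formula applies to each pair. By \<open>E_eq\<close>,
  weight times squared eigenvalue difference is a squared entry of \<open>E\<close>.\<close>

lemma reg_trace_diff:
  "reg_trace \<alpha> \<epsilon> G T - reg_trace \<alpha> \<epsilon> F S =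
    (\<Sum>s\<in>S. \<alpha> * lam s powr (\<alpha> - 1) * Re (E s s)) +
    (\<Sum>s\<in>S. \<Sum>t\<in>T. powr_remainder \<alpha> (lam s) (mu t) * (cmod (E s t))\<^sup>2)"
proof -
  have "reg_trace \<alpha> \<epsilon> G T = (\<Sum>t\<in>T. \<Sum>s\<in>S. (cmod (cinner s t))\<^sup>2 * mu t powr \<alpha>)"
    unfolding reg_trace_def
    by (intro sum.cong refl) (simp add: sum_distrib_right[symmetric] sum_overlap_S mu_def)
  then have 1: "reg_trace \<alpha> \<epsilon> G T = (\<Sum>s\<in>S. \<Sum>t\<in>T. (cmod (cinner s t))\<^sup>2 * mu t powr \<alpha>)"
    by (simp only: sum.swap[of _ S T])
  have 2: "reg_trace \<alpha> \<epsilon> F S = (\<Sum>s\<in>S. \<Sum>t\<in>T. (cmod (cinner s t))\<^sup>2 * lam s powr \<alpha>)"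
    unfolding reg_trace_def
    by (intro sum.cong refl) (simp add: sum_distrib_right[symmetric] sum_overlap_T lam_def)
  have 3: "Re (E s s) = (\<Sum>t\<in>T. (cmod (cinner s t))\<^sup>2 * (mu t - lam s))" if "s \<in> S" for s
  proof -
    have "(norm (G s))\<^sup>2 = (\<Sum>t\<in>T. (cmod (cinner s t))\<^sup>2 * (norm (G t))\<^sup>2)"
      using norm_image_diagonal[OF G T _ S_span(2)[OF that]] dG
      by (simp add: diagonalizes_def norm_cinner_commute)
    moreover have "(\<Sum>t\<in>T. (cmod (cinner s t))\<^sup>2 * (mu t - lam s))
        = (\<Sum>t\<in>T. (cmod (cinner s t))\<^sup>2 * (norm (G t))\<^sup>2) - (\<Sum>t\<in>T. (cmod (cinner s t))\<^sup>2) * (norm (F s))\<^sup>2"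
      unfolding sum_distrib_right sum_subtractf[symmetric]
      by (intro sum.cong refl) (simp add: mu_def lam_def algebra_simps)
    ultimately show ?thesis by (simp add: sum_overlap_T[OF that] E_def cinner_self)
  qed
  have 4: "(cmod (cinner s t))\<^sup>2 * mu t powr \<alpha> - (cmod (cinner s t))\<^sup>2 * lam s powr \<alpha>
      = \<alpha> * lam s powr (\<alpha> - 1) * ((cmod (cinner s t))\<^sup>2 * (mu t - lam s))
        + powr_remainder \<alpha> (lam s) (mu t) * (cmod (E s t))\<^sup>2" if "s \<in> S" "t \<in> T" for s t
  proof -
    have Esq: "(cmod (E s t))\<^sup>2 = (mu t - lam s)\<^sup>2 * (cmod (cinner s t))\<^sup>2"
      unfolding E_eq[OF that] by (simp add: norm_mult power_mult_distrib del: of_real_diff)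
    show ?thesis
      unfolding Esq by (subst powr_taylor[OF lam_pos[of s] mu_pos[of t], of \<alpha>]) (simp add: algebra_simps)
  qed
  have "reg_trace \<alpha> \<epsilon> G T - reg_trace \<alpha> \<epsilon> F S = (\<Sum>s\<in>S. \<Sum>t\<in>T.
      \<alpha> * lam s powr (\<alpha> - 1) * ((cmod (cinner s t))\<^sup>2 * (mu t - lam s))
        + powr_remainder \<alpha> (lam s) (mu t) * (cmod (E s t))\<^sup>2)"
    unfolding 1 2 sum_subtractf[symmetric] by (intro sum.cong refl 4)
  also have "\<dots> = (\<Sum>s\<in>S. \<alpha> * lam s powr (\<alpha> - 1) * Re (E s s)) +
    (\<Sum>s\<in>S. \<Sum>t\<in>T. powr_remainder \<alpha> (lam s) (mu t) * (cmod (E s t))\<^sup>2)"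
    by (simp add: sum.distrib sum_distrib_left[symmetric] 3)
  finally show ?thesis .
qed

text \<open>Concavity of the power makes the second-order term nonpositive, so the first-order term
  alone bounds the increment. Applied in both directions this yields Lipschitz continuity along a
  pencil.\<close>

lemma reg_trace_diff_upper:
  assumes \<delta>: "\<And>x y. norm x = 1 \<Longrightarrow> norm y = 1 \<Longrightarrow> cmod (E x y) \<le> \<delta>"
  shows "reg_trace \<alpha> \<epsilon> G T - reg_trace \<alpha> \<epsilon> F S \<le> real (card S) * (\<alpha> * \<epsilon> powr (\<alpha> - 1) * \<delta>)"
proof -
  have "(\<Sum>s\<in>S. \<Sum>t\<in>T. powr_remainder \<alpha> (lam s) (mu t) * (cmod (E s t))\<^sup>2) \<le> 0"
    using powr_remainder_nonpos[OF lam_pos mu_pos \<alpha>]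
    by (intro sum_nonpos mult_nonpos_nonneg) auto
  moreover have "(\<Sum>s\<in>S. \<alpha> * lam s powr (\<alpha> - 1) * Re (E s s)) \<le> (\<Sum>s\<in>S. \<alpha> * \<epsilon> powr (\<alpha> - 1) * \<delta>)"
  proof (rule sum_mono)
    fix s assume s: "s \<in> S"
    have "\<alpha> * lam s powr (\<alpha> - 1) * Re (E s s) \<le> \<alpha> * lam s powr (\<alpha> - 1) * \<delta>"
      using \<alpha> \<delta>[OF onset_norm[OF S s] onset_norm[OF S s]] complex_Re_le_cmod[of "E s s"]
      by (intro mult_left_mono) auto
    also have "\<dots> \<le> \<alpha> * \<epsilon> powr (\<alpha> - 1) * \<delta>"
      using \<alpha> \<epsilon> lam_ge[of s] \<delta>[OF onset_norm[OF S s] onset_norm[OF S s]] norm_ge_zero[of "E s s"]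
      by (intro mult_right_mono mult_left_mono powr_mono2') linarith+
    finally show "\<alpha> * lam s powr (\<alpha> - 1) * Re (E s s) \<le> \<alpha> * \<epsilon> powr (\<alpha> - 1) * \<delta>" .
  qed
  ultimately show ?thesis unfolding reg_trace_diff by simp
qed

text \<open>Lipschitz functional calculus: \<open>(\<phi>(\<mu>\<^sub>t) - \<phi>(\<lambda>\<^sub>u)) \<langle>u, t\<rangle>\<close> is dominated by \<open>E u t\<close>.\<close>

lemma remainder_sum_compare:
  assumes \<delta>: "\<And>x y. norm x = 1 \<Longrightarrow> norm y = 1 \<Longrightarrow> cmod (E x y) \<le> \<delta>" and s: "s \<in> S"
  shows "\<bar>(\<Sum>t\<in>T. powr_remainder \<alpha> (lam s) (mu t) * (cmod (E s t))\<^sup>2)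
      - (\<Sum>u\<in>S. powr_remainder \<alpha> (lam s) (lam u) * (cmod (E s u))\<^sup>2)\<bar>
    \<le> real (card S)^2 * (2 * \<epsilon> powr (\<alpha> - 3) * \<delta>^3)"
proof -
  interpret F: bounded_linear F by (rule compact_operator_bounded_linear[OF F])
  interpret G: bounded_linear G by (rule compact_operator_bounded_linear[OF G])
  define \<phi> where "\<phi> = powr_remainder \<alpha> (lam s)"
  have E_sum: "E s (\<Sum>x\<in>X. c x *\<^sub>C x) = (\<Sum>x\<in>X. c x * E s x)" for X c
    by (simp add: E_def F.sum G.sum compact_operator_scaleC[OF F] compact_operator_scaleC[OF G]
        cinner_sum_right cinner_scaleC_right sum_subtractf right_diff_distrib)
  \<comment> \<open>Expanding one factor of each squared entry in the other basis brings both sums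
    to the same double sum, differing only in \<open>\<phi> (mu t)\<close> against
    \<open>\<phi> (lam u)\<close>.\<close>
  have Et: "E s t = (\<Sum>u\<in>S. cinner u t * E s u)" if "t \<in> T" for t
    using arg_cong[OF onset_expand[OF S T_span(2)[OF that]], of "E s"] by (simp only: E_sum)
  have Eu: "E s u = (\<Sum>t\<in>T. cinner t u * E s t)" if "u \<in> S" for u
    using arg_cong[OF onset_expand[OF T S_span(2)[OF that]], of "E s"] by (simp only: E_sum)
  have A: "complex_of_real (\<Sum>t\<in>T. \<phi> (mu t) * (cmod (E s t))\<^sup>2)
      = (\<Sum>t\<in>T. \<Sum>u\<in>S. complex_of_real (\<phi> (mu t)) * (cnj (E s t) * E s u * cinner u t))"
    unfolding of_real_sum
  proof (intro sum.cong refl)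
    fix t assume t: "t \<in> T"
    have "complex_of_real (\<phi> (mu t) * (cmod (E s t))\<^sup>2) = complex_of_real (\<phi> (mu t)) * (cnj (E s t) * E s t)"
      by (simp add: complex_norm_square mult.commute del: of_real_power)
    also have "cnj (E s t) * E s t = (\<Sum>u\<in>S. cnj (E s t) * E s u * cinner u t)"
      by (subst (2) Et[OF t]) (simp add: sum_distrib_left mult_ac)
    finally show "complex_of_real (\<phi> (mu t) * (cmod (E s t))\<^sup>2)
      = (\<Sum>u\<in>S. complex_of_real (\<phi> (mu t)) * (cnj (E s t) * E s u * cinner u t))"
      by (simp add: sum_distrib_left)
  qed
  have B: "complex_of_real (\<Sum>u\<in>S. \<phi> (lam u) * (cmod (E s u))\<^sup>2)
      = (\<Sum>u\<in>S. \<Sum>t\<in>T. complex_of_real (\<phi> (lam u)) * (cnj (E s t) * E s u * cinner u t))"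
    unfolding of_real_sum
  proof (intro sum.cong refl)
    fix u assume u: "u \<in> S"
    have "complex_of_real (\<phi> (lam u) * (cmod (E s u))\<^sup>2) = complex_of_real (\<phi> (lam u)) * (cnj (E s u) * E s u)"
      by (simp add: complex_norm_square mult.commute del: of_real_power)
    also have "cnj (E s u) = (\<Sum>t\<in>T. cnj (E s t) * cinner u t)"
      by (subst Eu[OF u]) (simp add: cinner_commute[symmetric] mult.commute)
    also have "(\<Sum>t\<in>T. cnj (E s t) * cinner u t) * E s u = (\<Sum>t\<in>T. cnj (E s t) * E s u * cinner u t)"
      by (simp add: sum_distrib_right sum_distrib_left mult_ac)
    finally show "complex_of_real (\<phi> (lam u) * (cmod (E s u))\<^sup>2)
      = (\<Sum>t\<in>T. complex_of_real (\<phi> (lam u)) * (cnj (E s t) * E s u * cinner u t))"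
      by (simp add: sum_distrib_left)
  qed
  define D where "D = (\<Sum>t\<in>T. \<phi> (mu t) * (cmod (E s t))\<^sup>2) - (\<Sum>u\<in>S. \<phi> (lam u) * (cmod (E s u))\<^sup>2)"
  have D: "complex_of_real D
    = (\<Sum>u\<in>S. \<Sum>t\<in>T. complex_of_real (\<phi> (mu t) - \<phi> (lam u)) * (cnj (E s t) * E s u * cinner u t))"
    unfolding D_def of_real_diff A B sum.swap[of _ S T] sum_subtractf[symmetric] left_diff_distrib ..
  have "\<bar>D\<bar> = cmod (complex_of_real D)" by (simp only: norm_of_real)
  also have "\<dots> = cmod (\<Sum>u\<in>S. \<Sum>t\<in>T. complex_of_real (\<phi> (mu t) - \<phi> (lam u)) * (cnj (E s t) * E s u * cinner u t))"
    by (simp only: D)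
  also have "\<dots> \<le> (\<Sum>u\<in>S. \<Sum>t\<in>T. 2 * \<epsilon> powr (\<alpha> - 3) * \<delta>^3)"
  proof (intro sum_norm_le)
    fix u t assume u: "u \<in> S" and t: "t \<in> T"
    note n = onset_norm[OF S s] onset_norm[OF S u] onset_norm[OF T t]
    have "cmod (complex_of_real (\<phi> (mu t) - \<phi> (lam u)) * (cnj (E s t) * E s u * cinner u t))
      = (\<bar>\<phi> (mu t) - \<phi> (lam u)\<bar> * cmod (cinner u t)) * (cmod (E s t) * cmod (E s u))"
      by (simp add: norm_mult mult_ac del: of_real_diff)
    also have "\<dots> \<le> (2 * \<epsilon> powr (\<alpha> - 3) * \<delta>) * (\<delta> * \<delta>)"
    proof (rule mult_mono)
      have \<delta>0: "0 \<le> \<delta>" using order_trans[OF norm_ge_zero \<delta>[OF n(1) n(1)]] .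
      show "cmod (E s t) * cmod (E s u) \<le> \<delta> * \<delta>" by (intro mult_mono \<delta> n \<delta>0) simp
      have "\<bar>\<phi> (mu t) - \<phi> (lam u)\<bar> * cmod (cinner u t)
          \<le> (2 * \<epsilon> powr (\<alpha> - 3) * \<bar>mu t - lam u\<bar>) * cmod (cinner u t)"
        unfolding \<phi>_def
        by (intro mult_right_mono powr_remainder_lipschitz[OF \<epsilon> lam_ge mu_ge lam_ge \<alpha>]) simp
      also have "\<dots> = 2 * \<epsilon> powr (\<alpha> - 3) * cmod (E u t)"
        unfolding E_eq[OF u t] by (simp add: norm_mult del: of_real_diff)
      also have "\<dots> \<le> 2 * \<epsilon> powr (\<alpha> - 3) * \<delta>" by (intro mult_left_mono \<delta> n) simp
      finally show "\<bar>\<phi> (mu t) - \<phi> (lam u)\<bar> * cmod (cinner u t) \<le> 2 * \<epsilon> powr (\<alpha> - 3) * \<delta>" .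
      show "0 \<le> 2 * \<epsilon> powr (\<alpha> - 3) * \<delta>" using \<delta>0 by simp
    qed simp
    finally show "cmod (complex_of_real (\<phi> (mu t) - \<phi> (lam u)) * (cnj (E s t) * E s u * cinner u t))
        \<le> 2 * \<epsilon> powr (\<alpha> - 3) * \<delta>^3"
      by (simp add: power3_eq_cube mult.assoc)
  qed
  finally show ?thesis
    using onset_card_eq[OF S T span] by (simp add: D_def \<phi>_def power2_eq_square)
qed

text \<open>Replaces the unknown eigenbasis \<open>T\<close> in the second-order term by
  \<open>S\<close> at a third-order cost. The expansion then depends on the perturbation only
  through the entries of \<open>E\<close> in one fixed basis, so it can be averaged over several
  perturbations of one operator.\<close>

lemma reg_trace_diff_lower:
  assumes \<delta>: "\<And>x y. norm x = 1 \<Longrightarrow> norm y = 1 \<Longrightarrow> cmod (E x y) \<le> \<delta>"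
  shows "reg_trace \<alpha> \<epsilon> F S + (\<Sum>s\<in>S. \<alpha> * lam s powr (\<alpha> - 1) * Re (E s s)) +
    (\<Sum>s\<in>S. \<Sum>u\<in>S. powr_remainder \<alpha> (lam s) (lam u) * (cmod (E s u))\<^sup>2)
    - real (card S)^3 * (2 * \<epsilon> powr (\<alpha> - 3) * \<delta>^3) \<le> reg_trace \<alpha> \<epsilon> G T"
proof -
  have "(\<Sum>s\<in>S. \<Sum>u\<in>S. powr_remainder \<alpha> (lam s) (lam u) * (cmod (E s u))\<^sup>2)
      - (\<Sum>s\<in>S. real (card S)^2 * (2 * \<epsilon> powr (\<alpha> - 3) * \<delta>^3))
    \<le> (\<Sum>s\<in>S. \<Sum>t\<in>T. powr_remainder \<alpha> (lam s) (mu t) * (cmod (E s t))\<^sup>2)"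
    unfolding sum_subtractf[symmetric]
    by (intro sum_mono) (use remainder_sum_compare[OF \<delta>] in \<open>smt (verit)\<close>)
  then show ?thesis using reg_trace_diff by (simp add: power3_eq_cube power2_eq_square mult.assoc)
qed

end

subsection \<open>Subharmonicity along a pencil of operators\<close>

definition pencil :: "('h::complex_hilbert_space \<Rightarrow> 'h) \<Rightarrow> ('h \<Rightarrow> 'h) \<Rightarrow> complex \<Rightarrow> 'h \<Rightarrow> 'h"
  where "pencil A B z = (\<lambda>x. A x + z *\<^sub>C B x)"

text \<open>Four points replace the integral over a circle: the sums of \<open>\<omega>\<close> and
  of \<open>\<omega>\<^sup>2\<close> over them vanish, which is all that a second-order expansion
  needs.\<close>

definition unit_roots4 :: "complex set"
  where "unit_roots4 = {1, \<i>, - 1, - \<i>}"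

lemma sum_unit_roots4: "(\<Sum>\<omega>\<in>unit_roots4. h \<omega>) = h 1 + h \<i> + h (- 1) + h (- \<i>)"
  for h :: "complex \<Rightarrow> 'b::comm_monoid_add"
  by (simp add: unit_roots4_def complex_eq_iff add.assoc)

lemma card_unit_roots4: "card unit_roots4 = 4"
  by (simp add: unit_roots4_def complex_eq_iff)

lemma norm_unit_roots4: "\<omega> \<in> unit_roots4 \<Longrightarrow> cmod \<omega> = 1"
  by (auto simp: unit_roots4_def)

lemma four_point_norm_sum:
  "(\<Sum>\<omega>\<in>unit_roots4. (cmod ((of_real \<rho> * \<omega>) * a + cnj (of_real \<rho> * \<omega>) * b + of_real (\<rho>\<^sup>2) * c))\<^sup>2)
    = 4 * \<rho>\<^sup>2 * ((cmod a)\<^sup>2 + (cmod b)\<^sup>2) + 4 * \<rho>^4 * (cmod c)\<^sup>2"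
  unfolding sum_unit_roots4 cmod_power2
  by (simp add: power2_eq_square power4_eq_xxxx algebra_simps)

lemma four_point_Re_sum:
  "(\<Sum>\<omega>\<in>unit_roots4. Re ((of_real \<rho> * \<omega>) * a + cnj (of_real \<rho> * \<omega>) * b + of_real (\<rho>\<^sup>2) * c))
    = 4 * \<rho>\<^sup>2 * Re c"
  unfolding sum_unit_roots4 by (simp add: power2_eq_square algebra_simps)

lemma four_point_dist_sum:
  "(\<Sum>\<omega>\<in>unit_roots4. (cmod (z + of_real \<rho> * \<omega>))\<^sup>2) = 4 * (cmod z)\<^sup>2 + 4 * \<rho>\<^sup>2"
  unfolding sum_unit_roots4 cmod_power2
  by (simp add: power2_eq_square algebra_simps)

text \<open>Bessel's inequality for the normalised nonzero \<open>F s\<close>. Where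
  \<open>F s = 0\<close> the term is \<open>0 / 0\<close>, which is 0.\<close>

lemma bessel_diagonal:
  fixes F :: "'h::complex_hilbert_space \<Rightarrow> 'h"
  assumes S: "finite S" and d: "diagonalizes F S"
  shows "(\<Sum>s\<in>S. (cmod (cinner (F s) x))\<^sup>2 / (norm (F s))\<^sup>2) \<le> (norm x)\<^sup>2"
proof -
  define S' where "S' = {s \<in> S. F s \<noteq> 0}"
  define e where "e s = complex_of_real (1 / norm (F s)) *\<^sub>C F s" for s
  have e: "cinner (e s) (e t) = (if s = t then 1 else 0)" if "s \<in> S'" "t \<in> S'" for s t
    using that d by (auto simp: e_def S'_def diagonalizes_def cinner_scaleC_left cinner_scaleC_right
        cinner_self power2_eq_square)
  have inj: "inj_on e S'" by (rule inj_onI) (metis e one_neq_zero)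
  have "onset (e ` S')" using S e inj by (auto simp: onset_def inj_on_eq_iff S'_def)
  then have "(\<Sum>y\<in>e ` S'. (cmod (cinner y x))\<^sup>2) \<le> (norm x)\<^sup>2" by (rule onset_bessel)
  also have "(\<Sum>y\<in>e ` S'. (cmod (cinner y x))\<^sup>2) = (\<Sum>s\<in>S'. (cmod (cinner (F s) x))\<^sup>2 / (norm (F s))\<^sup>2)"
    unfolding sum.reindex[OF inj]
    by (simp add: e_def cinner_scaleC_left norm_divide norm_mult power_divide)
  also have "\<dots> = (\<Sum>s\<in>S. (cmod (cinner (F s) x))\<^sup>2 / (norm (F s))\<^sup>2)"
    unfolding S'_def using S by (intro sum.mono_neutral_left) auto
  finally show ?thesis .
qed

text \<open>The right side is a quarter of the Laplacian of the regularised trace at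
  \<open>F\<close> in direction \<open>B\<close>. For each \<open>u\<close>, the symmetrised
  remainder times \<open>l s\<close> is at least \<open>\<kappa> - f\<close>, while Bessel bounds
  the sum of the squared entries \<open>cinner (F s) (B u)\<close>, divided by the squares of
  \<open>norm (F s)\<close>, by the square of \<open>norm (B u)\<close>. Together they keep the
  negative second-order part under control.\<close>

lemma laplacian_lower_bound:
  fixes F B :: "'h::complex_hilbert_space \<Rightarrow> 'h"
  assumes S: "finite S" and d: "diagonalizes F S"
    and \<alpha>: "0 < \<alpha>" "\<alpha> \<le> 1" and \<epsilon>: "0 < \<epsilon>"
    and l: "\<And>s. l s = (norm (F s))\<^sup>2 + \<epsilon>" and L: "\<And>s. s \<in> S \<Longrightarrow> l s \<le> L"
  shows "\<alpha>\<^sup>2 * L powr (\<alpha> - 1) * (\<Sum>s\<in>S. (norm (B s))\<^sup>2) \<le>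
    (\<Sum>s\<in>S. \<alpha> * l s powr (\<alpha> - 1) * (norm (B s))\<^sup>2) +
    (\<Sum>s\<in>S. \<Sum>u\<in>S. powr_remainder \<alpha> (l s) (l u) *
      ((cmod (cinner (F s) (B u)))\<^sup>2 + (cmod (cinner (B s) (F u)))\<^sup>2))"
proof -
  define \<kappa> where "\<kappa> = \<alpha>\<^sup>2 * L powr (\<alpha> - 1)"
  define X where "X s u = (cmod (cinner (F s) (B u)))\<^sup>2" for s u
  define r where "r s u = powr_remainder \<alpha> (l s) (l u) + powr_remainder \<alpha> (l u) (l s)" for s u
  have lpos: "0 < l s" for s using \<epsilon> zero_le_power2[of "norm (F s)"] unfolding l by linarith
  have X': "(cmod (cinner (B s) (F u)))\<^sup>2 = X u s" for s u
    by (simp add: X_def norm_cinner_commute[of "B s"])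
  have r_le: "r s u \<le> 0" for s u
    unfolding r_def using powr_remainder_nonpos[OF lpos lpos \<alpha>] by (meson add_nonpos_nonpos)
  \<comment> \<open>Exchanging the indices in one half collects both remainders as the coefficient
    of a single \<open>X s u\<close>, the combination that \<open>powr_remainder_symmetrized\<close>
    estimates.\<close>
  have "(\<Sum>s\<in>S. \<Sum>u\<in>S. powr_remainder \<alpha> (l s) (l u) * (X s u + X u s))
      = (\<Sum>s\<in>S. \<Sum>u\<in>S. powr_remainder \<alpha> (l s) (l u) * X s u)
        + (\<Sum>s\<in>S. \<Sum>u\<in>S. powr_remainder \<alpha> (l s) (l u) * X u s)"
    by (simp add: distrib_left sum.distrib)
  also have "(\<Sum>s\<in>S. \<Sum>u\<in>S. powr_remainder \<alpha> (l s) (l u) * X s u)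
      = (\<Sum>u\<in>S. \<Sum>s\<in>S. powr_remainder \<alpha> (l s) (l u) * X s u)" by (rule sum.swap)
  also have "\<dots> + (\<Sum>s\<in>S. \<Sum>u\<in>S. powr_remainder \<alpha> (l s) (l u) * X u s) = (\<Sum>u\<in>S. \<Sum>s\<in>S. r s u * X s u)"
    by (simp add: r_def distrib_right sum.distrib)
  finally have sw: "(\<Sum>s\<in>S. \<Sum>u\<in>S. powr_remainder \<alpha> (l s) (l u) * (X s u + X u s))
      = (\<Sum>u\<in>S. \<Sum>s\<in>S. r s u * X s u)" .
  have "\<kappa> * (norm (B u))\<^sup>2 \<le> \<alpha> * l u powr (\<alpha> - 1) * (norm (B u))\<^sup>2 + (\<Sum>s\<in>S. r s u * X s u)"
    if u: "u \<in> S" for u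
  proof -
    define f where "f = \<alpha> * l u powr (\<alpha> - 1)"
    \<comment> \<open>The case \<open>s = u\<close> of the symmetrised bound suffices, its remainder
      part being nonpositive. The sign of \<open>\<kappa> - f\<close> is what allows Bessel's
      inequality to be multiplied by it.\<close>
    have \<kappa>f: "\<kappa> \<le> f"
    proof -
      have "\<kappa> \<le> f + l u * r u u"
        using powr_remainder_symmetrized[of "l u" L "l u" \<alpha>] lpos L[OF u] \<alpha>
        by (simp add: \<kappa>_def f_def r_def)
      moreover have "l u * r u u \<le> 0" using lpos[of u] r_le[of u u] by (intro mult_nonneg_nonpos) auto
      ultimately show ?thesis by linarith
    qed
    have "(\<kappa> - f) * (X s u / (norm (F s))\<^sup>2) \<le> r s u * X s u" if s: "s \<in> S" for s
    proof (cases "F s = 0")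
      case True
      then show ?thesis by (simp add: X_def)
    next
      case False
      have "\<kappa> - f \<le> l s * r s u"
        using powr_remainder_symmetrized[of "l s" L "l u" \<alpha>] lpos L[OF u] L[OF s] \<alpha>
        by (simp add: \<kappa>_def f_def r_def)
      \<comment> \<open>Dropping \<open>\<epsilon>\<close> from \<open>l s\<close> goes in the right
        direction because \<open>r s u\<close> is nonpositive.\<close>
      also have "\<dots> \<le> (norm (F s))\<^sup>2 * r s u"
        using r_le[of s u] \<epsilon> by (intro mult_right_mono_neg) (auto simp: l)
      finally have "(\<kappa> - f) * (X s u / (norm (F s))\<^sup>2) \<le> ((norm (F s))\<^sup>2 * r s u) * (X s u / (norm (F s))\<^sup>2)"
        by (intro mult_right_mono) (simp_all add: X_def)
      then show ?thesis using False by simp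
    qed
    then have "(\<Sum>s\<in>S. (\<kappa> - f) * (X s u / (norm (F s))\<^sup>2)) \<le> (\<Sum>s\<in>S. r s u * X s u)"
      by (rule sum_mono)
    moreover have "(\<kappa> - f) * (norm (B u))\<^sup>2 \<le> (\<kappa> - f) * (\<Sum>s\<in>S. X s u / (norm (F s))\<^sup>2)"
      using bessel_diagonal[OF S d, of "B u"] \<kappa>f unfolding X_def by (intro mult_left_mono_neg) auto
    ultimately show ?thesis
      unfolding sum_distrib_left[symmetric] by (simp add: f_def algebra_simps)
  qed
  then have "(\<Sum>u\<in>S. \<kappa> * (norm (B u))\<^sup>2)
      \<le> (\<Sum>u\<in>S. \<alpha> * l u powr (\<alpha> - 1) * (norm (B u))\<^sup>2 + (\<Sum>s\<in>S. r s u * X s u))"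
    by (rule sum_mono)
  then show ?thesis
    by (simp only: X' X_def[symmetric] sw sum.distrib sum_distrib_left \<kappa>_def)
qed

text \<open>Both sums are the trace of the compression of \<open>B* B\<close>. Each is compared with
  an eigenbasis \<open>U\<close> of that compression, Parseval making the squared overlaps sum to
  1.\<close>

lemma hilbert_schmidt_basis_indep:
  fixes B :: "'h::complex_hilbert_space \<Rightarrow> 'h"
  assumes B: "compact_operator B" and S: "onset S" and T: "onset T" and span: "cspan S = cspan T"
  shows "(\<Sum>s\<in>S. (norm (B s))\<^sup>2) = (\<Sum>t\<in>T. (norm (B t))\<^sup>2)"
proof -
  obtain U where U: "onset U" "cspan U = cspan S"
    "\<And>s t. s \<in> U \<Longrightarrow> t \<in> U \<Longrightarrow> s \<noteq> t \<Longrightarrow> cinner (B s) (B t) = 0"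
    using onset_extend_diagonal[OF B complex_vector.subspace_span cspan_onset_closed[OF S] order_refl
        onset_finite[OF S], of "{}"] by (auto simp: onset_def)
  have "(\<Sum>s\<in>S. (norm (B s))\<^sup>2) = (\<Sum>u\<in>U. (norm (B u))\<^sup>2)"
    if S: "onset S" "cspan S = cspan U" for S
  proof -
    have "(norm (B s))\<^sup>2 = (\<Sum>u\<in>U. (cmod (cinner u s))\<^sup>2 * (norm (B u))\<^sup>2)" if "s \<in> S" for s
      using that S(2) complex_vector.span_base[OF that] by (intro norm_image_diagonal[OF B U(1,3)]) auto
    then have "(\<Sum>s\<in>S. (norm (B s))\<^sup>2) = (\<Sum>u\<in>U. (\<Sum>s\<in>S. (cmod (cinner u s))\<^sup>2) * (norm (B u))\<^sup>2)"
      by (simp add: sum_distrib_right sum.swap[of _ U S])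
    also have "\<dots> = (\<Sum>u\<in>U. (norm (B u))\<^sup>2)"
    proof (intro sum.cong refl)
      fix u assume u: "u \<in> U"
      then have "u \<in> cspan S" using S(2) complex_vector.span_base[of u U] by auto
      from onset_parseval[OF S(1) this] have "(\<Sum>s\<in>S. (cmod (cinner u s))\<^sup>2) = 1"
        using onset_norm[OF U(1) u] by (simp add: norm_cinner_commute[of u])
      then show "(\<Sum>s\<in>S. (cmod (cinner u s))\<^sup>2) * (norm (B u))\<^sup>2 = (norm (B u))\<^sup>2" by simp
    qed
    finally show ?thesis .
  qed
  from this[OF S] this[OF T] show ?thesis using span U(2) by simp
qed

lemma pencil_gram_diff:
  fixes F B :: "'h::complex_hilbert_space \<Rightarrow> 'h"
  shows "cinner (F x + \<zeta> *\<^sub>C B x) (F y + \<zeta> *\<^sub>C B y) - cinner (F x) (F y)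
    = \<zeta> * cinner (F x) (B y) + cnj \<zeta> * cinner (B x) (F y) + of_real ((cmod \<zeta>)\<^sup>2) * cinner (B x) (B y)"
  unfolding complex_norm_square
  by (simp add: cinner_add_left cinner_add_right cinner_scaleC_left cinner_scaleC_right algebra_simps)

text \<open>The a priori bound \<open>c\<close> makes the term quadratic in \<open>\<zeta>\<close>
  linear; it is 1 for small circles and \<open>2 * t\<close> for two points of the disc.\<close>

lemma pencil_gram_diff_le:
  fixes F B :: "'h::complex_hilbert_space \<Rightarrow> 'h"
  assumes F: "\<And>x. norm (F x) \<le> a * norm x" and B: "\<And>x. norm (B x) \<le> b * norm x"
    and x: "norm x = 1" "norm y = 1" and \<zeta>: "cmod \<zeta> \<le> c"
  shows "cmod (cinner (F x + \<zeta> *\<^sub>C B x) (F y + \<zeta> *\<^sub>C B y) - cinner (F x) (F y))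
    \<le> cmod \<zeta> * (2 * a * b + c * b\<^sup>2)"
proof -
  have n: "norm (F x) \<le> a" "norm (F y) \<le> a" "norm (B x) \<le> b" "norm (B y) \<le> b"
    using F[of x] F[of y] B[of x] B[of y] x by auto
  have ab: "0 \<le> a" "0 \<le> b" using n norm_ge_zero order_trans by blast+
  have "cmod (cinner (F x) (B y)) \<le> a * b" "cmod (cinner (B x) (F y)) \<le> b * a"
    "cmod (cinner (B x) (B y)) \<le> b * b"
    using n ab by (auto intro!: order_trans[OF norm_cinner_le] mult_mono)
  moreover have "0 \<le> c" using \<zeta> norm_ge_zero order_trans by blast
  ultimately have "cmod \<zeta> * cmod (cinner (F x) (B y)) + cmod \<zeta> * cmod (cinner (B x) (F y))
      + (cmod \<zeta> * cmod \<zeta>) * cmod (cinner (B x) (B y))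
    \<le> cmod \<zeta> * (a * b) + cmod \<zeta> * (b * a) + (cmod \<zeta> * c) * (b * b)"
    using \<zeta> ab by (intro add_mono mult_mono mult_left_mono) auto
  moreover have "cmod (cinner (F x + \<zeta> *\<^sub>C B x) (F y + \<zeta> *\<^sub>C B y) - cinner (F x) (F y))
      \<le> cmod \<zeta> * cmod (cinner (F x) (B y)) + cmod \<zeta> * cmod (cinner (B x) (F y))
      + (cmod \<zeta> * cmod \<zeta>) * cmod (cinner (B x) (B y))"
    unfolding pencil_gram_diff
    by (rule norm_triangle_le, rule add_mono, rule norm_triangle_le)
      (simp_all add: norm_mult power2_eq_square)
  ultimately show ?thesis by (simp add: power2_eq_square algebra_simps)
qed

text \<open>\<open>v z\<close> is any eigenbasis of the Gram form on the fixed space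
  \<open>V\<close>, chosen separately for each \<open>z\<close> without continuity. This is enough
  because the trace does not depend on the choice.\<close>

locale compact_pencil =
  fixes A B :: "'h::complex_hilbert_space \<Rightarrow> 'h" and v :: "complex \<Rightarrow> 'h set" and V :: "'h set"
    and \<alpha> a b t :: real
  assumes pencil: "\<And>z. compact_operator (pencil A B z)" and B: "compact_operator B"
    and v: "\<And>z. onset (v z)" "\<And>z. cspan (v z) = V" "\<And>z. diagonalizes (pencil A B z) (v z)"
    and \<alpha>: "0 < \<alpha>" "\<alpha> \<le> 1" and t: "0 < t"
    and a: "\<And>x. norm (A x) \<le> a * norm x" and b: "\<And>x. norm (B x) \<le> b * norm x" "0 \<le> b"
begin

definition R :: real where "R = a + t * b"

definition hs :: real where "hs = (\<Sum>s\<in>v 0. (norm (B s))\<^sup>2)"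

lemma hs_eq: "(\<Sum>s\<in>v z. (norm (B s))\<^sup>2) = hs"
  unfolding hs_def by (rule hilbert_schmidt_basis_indep[OF B v(1) v(1)]) (simp add: v(2))

lemma card_v: "card (v z) = card (v 0)"
  by (rule onset_card_eq[OF v(1) v(1)]) (simp add: v(2))

lemma norm_pencil: "cmod z \<le> t \<Longrightarrow> norm (pencil A B z x) \<le> R * norm x"
proof -
  assume z: "cmod z \<le> t"
  have "norm (pencil A B z x) \<le> norm (A x) + cmod z * norm (B x)"
    unfolding pencil_def using norm_triangle_ineq[of "A x" "z *\<^sub>C B x"] by (simp add: norm_scaleC)
  also have "\<dots> \<le> a * norm x + t * (b * norm x)"
    using z t a b by (intro add_mono mult_mono) auto
  finally show ?thesis by (simp add: R_def algebra_simps)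
qed

lemma pencil_add: "pencil A B (z + \<zeta>) x = pencil A B z x + \<zeta> *\<^sub>C B x"
  by (simp add: pencil_def scaleC_add_left add.assoc)

lemma two_diag: "0 < \<epsilon> \<Longrightarrow> two_diagonalizations (pencil A B z) (pencil A B w) (v z) (v w) \<alpha> \<epsilon>"
  using pencil v \<alpha> by unfold_locales auto

lemma gram_diff:
  fixes \<epsilon> :: real
  assumes "0 < \<epsilon>"
  shows "two_diagonalizations.E (pencil A B z) (pencil A B (z + \<zeta>)) x y
    = cinner (pencil A B z x + \<zeta> *\<^sub>C B x) (pencil A B z y + \<zeta> *\<^sub>C B y)
      - cinner (pencil A B z x) (pencil A B z y)"
  unfolding two_diagonalizations.E_def[OF two_diag[OF assms]] pencil_add ..

text \<open>A sub-mean-value inequality up to third order. \<open>C\<close> may depend on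
  \<open>z\<close> and \<open>\<epsilon>\<close> but not on \<open>\<rho>\<close>, which suffices
  for its use at a single maximum point with small \<open>\<rho>\<close>.\<close>

lemma four_point_lower_bound:
  assumes \<epsilon>: "0 < \<epsilon>" and z: "cmod z \<le> t"
  shows "\<exists>C. \<forall>\<rho>. 0 < \<rho> \<longrightarrow> \<rho> \<le> 1 \<longrightarrow>
    4 * reg_trace \<alpha> \<epsilon> (pencil A B z) (v z)
      + 4 * \<rho>\<^sup>2 * (\<alpha>\<^sup>2 * (R\<^sup>2 + \<epsilon>) powr (\<alpha> - 1) * hs) - \<rho>^3 * C
    \<le> (\<Sum>\<omega>\<in>unit_roots4. reg_trace \<alpha> \<epsilon> (pencil A B (z + of_real \<rho> * \<omega>)) (v (z + of_real \<rho> * \<omega>)))"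
proof -
  define F where "F = pencil A B z"
  define S where "S = v z"
  define l where "l s = (norm (F s))\<^sup>2 + \<epsilon>" for s
  define \<phi> where "\<phi> s u = powr_remainder \<alpha> (l s) (l u)" for s u
  \<comment> \<open>The part of the squared entries coming from
    \<open>\<rho>\<^sup>2 * cinner (B s) (B u)\<close>, hence of fourth order in
    \<open>\<rho>\<close>. Being nonpositive, it is estimated by third order for
    \<open>\<rho> \<le> 1\<close> and absorbed into \<open>C\<close>.\<close>
  define P where "P = (\<Sum>s\<in>S. \<Sum>u\<in>S. \<phi> s u * (cmod (cinner (B s) (B u)))\<^sup>2)"
  define c where "c = 2 * R * b + 1 * b\<^sup>2"
  define C where "C = 8 * real (card S)^3 * \<epsilon> powr (\<alpha> - 3) * c^3 - 4 * P"
  have S: "onset S" by (simp add: S_def v)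
  have lpos: "0 < l s" for s using \<epsilon> zero_le_power2[of "norm (F s)"] unfolding l_def by linarith
  have \<phi>_le: "\<phi> s u \<le> 0" for s u unfolding \<phi>_def by (rule powr_remainder_nonpos[OF lpos lpos \<alpha>])
  have P_le: "P \<le> 0" unfolding P_def using \<phi>_le by (intro sum_nonpos mult_nonpos_nonneg) auto
  have lL: "l s \<le> R\<^sup>2 + \<epsilon>" if "s \<in> S" for s
    using norm_pencil[OF z, of s] onset_norm[OF S that] by (simp add: l_def F_def power_mono)
  show ?thesis
  proof (intro exI[of _ C] allI impI)
    fix \<rho> :: real assume \<rho>: "0 < \<rho>" "\<rho> \<le> 1"
    define E where "E \<omega> x y = (of_real \<rho> * \<omega>) * cinner (F x) (B y) + cnj (of_real \<rho> * \<omega>) * cinner (B x) (F y)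
      + of_real (\<rho>\<^sup>2) * cinner (B x) (B y)" for \<omega> x y
    define n3 where "n3 = real (card S)^3 * (2 * \<epsilon> powr (\<alpha> - 3) * (\<rho> * c)^3)"
    have low: "reg_trace \<alpha> \<epsilon> F S + (\<Sum>s\<in>S. \<alpha> * l s powr (\<alpha> - 1) * Re (E \<omega> s s)) +
        (\<Sum>s\<in>S. \<Sum>u\<in>S. \<phi> s u * (cmod (E \<omega> s u))\<^sup>2) - n3
      \<le> reg_trace \<alpha> \<epsilon> (pencil A B (z + of_real \<rho> * \<omega>)) (v (z + of_real \<rho> * \<omega>))"
      if \<omega>: "\<omega> \<in> unit_roots4" for \<omega>
    proof -
      define \<zeta> where "\<zeta> = of_real \<rho> * \<omega>"
      have n\<zeta>: "cmod \<zeta> = \<rho>" using \<rho> norm_unit_roots4[OF \<omega>] by (simp add: \<zeta>_def norm_mult)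
      interpret W: two_diagonalizations "pencil A B z" "pencil A B (z + \<zeta>)" "v z" "v (z + \<zeta>)" \<alpha> \<epsilon>
        by (rule two_diag[OF \<epsilon>])
      have E: "W.E x y = E \<omega> x y" for x y
        unfolding gram_diff[OF \<epsilon>] pencil_gram_diff n\<zeta> by (simp add: E_def \<zeta>_def F_def)
      have lam: "W.lam s = l s" for s by (simp add: W.lam_def l_def F_def)
      have "cmod (W.E x y) \<le> \<rho> * c" if "norm x = 1" "norm y = 1" for x y
        unfolding gram_diff[OF \<epsilon>] c_def
        using pencil_gram_diff_le[OF norm_pencil[OF z] b(1) that, of \<zeta> 1] \<rho> by (simp add: n\<zeta>)
      from W.reg_trace_diff_lower[OF this] show ?thesis
        unfolding E lam unfolding \<phi>_def n3_def F_def S_def \<zeta>_def .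
    qed
    have "(\<Sum>\<omega>\<in>unit_roots4. reg_trace \<alpha> \<epsilon> F S + (\<Sum>s\<in>S. \<alpha> * l s powr (\<alpha> - 1) * Re (E \<omega> s s)) +
        (\<Sum>s\<in>S. \<Sum>u\<in>S. \<phi> s u * (cmod (E \<omega> s u))\<^sup>2) - n3)
      = 4 * reg_trace \<alpha> \<epsilon> F S + (\<Sum>s\<in>S. \<alpha> * l s powr (\<alpha> - 1) * (\<Sum>\<omega>\<in>unit_roots4. Re (E \<omega> s s))) +
        (\<Sum>s\<in>S. \<Sum>u\<in>S. \<phi> s u * (\<Sum>\<omega>\<in>unit_roots4. (cmod (E \<omega> s u))\<^sup>2)) - 4 * n3"
      unfolding sum.distrib sum_subtractf sum_distrib_left
      by (simp add: card_unit_roots4 sum.swap[of _ unit_roots4])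
    also have "(\<Sum>s\<in>S. \<alpha> * l s powr (\<alpha> - 1) * (\<Sum>\<omega>\<in>unit_roots4. Re (E \<omega> s s)))
        = 4 * \<rho>\<^sup>2 * (\<Sum>s\<in>S. \<alpha> * l s powr (\<alpha> - 1) * (norm (B s))\<^sup>2)"
      unfolding E_def four_point_Re_sum sum_distrib_left
      by (intro sum.cong refl) (simp add: cinner_self del: of_real_power)
    also have "(\<Sum>s\<in>S. \<Sum>u\<in>S. \<phi> s u * (\<Sum>\<omega>\<in>unit_roots4. (cmod (E \<omega> s u))\<^sup>2))
        = 4 * \<rho>\<^sup>2 * (\<Sum>s\<in>S. \<Sum>u\<in>S. \<phi> s u *
            ((cmod (cinner (F s) (B u)))\<^sup>2 + (cmod (cinner (B s) (F u)))\<^sup>2)) + 4 * \<rho>^4 * P"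
      unfolding E_def four_point_norm_sum sum_distrib_left P_def sum.distrib[symmetric]
      by (intro sum.cong refl) (simp add: algebra_simps)
    finally have eq: "(\<Sum>\<omega>\<in>unit_roots4. reg_trace \<alpha> \<epsilon> F S + (\<Sum>s\<in>S. \<alpha> * l s powr (\<alpha> - 1) * Re (E \<omega> s s)) +
        (\<Sum>s\<in>S. \<Sum>u\<in>S. \<phi> s u * (cmod (E \<omega> s u))\<^sup>2) - n3)
      = 4 * reg_trace \<alpha> \<epsilon> F S + 4 * \<rho>\<^sup>2 * ((\<Sum>s\<in>S. \<alpha> * l s powr (\<alpha> - 1) * (norm (B s))\<^sup>2)
          + (\<Sum>s\<in>S. \<Sum>u\<in>S. \<phi> s u * ((cmod (cinner (F s) (B u)))\<^sup>2 + (cmod (cinner (B s) (F u)))\<^sup>2)))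
        + 4 * \<rho>^4 * P - 4 * n3"
      by (simp add: algebra_simps)
    have "4 * \<rho>\<^sup>2 * (\<alpha>\<^sup>2 * (R\<^sup>2 + \<epsilon>) powr (\<alpha> - 1) * hs)
      \<le> 4 * \<rho>\<^sup>2 * ((\<Sum>s\<in>S. \<alpha> * l s powr (\<alpha> - 1) * (norm (B s))\<^sup>2)
          + (\<Sum>s\<in>S. \<Sum>u\<in>S. \<phi> s u * ((cmod (cinner (F s) (B u)))\<^sup>2 + (cmod (cinner (B s) (F u)))\<^sup>2)))"
      unfolding \<phi>_def hs_eq[of z, symmetric] S_def[symmetric]
      by (rule mult_left_mono[OF laplacian_lower_bound[OF onset_finite[OF S] _ \<alpha> \<epsilon> l_def lL]])
        (simp_all add: S_def F_def v)
    moreover have "\<rho>^3 * P \<le> \<rho>^4 * P"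
      using \<rho> P_le by (intro mult_right_mono_neg power_decreasing) auto
    moreover have "\<rho>^3 * C = 4 * n3 - 4 * (\<rho>^3 * P)"
      by (simp add: C_def n3_def algebra_simps power_mult_distrib)
    moreover have "(\<Sum>\<omega>\<in>unit_roots4. reg_trace \<alpha> \<epsilon> F S + (\<Sum>s\<in>S. \<alpha> * l s powr (\<alpha> - 1) * Re (E \<omega> s s)) +
        (\<Sum>s\<in>S. \<Sum>u\<in>S. \<phi> s u * (cmod (E \<omega> s u))\<^sup>2) - n3)
      \<le> (\<Sum>\<omega>\<in>unit_roots4. reg_trace \<alpha> \<epsilon> (pencil A B (z + of_real \<rho> * \<omega>)) (v (z + of_real \<rho> * \<omega>)))"
      by (rule sum_mono[OF low])
    ultimately show "4 * reg_trace \<alpha> \<epsilon> (pencil A B z) (v z)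
      + 4 * \<rho>\<^sup>2 * (\<alpha>\<^sup>2 * (R\<^sup>2 + \<epsilon>) powr (\<alpha> - 1) * hs) - \<rho>^3 * C
    \<le> (\<Sum>\<omega>\<in>unit_roots4. reg_trace \<alpha> \<epsilon> (pencil A B (z + of_real \<rho> * \<omega>)) (v (z + of_real \<rho> * \<omega>)))"
      unfolding eq F_def[symmetric] S_def[symmetric] by linarith
  qed
qed

lemma continuous_on_reg_trace:
  assumes \<epsilon>: "0 < \<epsilon>"
  shows "continuous_on (cball 0 t) (\<lambda>z. reg_trace \<alpha> \<epsilon> (pencil A B z) (v z))"
proof -
  define K where "K = real (card (v 0)) * (\<alpha> * \<epsilon> powr (\<alpha> - 1) * (2 * R * b + (2 * t) * b\<^sup>2))"
  have le: "reg_trace \<alpha> \<epsilon> (pencil A B w) (v w) - reg_trace \<alpha> \<epsilon> (pencil A B z) (v z) \<le> K * dist z w"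
    if z: "z \<in> cball 0 t" and w: "w \<in> cball 0 t" for z w
  proof -
    define \<zeta> where "\<zeta> = w - z"
    have w_eq: "w = z + \<zeta>" by (simp add: \<zeta>_def)
    have zt: "cmod z \<le> t" "cmod \<zeta> \<le> 2 * t"
      using z w norm_triangle_ineq4[of w z] by (auto simp: \<zeta>_def)
    interpret W: two_diagonalizations "pencil A B z" "pencil A B (z + \<zeta>)" "v z" "v (z + \<zeta>)" \<alpha> \<epsilon>
      by (rule two_diag[OF \<epsilon>])
    have "cmod (W.E x y) \<le> cmod \<zeta> * (2 * R * b + (2 * t) * b\<^sup>2)" if "norm x = 1" "norm y = 1" for x y
      unfolding gram_diff[OF \<epsilon>] by (rule pencil_gram_diff_le[OF norm_pencil[OF zt(1)] b(1) that zt(2)])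
    then have "reg_trace \<alpha> \<epsilon> (pencil A B (z + \<zeta>)) (v (z + \<zeta>)) - reg_trace \<alpha> \<epsilon> (pencil A B z) (v z)
        \<le> real (card (v z)) * (\<alpha> * \<epsilon> powr (\<alpha> - 1) * (cmod \<zeta> * (2 * R * b + (2 * t) * b\<^sup>2)))"
      by (rule W.reg_trace_diff_upper)
    also have "\<dots> = K * cmod \<zeta>" unfolding K_def card_v[of z] by (simp only: mult_ac)
    finally show ?thesis unfolding w_eq[symmetric] by (simp add: \<zeta>_def dist_norm norm_minus_commute)
  qed
  show ?thesis
  proof (rule lipschitz_on_continuous_on)
    have "\<bar>reg_trace \<alpha> \<epsilon> (pencil A B z) (v z) - reg_trace \<alpha> \<epsilon> (pencil A B w) (v w)\<bar> \<le> \<bar>K\<bar> * dist z w"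
      if "z \<in> cball 0 t" "w \<in> cball 0 t" for z w
    proof -
      have "K * dist z w \<le> \<bar>K\<bar> * dist z w" by (intro mult_right_mono) auto
      then show ?thesis using le[OF that] le[OF that(2,1)] by (simp add: dist_commute abs_le_iff)
    qed
    then show "\<bar>K\<bar>-lipschitz_on (cball 0 t) (\<lambda>z. reg_trace \<alpha> \<epsilon> (pencil A B z) (v z))"
      by (intro lipschitz_onI) (auto simp: dist_real_def)
  qed
qed

text \<open>The strict inequality leaves a margin \<open>\<kappa> - K\<close> whose quadratic
  contribution beats the cubic error on a small circle. So the trace minus
  \<open>K * (cmod z)\<^sup>2\<close> has no interior maximum, and its maximum over the compact disc
  lies on the boundary.\<close>

lemma maximum_principle:
  assumes \<epsilon>: "0 < \<epsilon>" and K: "K < \<alpha>\<^sup>2 * (R\<^sup>2 + \<epsilon>) powr (\<alpha> - 1) * hs"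
  obtains z where "cmod z = t"
    "reg_trace \<alpha> \<epsilon> (pencil A B 0) (v 0) + K * t\<^sup>2 \<le> reg_trace \<alpha> \<epsilon> (pencil A B z) (v z)"
proof -
  define g where "g z = reg_trace \<alpha> \<epsilon> (pencil A B z) (v z)" for z
  define \<kappa> where "\<kappa> = \<alpha>\<^sup>2 * (R\<^sup>2 + \<epsilon>) powr (\<alpha> - 1) * hs"
  have "continuous_on (cball 0 t) (\<lambda>z. g z - K * (cmod z)\<^sup>2)"
    unfolding g_def by (intro continuous_intros continuous_on_reg_trace[OF \<epsilon>])
  moreover have "cball (0::complex) t \<noteq> {}" using t by simp
  ultimately have "\<exists>z\<in>cball 0 t. \<forall>w\<in>cball 0 t. g w - K * (cmod w)\<^sup>2 \<le> g z - K * (cmod z)\<^sup>2"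
    by (intro continuous_attains_sup compact_cball)
  then obtain z where z: "z \<in> cball 0 t"
    and mx: "\<And>w. w \<in> cball 0 t \<Longrightarrow> g w - K * (cmod w)\<^sup>2 \<le> g z - K * (cmod z)\<^sup>2"
    by blast
  have zt: "cmod z \<le> t" using z by simp
  have "cmod z = t"
  proof (rule ccontr)
    assume "cmod z \<noteq> t"
    then have lt: "cmod z < t" using zt by simp
    obtain C where C: "\<And>\<rho>. 0 < \<rho> \<Longrightarrow> \<rho> \<le> 1 \<Longrightarrow>
        4 * g z + 4 * \<rho>\<^sup>2 * \<kappa> - \<rho>^3 * C \<le> (\<Sum>\<omega>\<in>unit_roots4. g (z + of_real \<rho> * \<omega>))"
      using four_point_lower_bound[OF \<epsilon> zt] unfolding g_def[symmetric] \<kappa>_def[symmetric] by blast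
    \<comment> \<open>Keeps the circle inside the disc and makes \<open>\<rho> * C\<close> at most
      \<open>\<kappa> - K\<close>, whereas maximality would force it to be at least four times as
      large.\<close>
    define \<rho> where "\<rho> = min (min 1 (t - cmod z)) ((\<kappa> - K) / (\<bar>C\<bar> + 1))"
    have "0 < (\<kappa> - K) / (\<bar>C\<bar> + 1)" using K by (intro divide_pos_pos) (auto simp: \<kappa>_def)
    then have \<rho>: "0 < \<rho>" "\<rho> \<le> 1" "\<rho> \<le> t - cmod z" "\<rho> \<le> (\<kappa> - K) / (\<bar>C\<bar> + 1)"
      using lt by (auto simp: \<rho>_def)
    have "(\<Sum>\<omega>\<in>unit_roots4. g (z + of_real \<rho> * \<omega>) - K * (cmod (z + of_real \<rho> * \<omega>))\<^sup>2)
        \<le> (\<Sum>\<omega>\<in>unit_roots4. g z - K * (cmod z)\<^sup>2)"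
    proof (intro sum_mono mx)
      fix \<omega> assume "\<omega> \<in> unit_roots4"
      then have "cmod (of_real \<rho> * \<omega>) = \<rho>" using \<rho>(1) norm_unit_roots4 by (simp add: norm_mult)
      then show "z + of_real \<rho> * \<omega> \<in> cball 0 t"
        using norm_triangle_ineq[of z "of_real \<rho> * \<omega>"] \<rho>(3) by simp
    qed
    then have "(\<Sum>\<omega>\<in>unit_roots4. g (z + of_real \<rho> * \<omega>)) \<le> 4 * g z + 4 * K * \<rho>\<^sup>2"
      unfolding sum_subtractf sum_distrib_left[symmetric] four_point_dist_sum
      by (simp add: card_unit_roots4 algebra_simps)
    with C[OF \<rho>(1,2)] have "\<rho>\<^sup>2 * (4 * (\<kappa> - K)) \<le> \<rho>\<^sup>2 * (\<rho> * C)"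
      by (simp add: power2_eq_square power3_eq_cube algebra_simps)
    then have "4 * (\<kappa> - K) \<le> \<rho> * C" using \<rho>(1) by simp
    also have "\<dots> \<le> \<rho> * (\<bar>C\<bar> + 1)" using \<rho>(1) by (intro mult_left_mono) auto
    also have "\<dots> \<le> \<kappa> - K" using \<rho>(4) by (simp add: pos_le_divide_eq)
    finally have "\<kappa> - K \<le> 0" by simp
    then show False using K by (simp add: \<kappa>_def)
  qed
  moreover have "g 0 \<le> g z - K * (cmod z)\<^sup>2" using mx[of 0] t by simp
  ultimately show ?thesis by (intro that[of z]) (auto simp: g_def)
qed

end

section \<open>Removal of the regularisation\<close>

lemma powr_add_le:
  fixes x y :: real
  assumes "0 \<le> x" "0 \<le> y" "0 < \<alpha>" "\<alpha> \<le> 1"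
  shows "(x + y) powr \<alpha> \<le> x powr \<alpha> + y powr \<alpha>"
proof (cases "x + y = 0")
  case False
  then have s: "0 < x + y" using assms by linarith
  have *: "u \<le> u powr \<alpha>" if "0 \<le> u" "u \<le> 1" for u :: real
  proof (cases "u = 0")
    case False
    then show ?thesis using powr_mono'[of \<alpha> 1 u] that assms by simp
  qed simp
  have "1 = x / (x + y) + y / (x + y)" using s by (simp add: add_divide_distrib[symmetric])
  also have "\<dots> \<le> (x / (x + y)) powr \<alpha> + (y / (x + y)) powr \<alpha>"
    using assms s by (intro add_mono *) auto
  also have "\<dots> = (x powr \<alpha> + y powr \<alpha>) / (x + y) powr \<alpha>"
    using assms s by (simp add: powr_divide add_divide_distrib)
  finally show ?thesis using s by (simp add: le_divide_eq)
qed (use assms in simp)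

lemma power2_powr: "0 \<le> x \<Longrightarrow> (x\<^sup>2) powr a = x powr (2 * a)" for x a :: real
proof (cases "x = 0")
  case False
  assume "0 \<le> x"
  then have "x\<^sup>2 = x powr 2" using False by simp
  then show ?thesis by (simp only: powr_powr)
qed simp

text \<open>Adding \<open>\<epsilon>\<close> only increases the trace at the centre; on the circle
  subadditivity of the power limits its cost to \<open>\<epsilon> powr \<alpha>\<close> per basis
  vector, and the number of basis vectors is the same for all \<open>z\<close>. So the
  regularisation disappears in the limit.\<close>

lemma (in compact_pencil) schatten_mean_value:
  assumes p: "p = 2 * \<alpha>" and R: "0 < R"
    and N: "\<And>z. cmod z = t \<Longrightarrow> (\<Sum>s\<in>v z. norm (pencil A B z s) powr p) \<le> N"
  shows "(\<Sum>s\<in>v 0. norm (A s) powr p) + p\<^sup>2 / 4 * R powr (p - 2) * t\<^sup>2 * hs \<le> N"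
proof -
  define m where "m = real (card (v 0))"
  have A0: "pencil A B 0 = A" by (simp add: pencil_def)
  have ineq: "(\<Sum>s\<in>v 0. norm (A s) powr p) + \<alpha>\<^sup>2 * (R\<^sup>2 + \<epsilon>) powr (\<alpha> - 1) * hs * t\<^sup>2 \<le> N + m * \<epsilon> powr \<alpha>"
    if \<epsilon>: "0 < \<epsilon>" for \<epsilon>
  proof -
    have low: "(\<Sum>s\<in>v 0. norm (A s) powr p) \<le> reg_trace \<alpha> \<epsilon> (pencil A B 0) (v 0)"
      unfolding reg_trace_def A0
    proof (rule sum_mono)
      fix s
      have "norm (A s) powr p = ((norm (A s))\<^sup>2) powr \<alpha>" using p by (simp add: power2_powr)
      also have "\<dots> \<le> ((norm (A s))\<^sup>2 + \<epsilon>) powr \<alpha>" using \<epsilon> \<alpha> by (intro powr_mono2) auto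
      finally show "norm (A s) powr p \<le> ((norm (A s))\<^sup>2 + \<epsilon>) powr \<alpha>" .
    qed
    have up: "reg_trace \<alpha> \<epsilon> (pencil A B z) (v z) \<le> N + m * \<epsilon> powr \<alpha>" if z: "cmod z = t" for z
    proof -
      have "reg_trace \<alpha> \<epsilon> (pencil A B z) (v z) \<le> (\<Sum>s\<in>v z. norm (pencil A B z s) powr p + \<epsilon> powr \<alpha>)"
        unfolding reg_trace_def
      proof (rule sum_mono)
        fix s
        show "((norm (pencil A B z s))\<^sup>2 + \<epsilon>) powr \<alpha> \<le> norm (pencil A B z s) powr p + \<epsilon> powr \<alpha>"
          using powr_add_le[of "(norm (pencil A B z s))\<^sup>2" \<epsilon> \<alpha>] \<epsilon> \<alpha> p by (simp add: power2_powr)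
      qed
      also have "\<dots> = (\<Sum>s\<in>v z. norm (pencil A B z s) powr p) + m * \<epsilon> powr \<alpha>"
        by (simp add: sum.distrib m_def card_v[of z])
      finally show ?thesis using N[OF z] by simp
    qed
    define \<kappa> where "\<kappa> = \<alpha>\<^sup>2 * (R\<^sup>2 + \<epsilon>) powr (\<alpha> - 1) * hs"
    have "\<kappa> \<le> (N + m * \<epsilon> powr \<alpha> - (\<Sum>s\<in>v 0. norm (A s) powr p)) / t\<^sup>2"
    \<comment> \<open>The maximum principle needs \<open>K\<close> strictly below
      \<open>\<kappa>\<close>; density reaches \<open>\<kappa>\<close> itself.\<close>
    proof (rule dense_le)
      fix K assume "K < \<kappa>"
      then obtain z where z: "cmod z = t"
        "reg_trace \<alpha> \<epsilon> (pencil A B 0) (v 0) + K * t\<^sup>2 \<le> reg_trace \<alpha> \<epsilon> (pencil A B z) (v z)"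
        using maximum_principle[OF \<epsilon>] unfolding \<kappa>_def by metis
      then show "K \<le> (N + m * \<epsilon> powr \<alpha> - (\<Sum>s\<in>v 0. norm (A s) powr p)) / t\<^sup>2"
        using low up[OF z(1)] t by (simp add: pos_le_divide_eq)
    qed
    then show ?thesis using t by (simp add: pos_le_divide_eq \<kappa>_def algebra_simps)
  qed
  define c where "c = (\<Sum>s\<in>v 0. norm (A s) powr p)"
  have "c + \<alpha>\<^sup>2 * (R\<^sup>2 + 0) powr (\<alpha> - 1) * hs * t\<^sup>2 \<le> N + m * 0"
  proof (rule tendsto_le)
    have ev: "((\<lambda>\<epsilon>. \<epsilon>) \<longlongrightarrow> 0) (at_right (0::real))" by (rule tendsto_ident_at)
    show "((\<lambda>\<epsilon>. N + m * \<epsilon> powr \<alpha>) \<longlongrightarrow> N + m * 0) (at_right 0)"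
    proof (intro tendsto_intros)
      have "((\<lambda>\<epsilon>::real. \<epsilon> powr \<alpha>) \<longlongrightarrow> 0 powr \<alpha>) (at_right 0)"
        using \<alpha> by (intro tendsto_powr' ev tendsto_const) (auto simp: eventually_at_right_less eventually_at_filter)
      then show "((\<lambda>\<epsilon>::real. \<epsilon> powr \<alpha>) \<longlongrightarrow> 0) (at_right 0)" using \<alpha> by simp
    qed
    \<comment> \<open>\<open>R > 0\<close> keeps the base away from 0, where a negative exponent
      would break continuity.\<close>
    show "((\<lambda>\<epsilon>. c + \<alpha>\<^sup>2 * (R\<^sup>2 + \<epsilon>) powr (\<alpha> - 1) * hs * t\<^sup>2) \<longlongrightarrow>
        c + \<alpha>\<^sup>2 * (R\<^sup>2 + 0) powr (\<alpha> - 1) * hs * t\<^sup>2) (at_right 0)"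
      using R by (intro tendsto_intros tendsto_powr ev) auto
    show "\<forall>\<^sub>F \<epsilon> in at_right 0. c + \<alpha>\<^sup>2 * (R\<^sup>2 + \<epsilon>) powr (\<alpha> - 1) * hs * t\<^sup>2 \<le> N + m * \<epsilon> powr \<alpha>"
      using eventually_at_right_less[of "0::real"] by eventually_elim (simp add: ineq c_def)
  qed simp
  moreover have "(R\<^sup>2 + 0) powr (\<alpha> - 1) = R powr (p - 2)"
    using R p by (simp add: power2_powr algebra_simps)
  ultimately show ?thesis using p by (simp add: c_def power2_eq_square mult_ac)
qed

subsection \<open>The norm of the domain\<close>

lemma lq_norm_cases:
  assumes "2 < q"
  obtains "q = \<infinity>" | r where "q = ereal r" "2 < r"
  using assms by (cases q) auto

lemma lq_norm_ge:
  assumes q: "2 < q"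
  shows "cmod a \<le> lq_norm q (a, b)" "cmod b \<le> lq_norm q (a, b)"
proof -
  have 1: "x \<le> (x powr r + y powr r) powr (1 / r)" if "0 \<le> x" "0 \<le> y" "2 < r" for x y r :: real
  proof -
    have "x = (x powr r) powr (1 / r)" using that by (simp add: powr_powr)
    also have "\<dots> \<le> (x powr r + y powr r) powr (1 / r)" using that by (intro powr_mono2) auto
    finally show ?thesis .
  qed
  from q show "cmod a \<le> lq_norm q (a, b)" "cmod b \<le> lq_norm q (a, b)"
    by (cases rule: lq_norm_cases; use 1[of "cmod a" "cmod b"] 1[of "cmod b" "cmod a"] in
      \<open>simp add: lq_norm_def add.commute\<close>)+
qed

text \<open>A crude constant suffices, since it only serves to make the lower ratio positive. For
  finite exponents it rests on \<open>2 \<le> 2 powr r\<close>.\<close>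

lemma lq_norm_le:
  assumes q: "2 < q"
  shows "lq_norm q (a, b) \<le> 2 * max (cmod a) (cmod b)"
  using q
proof (cases rule: lq_norm_cases)
  case (2 r)
  define m where "m = max (cmod a) (cmod b)"
  have m: "cmod a \<le> m" "cmod b \<le> m" "0 \<le> m" by (auto simp: m_def le_max_iff_disj)
  have "cmod a powr r + cmod b powr r \<le> m powr r + m powr r"
    using 2 m by (intro add_mono powr_mono2) auto
  also have "\<dots> = 2 powr 1 * m powr r" by simp
  also have "\<dots> \<le> 2 powr r * m powr r" using 2 by (intro mult_right_mono powr_mono) auto
  also have "\<dots> = (2 * m) powr r" using m by (simp add: powr_mult)
  finally have "(cmod a powr r + cmod b powr r) powr (1 / r) \<le> ((2 * m) powr r) powr (1 / r)"
    using 2 by (intro powr_mono2) auto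
  also have "\<dots> = 2 * m" using 2 m by (simp add: powr_powr)
  finally show ?thesis using 2 by (simp add: lq_norm_def m_def)
next
  case 1
  have "0 \<le> max (cmod a) (cmod b)" by (simp add: le_max_iff_disj)
  moreover have "lq_norm q (a, b) = max (cmod a) (cmod b)" using 1 by (simp add: lq_norm_def)
  ultimately show ?thesis by linarith
qed

lemma lq_norm_pos:
  assumes q: "2 < q" and x: "x \<noteq> 0" shows "0 < lq_norm q x"
proof -
  obtain a b where ab: "x = (a, b)" by (cases x)
  have "0 < cmod a \<or> 0 < cmod b" using x by (auto simp: ab zero_prod_def)
  then show ?thesis using lq_norm_ge[OF q, of a b] lq_norm_ge[OF q, of b a] unfolding ab by linarith
qed

lemma lq_norm_axis:
  assumes "2 < q" shows "lq_norm q (1, 0) = 1" "lq_norm q (0, 1) = 1"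
  using assms by (cases rule: lq_norm_cases; simp add: lq_norm_def)+

lemma lq_norm_powr_eq_Phi:
  assumes "2 < q" "cmod z \<le> 1"
  shows "lq_norm q (1, z) powr p = Phi p q (cmod z)"
  using assms(1) by (cases rule: lq_norm_cases) (use assms(2) in \<open>auto simp: lq_norm_def Phi_def powr_powr\<close>)

subsection \<open>The distortion bound\<close>

lemma Phi_ge_1:
  assumes "0 < p" "2 < q" "0 < t" shows "1 \<le> Phi p q t"
  using assms(2)
proof (cases rule: lq_norm_cases)
  case (2 r)
  have "1 \<le> 1 + t powr r" by simp
  moreover have "0 \<le> p / r" using 2 assms by simp
  ultimately show ?thesis using 2 by (simp add: Phi_def ge_one_powr_ge_zero)
qed (simp add: Phi_def)

text \<open>The outer exponent \<open>p / r\<close> is at most 1 and the base at least 1. For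
  \<open>q = \<infinity>\<close> any exponent above 2 would do; 3 is chosen.\<close>

lemma Phi_le:
  assumes p: "0 < p" "p \<le> 2" and q: "2 < q"
  obtains r where "2 < r" "\<And>t. 0 < t \<Longrightarrow> t \<le> 1 \<Longrightarrow> Phi p q t \<le> 1 + t powr r"
  using q
proof (cases rule: lq_norm_cases)
  case 1
  then show ?thesis by (intro that[of 3]) (auto simp: Phi_def)
next
  case (2 r)
  have "Phi p q t \<le> 1 + t powr r" for t
  proof -
    have "(1 + t powr r) powr (p / r) \<le> (1 + t powr r) powr 1"
      using 2 p by (intro powr_mono) auto
    then show ?thesis using 2 by (simp add: Phi_def)
  qed
  then show ?thesis using 2 by (intro that[of r]) auto
qed

definition bound_at :: "real \<Rightarrow> ereal \<Rightarrow> nat \<Rightarrow> real \<Rightarrow> real"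
  where "bound_at p q k t =
    (1 + p\<^sup>2 / 4 * real k powr (1 - 2 / p) * t\<^sup>2 * (1 + t) powr (p - 2)) / Phi p q t"

text \<open>The numerator gains a multiple of \<open>t\<^sup>2\<close>, whereas \<open>Phi\<close>
  exceeds 1 by at most \<open>t powr r\<close> with \<open>r > 2\<close>, so a small
  \<open>t\<close> wins. The quotients must also be shown bounded, for otherwise a single value
  could not be compared with the supremum in the reals.\<close>

lemma distortion_bound_gt_1:
  assumes p: "0 < p" "p \<le> 2" and q: "2 < q" and k: "0 < k"
  shows "1 < distortion_bound p q k"
proof -
  define c where "c = p\<^sup>2 / 4 * real k powr (1 - 2 / p)"
  have c: "0 < c" using p k by (simp add: c_def)
  have le: "bound_at p q k t \<le> 1 + c" if t: "t \<in> {0<..1}" for t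
  proof -
    have "(1 + t) powr (p - 2) \<le> (1 + t) powr 0" using t p by (intro powr_mono) auto
    then have "(1 + t) powr (p - 2) \<le> 1" using t by simp
    moreover have "t\<^sup>2 \<le> 1" using t by (simp add: power_le_one)
    ultimately have "c * (t\<^sup>2 * (1 + t) powr (p - 2)) \<le> c * (1 * 1)"
      using c t by (intro mult_left_mono mult_mono) auto
    then have "1 + c * t\<^sup>2 * (1 + t) powr (p - 2) \<le> 1 + c" by (simp add: mult.assoc)
    moreover have "1 \<le> Phi p q t" using Phi_ge_1[OF p(1) q] t by simp
    ultimately show ?thesis
      unfolding bound_at_def c_def[symmetric] using c
    proof -
      have "1 + c \<le> (1 + c) * Phi p q t" using \<open>1 \<le> Phi p q t\<close> c mult_left_mono[of 1 "Phi p q t" "1 + c"] by simp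
      with \<open>1 + c * t\<^sup>2 * (1 + t) powr (p - 2) \<le> 1 + c\<close>
      have "1 + c * t\<^sup>2 * (1 + t) powr (p - 2) \<le> (1 + c) * Phi p q t" by (rule order_trans)
      then show "(1 + c * t\<^sup>2 * (1 + t) powr (p - 2)) / Phi p q t \<le> 1 + c"
        using \<open>1 \<le> Phi p q t\<close> by (simp add: divide_le_eq)
    qed
  qed
  then have bdd: "bdd_above (bound_at p q k ` {0<..1})" by (intro bdd_aboveI[of _ "1 + c"]) auto
  obtain r where r: "2 < r" "\<And>t. 0 < t \<Longrightarrow> t \<le> 1 \<Longrightarrow> Phi p q t \<le> 1 + t powr r"
    by (rule Phi_le[OF p q]) blast
  define d where "d = c * 2 powr (p - 2)"
  have d: "0 < d" using c by (simp add: d_def)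
  \<comment> \<open>Chosen so that \<open>t powr (r - 2) \<le> d / 2\<close>, strictly below
    \<open>d\<close>; the minimum keeps \<open>t\<close> in the unit interval.\<close>
  define t where "t = min 1 ((d / 2) powr (1 / (r - 2)))"
  have t: "0 < t" "t \<le> 1" using d by (auto simp: t_def)
  have "t powr (r - 2) \<le> ((d / 2) powr (1 / (r - 2))) powr (r - 2)"
    using t r(1) by (intro powr_mono2) (auto simp: t_def)
  also have "\<dots> = d / 2" using r(1) d by (simp add: powr_powr)
  finally have "t\<^sup>2 * t powr (r - 2) < t\<^sup>2 * d" using t d by (intro mult_strict_left_mono) auto
  moreover have "t\<^sup>2 * t powr (r - 2) = t powr r"
    using t powr_add[of t 2 "r - 2"] by simp
  moreover have "t\<^sup>2 * d \<le> c * t\<^sup>2 * (1 + t) powr (p - 2)"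
  proof -
    have "2 powr (p - 2) \<le> (1 + t) powr (p - 2)" using t p by (intro powr_mono2') auto
    then have "c * t\<^sup>2 * 2 powr (p - 2) \<le> c * t\<^sup>2 * (1 + t) powr (p - 2)"
      using c by (intro mult_left_mono) auto
    then show ?thesis by (simp add: d_def mult_ac)
  qed
  ultimately have "Phi p q t < 1 + c * t\<^sup>2 * (1 + t) powr (p - 2)" using r(2)[OF t] by linarith
  then have "1 < bound_at p q k t"
    unfolding bound_at_def c_def[symmetric] using Phi_ge_1[OF p(1) q t(1)] by (simp add: less_divide_eq)
  also have "\<dots> \<le> (SUP t\<in>{0<..1}. bound_at p q k t)" using t by (intro cSUP_upper bdd) auto
  also have "\<dots> = distortion_bound p q k" by (simp add: distortion_bound_def bound_at_def)
  finally show ?thesis .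
qed

section \<open>Power means and finite orthonormal bases\<close>

text \<open>Power mean inequality, the values being regarded as padded by zeros to \<open>k\<close>
  terms. It follows from the tangent of the concave \<open>x powr (p / 2)\<close> at the mean
  \<open>b\<close> of the squares.\<close>

lemma sum_powr_le_sum_squares:
  fixes f :: "'i \<Rightarrow> real"
  assumes S: "finite S" "card S \<le> k" and p: "0 < p" "p \<le> 2" and k: "0 < k" and f: "\<And>s. s \<in> S \<Longrightarrow> 0 \<le> f s"
  shows "real k powr (1 - 2 / p) * (\<Sum>s\<in>S. f s powr p) powr (2 / p) \<le> (\<Sum>s\<in>S. (f s)\<^sup>2)"
proof (cases "(\<Sum>s\<in>S. (f s)\<^sup>2) = 0")
  case True
  then have "f s = 0" if "s \<in> S" for s using sum_nonneg_eq_0_iff[OF S(1), of "\<lambda>s. (f s)\<^sup>2"] that by auto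
  then show ?thesis using True by simp
next
  case False
  define b where "b = (\<Sum>s\<in>S. (f s)\<^sup>2) / real k"
  have sum_b: "(\<Sum>s\<in>S. (f s)\<^sup>2) = real k * b" using k by (simp add: b_def)
  have b: "0 < b" unfolding b_def using False k sum_nonneg[of S "\<lambda>s. (f s)\<^sup>2"] by (intro divide_pos_pos) auto
  define h where "h = p / 2"
  have h: "0 < h" "h \<le> 1" using p by (auto simp: h_def)
  have tangent: "f s powr p \<le> b powr h + h * b powr (h - 1) * ((f s)\<^sup>2 - b)" if s: "s \<in> S" for s
  proof (cases "f s = 0")
    case True
    have "h * b powr (h - 1) * b = h * b powr h" using b by (simp add: powr_diff)
    also have "\<dots> \<le> 1 * b powr h" using h by (intro mult_right_mono) auto
    finally show ?thesis using True by simp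
  next
    case False
    then have f0: "0 < (f s)\<^sup>2" by simp
    have "f s powr p = ((f s)\<^sup>2) powr h" using f[OF s] by (simp add: power2_powr h_def)
    also have "\<dots> = b powr h + h * b powr (h - 1) * ((f s)\<^sup>2 - b) + powr_remainder h b ((f s)\<^sup>2) * ((f s)\<^sup>2 - b)\<^sup>2"
      by (rule powr_taylor[OF b f0])
    also have "\<dots> \<le> b powr h + h * b powr (h - 1) * ((f s)\<^sup>2 - b)"
      using powr_remainder_nonpos[OF b f0 h] by (simp add: mult_nonpos_nonneg)
    finally show ?thesis .
  qed
  have bh: "b powr (h - 1) * b = b powr h" using b by (simp add: powr_diff)
  have "(\<Sum>s\<in>S. f s powr p) \<le> (\<Sum>s\<in>S. b powr h + h * b powr (h - 1) * ((f s)\<^sup>2 - b))"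
    by (rule sum_mono[OF tangent])
  also have "\<dots> = real (card S) * (b powr h - h * (b powr (h - 1) * b)) + h * (b powr (h - 1) * b) * real k"
    by (simp add: sum.distrib sum_subtractf sum_distrib_left[symmetric] sum_b algebra_simps)
  also have "\<dots> = real (card S) * ((1 - h) * b powr h) + h * b powr h * real k"
    unfolding bh by (simp add: algebra_simps)
  also have "\<dots> \<le> real k * ((1 - h) * b powr h) + h * b powr h * real k"
    using S(2) h by (intro add_right_mono mult_right_mono) auto
  also have "\<dots> = real k * b powr h" by (simp add: algebra_simps)
  finally have "(\<Sum>s\<in>S. f s powr p) powr (2 / p) \<le> (real k * b powr h) powr (2 / p)"
    using p by (intro powr_mono2) (auto intro: sum_nonneg)
  also have "\<dots> = real k powr (2 / p) * b"
    using k b p by (simp add: powr_mult powr_powr h_def)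
  finally have "real k powr (1 - 2 / p) * (\<Sum>s\<in>S. f s powr p) powr (2 / p)
      \<le> real k powr (1 - 2 / p) * (real k powr (2 / p) * b)"
    by (intro mult_left_mono) auto
  also have "\<dots> = real k * b" using k powr_add[of "real k" "1 - 2 / p" "2 / p"] by (simp add: mult.assoc[symmetric])
  finally show ?thesis unfolding sum_b .
qed

lemma onset_basis_exists:
  fixes T :: "'h::complex_hilbert_space set"
  assumes T: "finite T"
  obtains S where "onset S" "cspan S = cspan T"
proof -
  define P where "P S \<longleftrightarrow> onset S \<and> S \<subseteq> cspan T" for S
  have "P {}" by (simp add: P_def onset_def)
  moreover have "card S \<le> card T" if "P S" for S using that T by (intro onset_card_le) (auto simp: P_def)
  ultimately obtain S where PS: "P S" and mx: "\<And>S'. P S' \<Longrightarrow> card S' \<le> card S"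
    using ex_has_greatest_nat[of P "{}" card "Suc (card T)"] by (metis less_Suc_eq_le)
  have S: "onset S" "S \<subseteq> cspan T" using PS by (auto simp: P_def)
  have "cspan T \<subseteq> cspan S"
  proof (rule ccontr)
    assume "\<not> cspan T \<subseteq> cspan S"
    then obtain x where "x \<in> cspan T" "x \<notin> cspan S" by blast
    then obtain e where e: "e \<in> cspan T" "norm e = 1" "\<And>s. s \<in> S \<Longrightarrow> cinner s e = 0"
      using exists_unit_orthogonal[OF S(1) complex_vector.subspace_span S(2)] by metis
    then have "P (insert e S)" using S onset_insert(1)[OF S(1) e(2,3)] by (simp add: P_def)
    then show False using mx onset_insert(2)[OF S(1) e(2,3)] onset_finite[OF S(1)] by fastforce
  qed
  moreover have "cspan S \<subseteq> cspan T" by (rule complex_vector.span_minimal[OF S(2) complex_vector.subspace_span])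
  ultimately show ?thesis using S by (intro that[of S]) auto
qed

subsection \<open>Finite distortion\<close>

locale schatten_embedding =
  fixes p :: real and q :: ereal and T :: "complex \<times> complex \<Rightarrow> 'h::complex_hilbert_space \<Rightarrow> 'h" and k :: nat
  assumes p: "0 < p" "p \<le> 2" and q: "2 < q"
    and lin: "clinear T" and inj: "inj T" and range: "range T \<subseteq> schatten_class p"
    and rank: "crank (T (0, 1)) \<le> enat k"
begin

definition A :: "'h \<Rightarrow> 'h" where "A = T (1, 0)"
definition B :: "'h \<Rightarrow> 'h" where "B = T (0, 1)"

lemma T_eq: "T (a, b) x = a *\<^sub>C A x + b *\<^sub>C B x"
proof -
  have "(a, b) = a *\<^sub>C (1, 0) + b *\<^sub>C (0, 1)" by (simp add: scaleC_prod_def scaleC_complex_def)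
  then have "T (a, b) = a *\<^sub>C T (1, 0) + b *\<^sub>C T (0, 1)"
    using lin by (simp only: Vector_Spaces.linear_iff)
  then show ?thesis by (simp add: A_def B_def scaleC_fun_def)
qed

lemma T_class: "T x \<in> schatten_class p" using range by blast
lemma A_class: "A \<in> schatten_class p" and B_class: "B \<in> schatten_class p"
  by (simp_all add: A_def B_def T_class)

lemma T_compact: "compact_operator (T x)" using T_class by (auto simp: schatten_class_def)
lemma A_compact: "compact_operator A" and B_compact: "compact_operator B"
  by (simp_all add: A_def B_def T_compact)

lemma T_nonzero: "x \<noteq> 0 \<Longrightarrow> \<exists>y. T x y \<noteq> 0"
proof (rule ccontr)
  assume x: "x \<noteq> 0" and "\<not> (\<exists>y. T x y \<noteq> 0)"
  then have "T x y = 0" for y by blast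
  moreover have "T 0 y = 0" for y using T_eq[of 0 0 y] by (simp add: zero_prod_def)
  ultimately have "T x = T 0" by (simp add: fun_eq_iff)
  then show False using inj x by (simp add: inj_eq)
qed

text \<open>With \<open>k = 0\<close> there are no singular vectors and \<open>B\<close> is zero,
  against injectivity of \<open>T\<close>.\<close>

lemma k_pos: "0 < k"
proof (rule ccontr)
  assume "\<not> 0 < k"
  obtain S where S: "card S \<le> k" "onset S" "\<And>w. (\<And>s. s \<in> S \<Longrightarrow> cinner s w = 0) \<Longrightarrow> B w = 0"
    using finite_rank_singular_system[OF p(1) B_class] rank unfolding B_def[symmetric] by metis
  then have "S = {}" using \<open>\<not> 0 < k\<close> S(1) onset_finite[OF S(2)] by simp
  then have "B w = 0" for w using S(3) by blast
  then show False using T_nonzero[of "(0, 1)"] by (simp add: B_def zero_prod_def)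
qed

text \<open>For \<open>p < 1\<close> the triangle inequality fails. On the orthogonal complement of
  the finitely many right singular vectors of \<open>B\<close>, however, \<open>T (a, b)\<close>
  equals \<open>a\<close> times \<open>A\<close>, so its singular values are dominated by multiples
  of those of \<open>A\<close>, up to at most \<open>k\<close> exceptional ones, which the operator
  norm bounds.\<close>

lemma ratio_upper: "\<exists>K. \<forall>x. x \<noteq> 0 \<longrightarrow> schatten_norm p (T x) / lq_norm q x \<le> K"
proof -
  obtain S where S: "card S \<le> k" "onset S" "\<And>w. (\<And>s. s \<in> S \<Longrightarrow> cinner s w = 0) \<Longrightarrow> B w = 0"
    using finite_rank_singular_system[OF p(1) B_class] rank unfolding B_def[symmetric] by metis
  define c where "c = schatten_norm p A + schatten_norm p B"
  define K where "K = schatten_norm p A powr p + real (card S) * c powr p"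
  have c: "0 \<le> c" unfolding c_def by (intro add_nonneg_nonneg schatten_norm_nonneg)
  have "schatten_norm p (T x) / lq_norm q x \<le> K powr (1 / p)" if x: "x \<noteq> 0" for x
  proof -
    obtain a b where ab: "x = (a, b)" by (cases x)
    define L where "L = lq_norm q x"
    have L: "0 < L" "cmod a \<le> L" "cmod b \<le> L"
      using lq_norm_pos[OF q x] lq_norm_ge[OF q] by (auto simp: L_def ab)
    have nT: "norm (T x w) \<le> L * norm (A w) + L * norm (B w)" for w
    proof -
      have "norm (T x w) \<le> cmod a * norm (A w) + cmod b * norm (B w)"
        unfolding ab T_eq using norm_triangle_ineq[of "a *\<^sub>C A w" "b *\<^sub>C B w"] by (simp add: norm_scaleC)
      also have "\<dots> \<le> L * norm (A w) + L * norm (B w)" using L by (intro add_mono mult_right_mono) auto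
      finally show ?thesis .
    qed
    have "schatten_norm p (T x) powr p \<le> L powr p * K"
    proof (rule schatten_norm_powr_le[OF p(1) T_class])
      fix S' :: "'h set"
      assume S': "onset S'" and d: "\<And>s y. s \<in> S' \<Longrightarrow> cinner s y = 0 \<Longrightarrow> cinner (T x s) (T x y) = 0"
      have "(\<Sum>s\<in>S'. norm (T x s) powr p)
          \<le> L powr p * schatten_norm p A powr p + real (card S) * (L * c) powr p"
      proof (rule sum_diagonal_le_schatten_norm[OF p(1) T_compact A_class L(1) onset_finite[OF S(2)] _ _ _ S'])
        show "norm (T x w) \<le> L * norm (A w)" if "\<And>z. z \<in> S \<Longrightarrow> cinner z w = 0" for w
          using nT[of w] S(3)[OF that] by simp
        show "\<forall>w. norm (T x w) \<le> L * c * norm w"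
        proof
          fix w
          have "L * norm (A w) + L * norm (B w) \<le> L * (schatten_norm p A * norm w) + L * (schatten_norm p B * norm w)"
            using L by (intro add_mono mult_left_mono norm_le_schatten_norm p A_class B_class) auto
          then show "norm (T x w) \<le> L * c * norm w" using nT[of w] by (simp add: c_def algebra_simps)
        qed
        show "cinner (T x s) (T x u) = 0" if "s \<in> S'" "u \<in> S'" "s \<noteq> u" for s u
          using that by (intro d) (auto simp: onset_cinner[OF S'])
      qed (use L c in auto)
      also have "\<dots> = L powr p * K" using L c by (simp add: K_def powr_mult algebra_simps)
      finally show "(\<Sum>s\<in>S'. norm (T x s) powr p) \<le> L powr p * K" .
    qed
    then have "(schatten_norm p (T x) powr p) powr (1 / p) \<le> (L powr p * K) powr (1 / p)"
      using p by (intro powr_mono2) auto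
    moreover have "0 \<le> K" by (simp add: K_def)
    ultimately have "schatten_norm p (T x) \<le> L * K powr (1 / p)"
      using p L schatten_norm_nonneg[of p "T x"] by (simp add: powr_powr powr_mult)
    then show ?thesis using L by (simp add: L_def divide_le_eq mult.commute)
  qed
  then show ?thesis by blast
qed

text \<open>Otherwise unit vectors along which the operator norm of \<open>T\<close> tends to 0
  would accumulate, by compactness of the sphere, at some \<open>l\<close> with
  \<open>T l = 0\<close>. The operator norm is at most the Schatten norm, so continuity of the
  latter is avoided.\<close>

lemma ratio_lower: "\<exists>c>0. \<forall>x. x \<noteq> 0 \<longrightarrow> c \<le> schatten_norm p (T x) / lq_norm q x"
proof -
  have T_scaleR: "T (r *\<^sub>R x) h = r *\<^sub>R T x h" for r x h
    by (cases x) (simp add: T_eq scaleR_scaleC scaleC_add_right scaleC_scaleC scaleC_complex_def)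
  have "\<exists>c>0. \<forall>y. norm y = 1 \<longrightarrow> (\<exists>h. c * norm h < norm (T y h))"
  proof (rule ccontr)
    assume neg: "\<not> (\<exists>c>0. \<forall>y. norm y = 1 \<longrightarrow> (\<exists>h. c * norm h < norm (T y h)))"
    have "\<exists>y. norm y = 1 \<and> (\<forall>h. norm (T y h) \<le> 1 / real (Suc n) * norm h)" for n
    proof -
      have "0 < 1 / real (Suc n)" by simp
      with neg show ?thesis by (meson linorder_not_less)
    qed
    then obtain Y where Y: "\<And>n. norm (Y n) = 1" "\<And>n h. norm (T (Y n) h) \<le> 1 / real (Suc n) * norm h"
      by metis
    have "compact (sphere (0::complex \<times> complex) 1)" by simp
    moreover have "Y n \<in> sphere 0 1" for n using Y(1) by simp
    ultimately obtain l r where l: "l \<in> sphere 0 1" and r: "strict_mono r" and "(Y \<circ> r) \<longlonglongrightarrow> l"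
      unfolding compact_eq_seq_compact_metric seq_compact_def by meson
    then have lim: "(\<lambda>n. Y (r n)) \<longlonglongrightarrow> l" by (simp add: o_def)
    have "T l h = 0" for h
    proof -
      have bl: "bounded_linear (\<lambda>c. c *\<^sub>C w)" for w :: 'h
        by (rule bounded_linear_intro[where K = "norm w"])
          (simp_all add: scaleC_add_left scaleR_scaleC[where 'a = 'h] scaleC_scaleC scaleR_conv_of_real norm_scaleC)
      have Tx: "T y h = fst y *\<^sub>C A h + snd y *\<^sub>C B h" for y using T_eq[of "fst y" "snd y" h] by simp
      have "(\<lambda>n. T (Y (r n)) h) \<longlonglongrightarrow> T l h"
        unfolding Tx by (intro tendsto_add bounded_linear.tendsto[OF bl] tendsto_fst tendsto_snd lim)
      moreover have "(\<lambda>n. T (Y (r n)) h) \<longlonglongrightarrow> 0"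
      proof (rule Lim_null_comparison)
        show "\<forall>\<^sub>F n in sequentially. norm (T (Y (r n)) h) \<le> 1 / real (Suc (r n)) * norm h"
          using Y(2) by (intro always_eventually) blast
        have "(\<lambda>n. 1 / real (Suc (r n))) \<longlonglongrightarrow> 0"
          using LIMSEQ_subseq_LIMSEQ[OF LIMSEQ_Suc[OF lim_1_over_n] r] by (simp add: o_def)
        then show "(\<lambda>n. 1 / real (Suc (r n)) * norm h) \<longlonglongrightarrow> 0" by (rule tendsto_mult_left_zero)
      qed
      ultimately show ?thesis by (rule LIMSEQ_unique)
    qed
    moreover have "l \<noteq> 0" using l by auto
    ultimately show False using T_nonzero by blast
  qed
  then obtain c where c: "0 < c" "\<And>y. norm y = 1 \<Longrightarrow> \<exists>h. c * norm h < norm (T y h)" by blast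
  have "c / 2 \<le> schatten_norm p (T x) / lq_norm q x" if x: "x \<noteq> 0" for x
  proof -
    obtain a b where ab: "x = (a, b)" by (cases x)
    define y where "y = (1 / norm x) *\<^sub>R x"
    have "norm y = 1" using x by (simp add: y_def)
    then obtain h where "c * norm h < norm (T y h)" using c(2) by blast
    then have h: "c * norm h * norm x < norm (T x h)" using x by (simp add: y_def T_scaleR field_simps)
    also have "\<dots> \<le> schatten_norm p (T x) * norm h" by (rule norm_le_schatten_norm[OF p(1) T_class])
    finally have "(c * norm x) * norm h < schatten_norm p (T x) * norm h" by (simp add: mult_ac)
    then have 1: "c * norm x < schatten_norm p (T x)" by (rule mult_right_less_imp_less) simp
    have "max (cmod a) (cmod b) \<le> norm x"
      using norm_fst_le[of a b] norm_snd_le[of b a] by (simp add: ab)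
    then have "lq_norm q x \<le> 2 * norm x" using lq_norm_le[OF q, of a b] unfolding ab by linarith
    then have "c / 2 * lq_norm q x \<le> c * norm x" using c(1) by (simp add: field_simps)
    then show ?thesis using 1 lq_norm_pos[OF q x] by (simp add: le_divide_eq)
  qed
  then show ?thesis using c(1) by (intro exI[of _ "c / 2"]) auto
qed

definition M :: real where "M = upper_const p q T"
definition m :: real where "m = lower_const p q T"

lemma nonempty: "- {0 :: complex \<times> complex} \<noteq> {}"
  by (metis Compl_iff empty_iff singletonD zero_neq_one zero_prod_def fst_conv)

lemma le_M:
  assumes "x \<noteq> 0" shows "schatten_norm p (T x) \<le> M * lq_norm q x"
proof -
  obtain K where K: "\<And>x. x \<noteq> 0 \<Longrightarrow> schatten_norm p (T x) / lq_norm q x \<le> K" using ratio_upper by blast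
  have "schatten_norm p (T x) / lq_norm q x \<le> M"
    unfolding M_def upper_const_def using assms K by (intro cSUP_upper bdd_aboveI[of _ K]) auto
  then show ?thesis using lq_norm_pos[OF q assms] by (simp add: divide_le_eq)
qed

lemma m_le:
  assumes "x \<noteq> 0" shows "m * lq_norm q x \<le> schatten_norm p (T x)"
proof -
  obtain c where c: "\<And>x. x \<noteq> 0 \<Longrightarrow> c \<le> schatten_norm p (T x) / lq_norm q x" using ratio_lower by blast
  have "m \<le> schatten_norm p (T x) / lq_norm q x"
    unfolding m_def lower_const_def using assms c by (intro cINF_lower bdd_belowI[of _ c]) auto
  then show ?thesis using lq_norm_pos[OF q assms] by (simp add: le_divide_eq)
qed

lemma m_pos: "0 < m"
proof -
  obtain c where c: "0 < c" "\<And>x. x \<noteq> 0 \<Longrightarrow> c \<le> schatten_norm p (T x) / lq_norm q x"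
    using ratio_lower by blast
  have "c \<le> m" unfolding m_def lower_const_def using c(2) by (intro cINF_greatest nonempty) auto
  then show ?thesis using c(1) by simp
qed

lemma norm_A: "m \<le> schatten_norm p A" "schatten_norm p A \<le> M"
  and norm_B: "m \<le> schatten_norm p B" "schatten_norm p B \<le> M"
  using m_le[of "(1, 0)"] m_le[of "(0, 1)"] le_M[of "(1, 0)"] le_M[of "(0, 1)"]
  by (simp_all add: lq_norm_axis[OF q] A_def B_def zero_prod_def)

lemma pencil_eq: "pencil A B z = T (1, z)"
  by (simp add: pencil_def fun_eq_iff T_eq scaleC_one)

text \<open>\<open>V\<close> is spanned by an arbitrary finite system \<open>J\<close> of singular
  vectors of \<open>A\<close> and a complete system \<open>SB\<close> for \<open>B\<close>. Varying
  \<open>J\<close> recovers \<open>schatten_norm p A\<close>, while \<open>SB\<close> keeps the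
  whole Hilbert-Schmidt sum of \<open>B\<close> inside \<open>V\<close>.\<close>

lemma key_inequality:
  assumes t: "0 < t" "t \<le> 1"
  shows "m powr p + p\<^sup>2 / 4 * (M + t * M) powr (p - 2) * t\<^sup>2 * (real k powr (1 - 2 / p) * m\<^sup>2)
    \<le> M powr p * Phi p q t"
proof -
  define R where "R = M + t * M"
  have M: "0 < M" using norm_A m_pos by linarith
  have R: "0 < R" unfolding R_def using M t by (intro add_pos_pos mult_pos_pos)
  obtain SB where SB: "onset SB" "card SB \<le> k"
    "\<And>s y. s \<in> SB \<Longrightarrow> cinner s y = 0 \<Longrightarrow> cinner (B s) (B y) = 0"
    "schatten_norm p B powr p = (\<Sum>s\<in>SB. norm (B s) powr p)"
    by (rule finite_rank_singular_system[OF p(1) B_class rank[folded B_def]]) (rule that; blast)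
  define \<beta> where "\<beta> = (\<Sum>s\<in>SB. (norm (B s))\<^sup>2)"
  define c where "c = p\<^sup>2 / 4 * R powr (p - 2) * t\<^sup>2"
  have "real k powr (1 - 2 / p) * m\<^sup>2 \<le> real k powr (1 - 2 / p) * (schatten_norm p B)\<^sup>2"
    using norm_B m_pos by (intro mult_left_mono power_mono) auto
  also have "(schatten_norm p B)\<^sup>2 = (schatten_norm p B powr p) powr (2 / p)"
    using p norm_B m_pos by (simp add: powr_powr)
  also have "real k powr (1 - 2 / p) * \<dots> \<le> \<beta>"
    unfolding SB(4) \<beta>_def by (rule sum_powr_le_sum_squares[OF onset_finite[OF SB(1)] SB(2) p k_pos]) simp
  finally have \<beta>: "real k powr (1 - 2 / p) * m\<^sup>2 \<le> \<beta>" .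
  have "schatten_norm p A powr p \<le> M powr p * Phi p q t - c * \<beta>"
  proof (rule schatten_norm_powr_le[OF p(1) A_class])
    fix J :: "'h set"
    assume J: "onset J" "\<And>s y. s \<in> J \<Longrightarrow> cinner s y = 0 \<Longrightarrow> cinner (A s) (A y) = 0"
    define V where "V = cspan (J \<union> SB)"
    have fin: "finite (J \<union> SB)" using J(1) SB(1) by (simp add: onset_finite)
    obtain S where S: "onset S" "cspan S = V" unfolding V_def by (rule onset_basis_exists[OF fin])
    have V: "csubspace V" "closed V" "V \<subseteq> cspan (J \<union> SB)" 
      unfolding V_def using cspan_onset_closed[OF S(1)] S(2) by (auto simp: V_def)
    have sub: "J \<subseteq> V" "SB \<subseteq> V" using complex_vector.span_superset[of "J \<union> SB"] by (simp_all add: V_def)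
    note extend = onset_extend_diagonal[OF _ V fin]
    obtain SA where SA: "J \<subseteq> SA" "onset SA" "cspan SA = V" "diagonalizes A SA"
      using extend[OF A_compact J(1) sub(1) J(2)] unfolding diagonalizes_def by metis
    obtain S1 where S1: "SB \<subseteq> S1" "onset S1" "cspan S1 = V"
      using extend[OF B_compact SB(1) sub(2) SB(3)] by metis
    \<comment> \<open>At the centre the basis must be \<open>SA\<close>, which contains
      \<open>J\<close>; elsewhere any eigenbasis of \<open>V\<close> will do.\<close>
    have "\<exists>S. onset S \<and> cspan S = V \<and> diagonalizes (pencil A B z) S \<and> (z = 0 \<longrightarrow> S = SA)" for z
    proof (cases "z = 0")
      case True
      then show ?thesis using SA by (intro exI[of _ SA]) (simp add: pencil_def)
    next
      case False
      have "onset {}" by (simp add: onset_def)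
      then obtain S where "onset S" "cspan S = V" "diagonalizes (pencil A B z) S"
        using extend[OF _ _ empty_subsetI, of "pencil A B z"] T_compact
        unfolding diagonalizes_def pencil_eq by (metis empty_iff)
      then show ?thesis using False by blast
    qed
    then obtain v where v: "\<And>z. onset (v z)" "\<And>z. cspan (v z) = V"
      "\<And>z. diagonalizes (pencil A B z) (v z)" "v 0 = SA" by metis
    \<comment> \<open>\<open>M\<close> bounds both operator norms, since these are at most the
      Schatten norms of the images of two unit vectors; hence the bound \<open>M + t * M\<close> on
      the disc.\<close>
    interpret P: compact_pencil A B v V "p / 2" M M t
    proof
      show "compact_operator (pencil A B z)" for z by (simp add: pencil_eq T_compact)
      show "norm (A x) \<le> M * norm x" for x
        using norm_le_schatten_norm[OF p(1) A_class, of x] mult_right_mono[OF norm_A(2) norm_ge_zero[of x]]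
        by linarith
      show "norm (B x) \<le> M * norm x" for x
        using norm_le_schatten_norm[OF p(1) B_class, of x] mult_right_mono[OF norm_B(2) norm_ge_zero[of x]]
        by linarith
    qed (use v B_compact p t M in auto)
    have PR: "P.R = R" by (simp add: P.R_def R_def)
    have "(\<Sum>s\<in>v 0. norm (A s) powr p) + p\<^sup>2 / 4 * P.R powr (p - 2) * t\<^sup>2 * P.hs \<le> M powr p * Phi p q t"
    proof (rule P.schatten_mean_value)
      show "0 < P.R" using R PR by simp
      show "p = 2 * (p / 2)" by simp
      fix z assume z: "cmod z = t"
      have "(\<Sum>s\<in>v z. norm (T (1, z) s) powr p) \<le> schatten_norm p (T (1, z)) powr p"
        using v(1,3)[of z] by (intro diagonal_sum_le_schatten_norm p T_class) (auto simp: diagonalizes_def pencil_eq)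
      also have "\<dots> \<le> (M * lq_norm q (1, z)) powr p"
        using p schatten_norm_nonneg by (intro powr_mono2 le_M) (auto simp: zero_prod_def)
      also have "\<dots> = M powr p * Phi p q t"
        using M lq_norm_pos[OF q, of "(1, z)"] z t lq_norm_powr_eq_Phi[OF q, of z p]
        by (simp add: powr_mult zero_prod_def)
      finally show "(\<Sum>s\<in>v z. norm (pencil A B z s) powr p) \<le> M powr p * Phi p q t"
        by (simp add: pencil_eq)
    qed
    moreover have "(\<Sum>s\<in>J. norm (A s) powr p) \<le> (\<Sum>s\<in>v 0. norm (A s) powr p)"
      unfolding v(4) using SA onset_finite by (intro sum_mono2) auto
    moreover have "\<beta> \<le> P.hs"
    proof -
      have "\<beta> \<le> (\<Sum>s\<in>S1. (norm (B s))\<^sup>2)"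
        unfolding \<beta>_def using S1 onset_finite by (intro sum_mono2) auto
      also have "\<dots> = P.hs"
        unfolding P.hs_def by (rule hilbert_schmidt_basis_indep[OF B_compact S1(2) v(1)]) (simp only: S1(3) v(2))
      finally show ?thesis .
    qed
    then have "c * \<beta> \<le> c * P.hs" by (intro mult_left_mono) (auto simp: c_def)
    ultimately show "(\<Sum>s\<in>J. norm (A s) powr p) \<le> M powr p * Phi p q t - c * \<beta>"
      unfolding PR c_def by linarith
  qed
  moreover have "m powr p \<le> schatten_norm p A powr p" using norm_A m_pos p by (intro powr_mono2) auto
  moreover have "c * (real k powr (1 - 2 / p) * m\<^sup>2) \<le> c * \<beta>"
    using \<beta> by (intro mult_left_mono) (auto simp: c_def)
  ultimately show ?thesis unfolding c_def R_def by linarith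
qed

lemma bound_at_le_distortion:
  assumes t: "0 < t" "t \<le> 1"
  shows "bound_at p q k t \<le> (distortion p q T)\<^sup>2"
proof -
  define D where "D = M / m"
  have M: "0 < M" "m \<le> M" using norm_A m_pos by linarith+
  have D: "1 \<le> D" unfolding D_def using M m_pos by (simp add: le_divide_eq)
  define X where "X = p\<^sup>2 / 4 * real k powr (1 - 2 / p) * t\<^sup>2 * (1 + t) powr (p - 2)"
  define \<Phi> where "\<Phi> = Phi p q t"
  have \<Phi>: "1 \<le> \<Phi>" unfolding \<Phi>_def using Phi_ge_1[OF p(1) q t(1)] .
  have "(M + t * M) powr (p - 2) = (1 + t) powr (p - 2) * M powr (p - 2)"
    using M t powr_mult[of "1 + t" M "p - 2"] by (simp add: algebra_simps)
  then have "m powr p + X * m\<^sup>2 * M powr (p - 2) \<le> M powr p * \<Phi>"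
    using key_inequality[OF t] by (simp add: X_def \<Phi>_def mult_ac)
  then have "(m powr p + X * m\<^sup>2 * M powr (p - 2)) * (M powr (2 - p) / m\<^sup>2)
      \<le> M powr p * \<Phi> * (M powr (2 - p) / m\<^sup>2)"
    by (intro mult_right_mono) auto
  moreover have "M powr (p - 2) * M powr (2 - p) = 1" using M by (simp add: powr_add[symmetric])
  moreover have "M powr p * M powr (2 - p) = M\<^sup>2" using M by (simp add: powr_add[symmetric])
  moreover have "m powr p * (M powr (2 - p) / m\<^sup>2) = D powr (2 - p)"
  proof -
    have "m\<^sup>2 = m powr p * m powr (2 - p)" using m_pos by (simp add: powr_add[symmetric])
    then show ?thesis using m_pos M by (simp add: D_def powr_divide)
  qed
  moreover have "(m powr p + X * m\<^sup>2 * M powr (p - 2)) * (M powr (2 - p) / m\<^sup>2)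
      = m powr p * (M powr (2 - p) / m\<^sup>2) + X * (M powr (p - 2) * M powr (2 - p))"
    using m_pos by (simp add: field_simps)
  moreover have "M powr p * \<Phi> * (M powr (2 - p) / m\<^sup>2) = (M powr p * M powr (2 - p)) * \<Phi> / m\<^sup>2"
    by simp
  moreover have "M\<^sup>2 * \<Phi> / m\<^sup>2 = D\<^sup>2 * \<Phi>" by (simp add: D_def power_divide)
  ultimately have "D powr (2 - p) + X \<le> D\<^sup>2 * \<Phi>" by (simp only: mult_1_right)
  \<comment> \<open>The rescaling leaves this factor in place of the leading 1; it is at least 1
    because \<open>D \<ge> 1\<close> and \<open>p \<le> 2\<close>.\<close>
  moreover have "1 \<le> D powr (2 - p)" using D p by (intro ge_one_powr_ge_zero) auto
  ultimately have "1 + X \<le> D\<^sup>2 * \<Phi>" by linarith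
  then have "(1 + X) / \<Phi> \<le> D\<^sup>2" using \<Phi> by (simp add: divide_le_eq)
  then show ?thesis
    by (simp add: bound_at_def X_def \<Phi>_def D_def distortion_def M_def m_def)
qed

lemma distortion_bound_le: "distortion_bound p q k \<le> (distortion p q T)\<^sup>2"
  unfolding distortion_bound_def bound_at_def[symmetric]
  by (intro cSUP_least bound_at_le_distortion) auto

end

section \<open>The distortion inequality on Hilbert space and for matrices\<close>

lemma distortion_lower_bound:
  fixes T :: "complex \<times> complex \<Rightarrow> 'h::complex_hilbert_space \<Rightarrow> 'h"
  assumes "0 < p" "p \<le> 2" "2 < q"
    and "clinear T" "inj T" "range T \<subseteq> schatten_class p" "crank (T (0, 1)) \<le> enat k"
  shows "(distortion p q T)\<^sup>2 \<ge> distortion_bound p q k \<and> distortion_bound p q k > 1"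
proof -
  interpret schatten_embedding p q T k by (rule schatten_embedding.intro[OF assms])
  show ?thesis using distortion_bound_le distortion_bound_gt_1[OF assms(1-3) k_pos] by blast
qed

theorem theorem3p5:
  fixes p :: real and q :: ereal
  assumes "0 < p" and "p \<le> 2" and "2 < q"
  shows "(\<forall>(T :: complex \<times> complex \<Rightarrow> 'h::complex_hilbert_space \<Rightarrow> 'h) k.
            clinear T \<and> inj T \<and> range T \<subseteq> schatten_class p \<and> crank (T (0, 1)) \<le> enat k \<longrightarrow>
              (distortion p q T)\<^sup>2 \<ge> distortion_bound p q k \<and> distortion_bound p q k > 1) \<and>
         (\<forall>T :: complex \<times> complex \<Rightarrow> complex ^ 'n \<Rightarrow> complex ^ 'n.
            clinear T \<and> inj T \<and> range T \<subseteq> schatten_class p \<longrightarrow>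
              (distortion p q T)\<^sup>2 \<ge> distortion_bound p q CARD('n) \<and>
              distortion_bound p q CARD('n) > 1)"
proof -
  \<comment> \<open>The range lies in the span of the standard basis, which reduces the matrix case
    to the first one with \<open>k\<close> equal to the dimension.\<close>
  have rank: "crank F \<le> enat CARD('n)" for F :: "complex ^ 'n \<Rightarrow> complex ^ 'n"
  proof -
    define \<delta> :: "'n \<Rightarrow> complex ^ 'n" where "\<delta> i = axis i 1" for i
    have "x \<in> cspan (range \<delta>)" for x
    proof -
      have "x = (\<Sum>i\<in>UNIV. (x $ i) *\<^sub>C \<delta> i)"
        by (simp add: vec_eq_iff scaleC_vec_def scaleC_complex_def \<delta>_def axis_def if_distrib cong: if_cong)
      also have "\<dots> \<in> cspan (range \<delta>)"
        by (intro complex_vector.span_sum complex_vector.span_scale complex_vector.span_base rangeI)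
      finally show ?thesis .
    qed
    then have sub: "range F \<subseteq> cspan (range \<delta>)" by blast
    have "cdim (range F) \<le> card (range \<delta>)" by (rule complex_vector.dim_le_card[OF sub]) simp
    also have "\<dots> \<le> CARD('n)" by (rule card_image_le) simp
    finally have "cdim (range F) \<le> CARD('n)" .
    moreover have "\<exists>B. finite B \<and> range F \<subseteq> cspan B" using sub by (intro exI[of _ "range \<delta>"]) simp
    ultimately show ?thesis by (simp add: crank_def)
  qed
  show ?thesis
    by (rule conjI; intro allI impI; elim conjE; rule distortion_lower_bound[OF assms]; (assumption | rule rank))
qed

end
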